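(* Let $g\ge 0$. The application $\mathrm{Mob}$ defines a bijection between the set of rooted and pointed Eulerian maps of genus $g$ with $n$ edges and the set of $g$-mobiles with $n$ edges. This bijection sends a map which has $n_i$ white faces of degree $i$ for all $i$, $b$ black faces and $v$ vertices to a $g$-mobile which has $n_i$ white unlabelled vertices of degree $i$ for all $i$, $b$ black unlabelled vertices and $v-1$ labelled vertices.
   Context: Maps on the closed orientable surface $\mathcal{S}_g$ of genus $g$ are embeddings of finite connected graphs (loops and multiple edges allowed) whose faces are simply connected, up to orientation-preserving homeomorphism. An Eulerian map is a map whose faces are coloured black and white with adjacent faces of different colours; it is rooted (a distinguished oriented edge, oriented with a black face on its right) and pointed (a distinguished vertex $v_0$). A $g$-tree is a map on $\mathcal{S}_g$ with exactly one face. Construction $\mathrm{Mob}(\mathfrak{m})$ for a rooted pointed Eulerian map $\mathfrak{m}$: (1) orient every edge so that it has a black face on its right; label every vertex $v$ by the minimum number of oriented edges of an oriented path from $v_0$ to $v$. (2) Inside each face add a new (unlabelled) vertex of the colour of the face. Inside each white face $F$, for each edge $e$ incident to $F$: if the label increases by $1$ along $e$, add a new edge between the central vertex of $F$ and the endpoint of $e$ of greater label; if the label decreases by some $\tau\ge 0$ along $e$, add a new edge crossing $e$ between the central vertices of the two faces separated by $e$, and mark each side of this new edge with a flag labelled by the label of the endpoint of $e$ lying on that side. (3) Erase all original edges of $\mathfrak{m}$ and the vertex $v_0$. (4) The root is the new edge associated with the root edge of $\mathfrak{m}$, oriented leaving a white unlabelled vertex; the root label is the label of the labelled vertex adjacent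 to the root edge if it exists, and otherwise the label of the flag on the left side of the root edge; all labels are then shifted by the opposite of the root label. A $g$-mobile is a rooted $g$-tree $\mathfrak{t}$ such that: (i) its vertices are of three types: unlabelled black, unlabelled white, and labelled vertices carrying integer labels; (ii) each edge either joins a labelled vertex to a white unlabelled vertex, or joins two unlabelled vertices of different colours, in which case it carries on each side a flag labelled by an integer; (iii-w) clockwise around a white unlabelled vertex, a labelled vertex of label $l$ is followed by a label $l-1$ (vertex or flag), and two successive flags of labels $l,l'$ lying on the same edge satisfy $l'\ge l$, the second flag being followed by a label $l'$ (vertex or flag); (iii-b) clockwise around a black unlabelled vertex, two flags of labels $l,l'$ lying on the same edge satisfy $l'\le l$, and the second flag is followed by a flag labelled $\ge l'$; (iv) the root edge is oriented leaving a white unlabelled vertex, and the root label (the label of the labelled vertex adjacent to the root if it exists, otherwise the label of the flag on its left side) equals $0$. *)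

theory Defs
  imports Main "HOL-Combinatorics.Permutations" "HOL-Combinatorics.Orbits"
begin

text \<open>
  A map on a closed oriented surface is given by its rotation system.  A dart is an edge together
  with one of its two orientations; \<open>rot m x\<close> is the dart that follows \<open>x\<close> counterclockwise among
  the darts leaving the same vertex, and \<open>opp m x\<close> is \<open>x\<close> with the opposite orientation.
  Loops and multiple edges are allowed.
\<close>

record 'd cmap =
  darts :: "'d set"
  rot :: "'d \<Rightarrow> 'd"
  opp :: "'d \<Rightarrow> 'd"

text \<open>
  A vertex is identified with the set of the darts leaving it, and a face with the set of the darts
  having it on their left; walking along its boundary with the face on the left, one turns into
  the first dart clockwise from the reversal of the current one.  So the degree of a vertex or of a
  face is its cardinality.
\<close>

definition vertex :: "('d, 'z) cmap_scheme \<Rightarrow> 'd \<Rightarrow> 'd set" where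
  "vertex m x = orbit (rot m) x"

definition face_step :: "('d, 'z) cmap_scheme \<Rightarrow> 'd \<Rightarrow> 'd" where
  "face_step m x = inv (rot m) (opp m x)"

definition face :: "('d, 'z) cmap_scheme \<Rightarrow> 'd \<Rightarrow> 'd set" where
  "face m x = orbit (face_step m) x"

definition vertices :: "('d, 'z) cmap_scheme \<Rightarrow> 'd set set" where
  "vertices m = vertex m ` darts m"

definition edges :: "('d, 'z) cmap_scheme \<Rightarrow> 'd set set" where
  "edges m = (\<lambda>x. {x, opp m x}) ` darts m"

definition faces :: "('d, 'z) cmap_scheme \<Rightarrow> 'd set set" where
  "faces m = face m ` darts m"

definition connected_map :: "('d, 'z) cmap_scheme \<Rightarrow> bool" where
  "connected_map m \<longleftrightarrow>
     (\<forall>x\<in>darts m. \<forall>y\<in>darts m.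
        (x, y) \<in> ({(z, rot m z) | z. z \<in> darts m} \<union> {(z, opp m z) | z. z \<in> darts m})\<^sup>*)"

text \<open>
  The map with one vertex and no edge is left out: it has no dart, and all maps considered below
  are rooted at an edge.
\<close>

definition is_map :: "('d, 'z) cmap_scheme \<Rightarrow> bool" where
  "is_map m \<longleftrightarrow>
     finite (darts m) \<and> darts m \<noteq> {} \<and>
     rot m permutes darts m \<and> opp m permutes darts m \<and>
     (\<forall>x\<in>darts m. opp m x \<noteq> x \<and> opp m (opp m x) = x) \<and>
     connected_map m"

definition has_genus :: "('d, 'z) cmap_scheme \<Rightarrow> nat \<Rightarrow> bool" where
  "has_genus m g \<longleftrightarrow>
     int (card (vertices m)) - int (card (edges m)) + int (card (faces m)) = 2 - 2 * int g"

text \<open>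
  Orientation-preserving homeomorphisms of embedded graphs correspond to bijections of the darts
  that commute with \<open>rot\<close> and \<open>opp\<close>.
\<close>

definition map_iso :: "('d \<Rightarrow> 'e) \<Rightarrow> ('d, 'y) cmap_scheme \<Rightarrow> ('e, 'z) cmap_scheme \<Rightarrow> bool" where
  "map_iso f m m' \<longleftrightarrow>
     bij_betw f (darts m) (darts m') \<and>
     (\<forall>x\<in>darts m. f (rot m x) = rot m' (f x) \<and> f (opp m x) = opp m' (f x))"


datatype colour = Black | White

record 'd emap = "'d cmap" +
  fcol :: "'d set \<Rightarrow> colour"
  root :: 'd
  point :: "'d set"

text \<open>The faces on the left and on the right of \<open>x\<close> are \<open>face m x\<close> and \<open>face m (opp m x)\<close>.\<close>

definition eulerian_map :: "'d emap \<Rightarrow> bool" where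
  "eulerian_map m \<longleftrightarrow>
     is_map m \<and> (\<forall>x\<in>darts m. fcol m (face m x) \<noteq> fcol m (face m (opp m x)))"

definition black_right :: "'d emap \<Rightarrow> 'd \<Rightarrow> bool" where
  "black_right m x \<longleftrightarrow> fcol m (face m (opp m x)) = Black"

definition rp_eulerian_map :: "'d emap \<Rightarrow> bool" where
  "rp_eulerian_map m \<longleftrightarrow>
     eulerian_map m \<and> root m \<in> darts m \<and> black_right m (root m) \<and> point m \<in> vertices m"

definition emap_rel :: "('d emap \<times> 'd emap) set" where
  "emap_rel = {(m, m'). rp_eulerian_map m \<and> rp_eulerian_map m' \<and>
     (\<exists>f. map_iso f m m' \<and> (\<forall>F\<in>faces m. fcol m' (f ` F) = fcol m F) \<and>
          f (root m) = root m' \<and> f ` point m = point m')}"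

definition rp_eulerian_maps :: "nat \<Rightarrow> nat \<Rightarrow> 'd emap set" where
  "rp_eulerian_maps g n = {m. rp_eulerian_map m \<and> has_genus m g \<and> card (edges m) = n}"


datatype vkind = Unlabelled colour | Labelled int

text \<open>
  \<open>flag t x\<close> is the flag on the left side of \<open>x\<close>, so that the flag on its right side is
  \<open>flag t (opp t x)\<close>.  It is meaningful only if \<open>x\<close> joins two unlabelled vertices.
\<close>

record 'd mobile = "'d cmap" +
  kind :: "'d set \<Rightarrow> vkind"
  flag :: "'d \<Rightarrow> int"
  mroot :: 'd

definition flagged :: "'d mobile \<Rightarrow> 'd \<Rightarrow> bool" where
  "flagged t x \<longleftrightarrow>
     (\<exists>c c'. kind t (vertex t x) = Unlabelled c \<and> kind t (vertex t (opp t x)) = Unlabelled c')"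

text \<open>
  Reading clockwise around the origin of \<open>x\<close>, an edge shows its left side first.  So the first
  label met on \<open>x\<close> is that of the labelled vertex at its other end, if there is one, and otherwise
  the flag on its left side.
\<close>

definition first_label :: "'d mobile \<Rightarrow> 'd \<Rightarrow> int" where
  "first_label t x =
     (case kind t (vertex t (opp t x)) of Labelled l \<Rightarrow> l | Unlabelled c \<Rightarrow> flag t x)"

definition root_label :: "'d mobile \<Rightarrow> int" where
  "root_label t = first_label t (mroot t)"

abbreviation next_cw :: "'d mobile \<Rightarrow> 'd \<Rightarrow> 'd" where
  "next_cw t \<equiv> inv (rot t)"

definition gtree :: "nat \<Rightarrow> ('d, 'z) cmap_scheme \<Rightarrow> bool" where
  "gtree g t \<longleftrightarrow> is_map t \<and> has_genus t g \<and> card (faces t) = 1"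

definition mobile_edges_ok :: "'d mobile \<Rightarrow> bool" where
  "mobile_edges_ok t \<longleftrightarrow>
     (\<forall>x\<in>darts t. \<exists>y\<in>{x, opp t x}.
        kind t (vertex t y) = Unlabelled White \<and>
        ((\<exists>l. kind t (vertex t (opp t y)) = Labelled l) \<or>
         kind t (vertex t (opp t y)) = Unlabelled Black))"

definition mobile_white_ok :: "'d mobile \<Rightarrow> bool" where
  "mobile_white_ok t \<longleftrightarrow>
     (\<forall>x\<in>darts t. kind t (vertex t x) = Unlabelled White \<longrightarrow>
        (case kind t (vertex t (opp t x)) of
           Labelled l \<Rightarrow> first_label t (next_cw t x) = l - 1
         | Unlabelled c \<Rightarrow>
             flag t x \<le> flag t (opp t x) \<and> first_label t (next_cw t x) = flag t (opp t x)))"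

definition mobile_black_ok :: "'d mobile \<Rightarrow> bool" where
  "mobile_black_ok t \<longleftrightarrow>
     (\<forall>x\<in>darts t. kind t (vertex t x) = Unlabelled Black \<longrightarrow>
        flag t (opp t x) \<le> flag t x \<and> flag t (opp t x) \<le> flag t (next_cw t x))"

definition gmobile :: "nat \<Rightarrow> 'd mobile \<Rightarrow> bool" where
  "gmobile g t \<longleftrightarrow>
     gtree g t \<and> mobile_edges_ok t \<and> mobile_white_ok t \<and> mobile_black_ok t \<and>
     mroot t \<in> darts t \<and> kind t (vertex t (mroot t)) = Unlabelled White \<and> root_label t = 0"

definition mobile_rel :: "('d mobile \<times> 'd mobile) set" where
  "mobile_rel = {(t, t'). (\<exists>g. gmobile g t) \<and> (\<exists>g. gmobile g t') \<and>
     (\<exists>f. map_iso f t t' \<and> (\<forall>v\<in>vertices t. kind t' (f ` v) = kind t v) \<and>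
          (\<forall>x\<in>darts t. flagged t x \<longrightarrow> flag t' (f x) = flag t x) \<and>
          f (mroot t) = mroot t')}"

definition gmobiles :: "nat \<Rightarrow> nat \<Rightarrow> 'd mobile set" where
  "gmobiles g n = {t. gmobile g t \<and> card (edges t) = n}"


definition arcs :: "'d emap \<Rightarrow> ('d set \<times> 'd set) set" where
  "arcs m = {(vertex m x, vertex m (opp m x)) | x. x \<in> darts m \<and> black_right m x}"

definition label :: "'d emap \<Rightarrow> 'd set \<Rightarrow> int" where
  "label m v = int (LEAST k. (point m, v) \<in> arcs m ^^ k)"

text \<open>
  Along an oriented edge the label increases by at most \<open>1\<close>, so an edge that is not increasing is
  one along which the label decreases by some \<open>\<tau> \<ge> 0\<close>.
\<close>

definition increasing :: "'d emap \<Rightarrow> 'd \<Rightarrow> bool" where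
  "increasing m x \<longleftrightarrow> label m (vertex m (opp m x)) = label m (vertex m x) + 1"

text \<open>
  Each edge of \<open>m\<close> gives one new edge, and the new map is built on the darts of \<open>m\<close>.  If \<open>x\<close> is an
  edge oriented with its black face on the right, then \<open>x\<close> also denotes the new edge associated with
  it, oriented from the centre of the white face on the left of \<open>x\<close>, and \<open>opp m x\<close> the reversed new
  edge, which leaves either the endpoint of \<open>x\<close> (increasing case) or the centre of the black face
  on the right of \<open>x\<close>.  \<open>mob_kind m y\<close> is the kind of the vertex that the new dart \<open>y\<close> leaves.
\<close>

definition mob_kind :: "'d emap \<Rightarrow> 'd \<Rightarrow> vkind" where
  "mob_kind m y =
     (if black_right m y then Unlabelled White
      else if increasing m (opp m y) then Labelled (label m (vertex m y))
      else Unlabelled Black)"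

definition first_return :: "('d \<Rightarrow> 'd) \<Rightarrow> ('d \<Rightarrow> bool) \<Rightarrow> 'd \<Rightarrow> 'd" where
  "first_return f P x = (f ^^ (LEAST k. 0 < k \<and> P ((f ^^ k) x))) x"

text \<open>
  Around the centre of a face, the new edges come in the order of the edges that they are associated
  with along the boundary of the face.  All the edges of a white face contribute, but only the
  non-increasing ones of a black face.  A new edge reaching a labelled vertex \<open>v\<close> for the increasing
  edge \<open>x\<close> arrives in the corner of \<open>v\<close> directly clockwise of \<open>opp m x\<close>, hence the new edges at \<open>v\<close>
  are ordered like the darts \<open>opp m x\<close>.  No increasing edge ends at the distinguished vertex, so
  this vertex disappears; each other vertex and each face keeps at least one new edge.
\<close>

definition mob_rot :: "'d emap \<Rightarrow> 'd \<Rightarrow> 'd" where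
  "mob_rot m y =
     (if y \<notin> darts m then y
      else case mob_kind m y of
        Unlabelled White \<Rightarrow> face_step m y
      | Unlabelled Black \<Rightarrow> first_return (face_step m) (\<lambda>z. mob_kind m z = Unlabelled Black) y
      | Labelled l \<Rightarrow> first_return (rot m) (\<lambda>z. \<exists>l'. mob_kind m z = Labelled l') y)"

text \<open>
  Flags: the new edge \<open>y\<close> crosses the original edge \<open>y\<close> so as to have the endpoint
  \<open>vertex m (opp m y)\<close> of the latter on its left.
  Kinds: \<open>mob_kind m\<close> is constant on each vertex of the new map.
\<close>

definition mob_unshifted :: "'d emap \<Rightarrow> 'd mobile" where
  "mob_unshifted m =
     \<lparr> darts = darts m, rot = mob_rot m, opp = opp m,
       kind = (\<lambda>v. the_elem (mob_kind m ` v)),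
       flag = (\<lambda>y. label m (vertex m (opp m y))),
       mroot = root m \<rparr>"

fun shift_kind :: "int \<Rightarrow> vkind \<Rightarrow> vkind" where
  "shift_kind c (Labelled l) = Labelled (l + c)"
| "shift_kind c (Unlabelled col) = Unlabelled col"

definition shift_labels :: "int \<Rightarrow> 'd mobile \<Rightarrow> 'd mobile" where
  "shift_labels c t = t \<lparr> kind := shift_kind c \<circ> kind t, flag := (\<lambda>x. flag t x + c) \<rparr>"

definition Mob :: "'d emap \<Rightarrow> 'd mobile" where
  "Mob m = shift_labels (- root_label (mob_unshifted m)) (mob_unshifted m)"

text \<open>
  \<open>Mob\<close> on isomorphism classes: the union of the classes of the images of all representatives,
  which is a single class exactly if these images are isomorphic.
\<close>

definition Mob_class :: "'d emap set \<Rightarrow> 'd mobile set" where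
  "Mob_class C = (\<Union>m\<in>C. mobile_rel `` {Mob m})"

end

theory Submission
  imports Defs
begin

text \<open>
  An Eulerian map is a triple of permutations of its edges: \<open>\<theta>\<close> around white faces, \<open>\<phi>\<close> around black
  faces, and their product around vertices.  The mobile keeps \<open>\<theta>\<close>, and its other rotation \<open>\<sigma>\<close> is the
  permutation induced by \<open>\<phi>\<close> on the non-increasing edges, together with that induced by the vertex
  rotation on the set \<open>L\<close> of increasing ones.  The contour of the mobile is \<open>\<theta> \<circ> \<sigma>\<close>; it rises
  by one at \<open>L\<close> and drops weakly elsewhere, so its rises and drops match like parentheses.

  On the map side, descending induction on the labels shows that \<open>n\<close> and \<open>\<phi> n\<close> are matched in this sense.
  Hence the mobile determines \<open>\<phi>\<close>; and because each vertex but the pointed one has an incoming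
  increasing edge, every cycle of the contour reaches the level of the pointed vertex, so there is only
  one.  Conversely, on a one-face mobile the matching defines a permutation \<open>\<phi>\<close> which induces \<open>\<sigma>\<close>, and
  exactly one vertex has no increasing edge; it is the pointed vertex, and the labels are the distances from it.
\<close>

text \<open>At a corner of a black vertex the contour may drop by any amount, so one drop can close
  several rises; this is the obstacle to reading black faces off the contour. The chain
  \<open>k, \<phi> k, \<phi> (\<phi> k), ...\<close> started at a non-increasing \<open>k\<close>
  spends one element of \<open>L\<close> per level of the drop before it lands on
  \<open>\<sigma> k\<close>. Hence the two clauses of \<open>F\<close>: the end of the chain, or the
  next rise closed by the same drop. The contour is cyclic and has no preferred start, so matching
  is expressed by first passages in both directions of time and not by positions in a word.

  \<open>F\<close> mentions only \<open>\<theta>\<close>, \<open>\<sigma>\<close> and comparisons of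
  heights. So it is blind to the shift that makes the root label zero, it is carried along by
  isomorphisms of mobiles, and it is single-valued even where it is not known to be total;
  injectivity of \<open>Mob\<close> on classes rests on this and not on an inverse construction.

  The genus reduces to counting: the edges are kept, the contour has one cycle, and the vertices of
  the mobile correspond to the faces and to the vertices other than the pointed one.\<close>

section \<open>Walks and first returns\<close>

text \<open>The starting point of a walk may satisfy \<open>P\<close>, all later points must not.\<close>

definition walk :: "('a \<Rightarrow> 'a) \<Rightarrow> ('a \<Rightarrow> bool) \<Rightarrow> 'a \<Rightarrow> 'a \<Rightarrow> bool" where
  "walk f P = (\<lambda>x y. y = f x \<and> \<not> P y)\<^sup>*\<^sup>*"

lemma walk_refl [simp, intro]: "walk f P x x"
  by (simp add: walk_def)

lemma walk_step: "walk f P x y \<Longrightarrow> \<not> P (f y) \<Longrightarrow> walk f P x (f y)"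
  unfolding walk_def by (metis (mono_tags, lifting) rtranclp.rtrancl_into_rtrancl)

lemma walk_step_left: "\<not> P (f x) \<Longrightarrow> walk f P (f x) y \<Longrightarrow> walk f P x y"
  unfolding walk_def by (metis (mono_tags, lifting) converse_rtranclp_into_rtranclp)

lemma walk_trans: "walk f P x y \<Longrightarrow> walk f P y z \<Longrightarrow> walk f P x z"
  unfolding walk_def by (rule rtranclp_trans)

lemma walk_mono: "walk f P x y \<Longrightarrow> (\<And>z. Q z \<Longrightarrow> P z) \<Longrightarrow> walk f Q x y"
  unfolding walk_def by (erule rtranclp_mono[THEN predicate2D, rotated]) auto

lemma walk_induct [consumes 1, case_names refl step]:
  assumes "walk f P x y" "R x" "\<And>y. walk f P x y \<Longrightarrow> R y \<Longrightarrow> \<not> P (f y) \<Longrightarrow> R (f y)"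
  shows "R y"
  using assms(1) unfolding walk_def
  by (induction rule: rtranclp_induct) (use assms(2,3) in \<open>auto simp: walk_def\<close>)

lemma walk_induct_left [consumes 1, case_names refl step]:
  assumes "walk f P x y" "R y" "\<And>x. walk f P (f x) y \<Longrightarrow> R (f x) \<Longrightarrow> \<not> P (f x) \<Longrightarrow> R x"
  shows "R x"
  using assms(1) unfolding walk_def
  by (induction rule: converse_rtranclp_induct) (use assms(2,3) in \<open>auto simp: walk_def\<close>)

lemma walk_cases_left:
  assumes "walk f P x y"
  obtains "x = y" | "\<not> P (f x)" "walk f P (f x) y"
  using assms unfolding walk_def by (metis (mono_tags, lifting) converse_rtranclpE)

lemma walk_cases_right:
  assumes "walk f P x y"
  obtains "x = y" | z where "walk f P x z" "y = f z" "\<not> P y"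
  using assms unfolding walk_def by (metis (mono_tags, lifting) rtranclp.cases)

lemma walk_in: "walk f P x y \<Longrightarrow> f ` N \<subseteq> N \<Longrightarrow> x \<in> N \<Longrightarrow> y \<in> N"
  by (induction rule: walk_induct) auto

lemma walk_funpow: "walk f P x y \<Longrightarrow> \<exists>i. (f ^^ i) x = y"
proof (induction rule: walk_induct)
  case refl
  then show ?case by (auto intro: exI[of _ 0])
next
  case (step y)
  then show ?case by (metis funpow.simps(2) comp_apply)
qed

text \<open>The orbit is deterministic: the shorter walk already faces a point of \<open>P\<close>,
  which the longer one would have to enter.\<close>

lemma walk_stop_unique:
  assumes "walk f P x k" "P (f k)" "walk f P x k'" "P (f k')"
  shows "k = k'"
  using assms(1,3)
proof (induction rule: walk_induct_left)
  case refl
  then show ?case using assms(2) by (auto elim: walk_cases_left)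
next
  case (step x)
  then show ?case using assms(4) by (metis walk_cases_left)
qed

text \<open>Injectivity makes predecessors unique, so both starts are the last point of
  \<open>P\<close> at or before \<open>n\<close>.\<close>

lemma walk_start_unique:
  assumes "inj_on f N" "f ` N \<subseteq> N" "x \<in> N" "x' \<in> N" "P x" "P x'" "walk f P x n" "walk f P x' n"
  shows "x = x'"
  using assms(7,8)
proof (induction rule: walk_induct)
  case refl
  then show ?case using assms(5) by (auto elim: walk_cases_right)
next
  case (step y)
  have "y \<in> N" using walk_in[OF step(1) assms(2,3)] .
  show ?case using step(4)
  proof (cases rule: walk_cases_right)
    case 1
    then show ?thesis using assms(6) step.hyps by auto
  next
    case (2 z)
    have "z \<in> N" using walk_in[OF 2(1) assms(2,4)] .
    then have "z = y" using 2 \<open>y \<in> N\<close> assms(1) by (metis inj_onD)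
    then show ?thesis using step.IH 2(1) by blast
  qed
qed

lemma walk_stop_exists:
  assumes "P ((f ^^ i) x)" "i > 0"
  shows "\<exists>k. walk f P x k \<and> P (f k)"
  using assms
proof (induction i arbitrary: x)
  case (Suc i)
  show ?case
  proof (cases "P (f x)")
    case False
    then have "i > 0" using Suc by (cases i) auto
    moreover have "P ((f ^^ i) (f x))" using Suc(2) by (simp add: funpow_swap1)
    ultimately obtain k where "walk f P (f x) k" "P (f k)" using Suc.IH by blast
    then show ?thesis using False walk_step_left by metis
  qed auto
qed auto

text \<open>The induction follows the orbit of \<open>y\<close> and keeps the latest point of
  \<open>P\<close> met so far.\<close>

lemma walk_start_exists:
  assumes "P y"
  shows "\<exists>x. P x \<and> walk f P x ((f ^^ i) y) \<and> (\<exists>j. x = (f ^^ j) y)"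
proof (induction i)
  case 0
  show ?case using assms by (auto intro!: exI[of _ y] exI[of _ 0])
next
  case (Suc i)
  then obtain x where x: "P x" "walk f P x ((f ^^ i) y)" "\<exists>j. x = (f ^^ j) y" by blast
  show ?case
  proof (cases "P (f ((f ^^ i) y))")
    case True
    moreover have "(f ^^ Suc i) y = f ((f ^^ i) y)" by simp
    ultimately have "P ((f ^^ Suc i) y)" by simp
    then show ?thesis by blast
  next
    case False
    then have "walk f P x ((f ^^ Suc i) y)" using x walk_step[of f P x "(f ^^ i) y"] by simp
    then show ?thesis using x by blast
  qed
qed

text \<open>Trades the \<open>LEAST\<close> of \<open>first_return\<close> for a walk, the form in
  which induced permutations are handled below.\<close>

lemma first_return_walk:
  assumes "walk f P x k" "P (f k)"
  shows "first_return f P x = f k"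
proof -
  have "\<exists>i. (f ^^ i) x = k \<and> (\<forall>j. 0 < j \<and> j \<le> i \<longrightarrow> \<not> P ((f ^^ j) x))"
    using assms(1)
  proof (induction rule: walk_induct)
    case refl
    then show ?case by (auto intro: exI[of _ 0])
  next
    case (step y)
    then obtain i where i: "(f ^^ i) x = y" "\<forall>j. 0 < j \<and> j \<le> i \<longrightarrow> \<not> P ((f ^^ j) x)" by blast
    then show ?case using step.hyps by (intro exI[of _ "Suc i"]) (auto simp: le_Suc_eq)
  qed
  then obtain i where i: "(f ^^ i) x = k" "\<forall>j. 0 < j \<and> j \<le> i \<longrightarrow> \<not> P ((f ^^ j) x)" by blast
  have "(LEAST j. 0 < j \<and> P ((f ^^ j) x)) = Suc i"
    using i assms(2) by (intro Least_equality) (auto simp: not_less_eq_eq[symmetric])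
  then show ?thesis using i by (simp add: first_return_def)
qed

text \<open>The ends shift by one because the start of a walk is unconstrained while all later
  points avoid \<open>P\<close>: backwards, \<open>f n\<close> is the free start and the last point
  entered is \<open>f x\<close>, not \<open>x\<close>.\<close>

lemma walk_reverse:
  assumes "walk f P x n" "f ` N \<subseteq> N" "x \<in> N" "\<And>z. z \<in> N \<Longrightarrow> g (f z) = z"
  shows "walk g P (f n) (f x)"
  using assms(1)
proof (induction rule: walk_induct)
  case (step y)
  have "y \<in> N" using walk_in[OF step(1) assms(2,3)] .
  then have "g (f (f y)) = f y" using assms(2,4) by blast
  then show ?case using step walk_step_left by metis
qed auto

lemma walk_hom:
  assumes "walk f P x y" "f ` N \<subseteq> N" "x \<in> N"
    "\<And>z. z \<in> N \<Longrightarrow> h (f z) = g (h z)" "\<And>z. z \<in> N \<Longrightarrow> Q (h z) \<Longrightarrow> P z"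
  shows "walk g Q (h x) (h y)"
  using assms(1)
proof (induction rule: walk_induct)
  case (step y)
  have "y \<in> N" using walk_in[OF step(1) assms(2,3)] .
  moreover have "f y \<in> N" using assms(2) calculation by blast
  ultimately show ?case using step assms(4,5) walk_step by metis
qed auto

section \<open>Permutations of finite sets\<close>

lemma bij_betw_selfI:
  assumes "finite N" "inj_on f N" "\<And>x. x \<in> N \<Longrightarrow> f x \<in> N"
  shows "bij_betw f N N"
  using assms by (metis bij_betw_imageI endo_inj_surj image_subsetI)

lemma funpow_in: "f ` N \<subseteq> N \<Longrightarrow> x \<in> N \<Longrightarrow> (f ^^ i) x \<in> N"
  by (induction i) auto

lemma funpow_returns:
  assumes "finite N" "bij_betw f N N" "x \<in> N"
  shows "\<exists>i>0. (f ^^ i) x = x"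
proof -
  have im: "f ` N \<subseteq> N" using assms(2) by (auto simp: bij_betw_def)
  have "\<not> inj (\<lambda>i. (f ^^ i) x)"
  proof
    assume "inj (\<lambda>i. (f ^^ i) x)"
    then have "infinite (range (\<lambda>i. (f ^^ i) x))" using finite_imageD by blast
    moreover have "range (\<lambda>i. (f ^^ i) x) \<subseteq> N" using funpow_in[OF im assms(3)] by auto
    ultimately show False using assms(1) finite_subset by blast
  qed
  then obtain i j where ij: "i < j" "(f ^^ i) x = (f ^^ j) x"
    unfolding inj_on_def by (metis nat_neq_iff)
  have inj: "inj_on (f ^^ i) N" for i
  proof (induction i)
    case (Suc i)
    show ?case
    proof (rule inj_onI)
      fix a b assume "a \<in> N" "b \<in> N" "(f ^^ Suc i) a = (f ^^ Suc i) b"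
      moreover have "(f ^^ i) a \<in> N" "(f ^^ i) b \<in> N" using calculation funpow_in[OF im] by auto
      ultimately show "a = b" using assms(2) Suc by (auto simp: bij_betw_def inj_on_def)
    qed
  qed auto
  have "(f ^^ i) ((f ^^ (j - i)) x) = (f ^^ i) x"
    using ij by (metis add_diff_inverse_nat comp_apply funpow_add nat_less_le not_less)
  then have "(f ^^ (j - i)) x = x" using inj[of i] funpow_in[OF im assms(3)] assms(3) by (meson inj_onD)
  then show ?thesis using ij by (intro exI[of _ "j - i"]) auto
qed

section \<open>The contour of a leveled tree\<close>

text \<open>
  Every edge is named after its dart \<open>n\<close> not leaving the centre of a white face, \<open>\<theta>\<close> moves to the next
  edge around that white face, and \<open>\<sigma>\<close> rotates around the mobile vertex which \<open>n\<close> leaves.  \<open>L\<close>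
  contains the edges incident to labelled vertices.  Along the original edge \<open>n\<close> the label
  goes from \<open>s n\<close> to \<open>s (\<theta> n)\<close>.
\<close>

locale leveled =
  fixes N :: "'a set" and \<theta> \<sigma> :: "'a \<Rightarrow> 'a" and s :: "'a \<Rightarrow> int" and L :: "'a set"
  assumes fin: "finite N"
    and bij_theta: "bij_betw \<theta> N N" and bij_sigma: "bij_betw \<sigma> N N"
    and L_sub: "L \<subseteq> N"
    and sigma_L: "\<And>n. n \<in> N \<Longrightarrow> \<sigma> n \<in> L \<longleftrightarrow> n \<in> L"
    and up: "\<And>l. l \<in> L \<Longrightarrow> s (\<theta> l) = s l + 1"
    and level: "\<And>l. l \<in> L \<Longrightarrow> s (\<theta> (\<sigma> l)) = s (\<theta> l)"
    and down: "\<And>k. k \<in> N - L \<Longrightarrow> s (\<theta> k) \<le> s k"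
    and drop: "\<And>k. k \<in> N - L \<Longrightarrow> s (\<theta> (\<sigma> k)) \<le> s k"
begin

definition \<kappa> :: "'a \<Rightarrow> 'a" where "\<kappa> = \<theta> \<circ> \<sigma>"

text \<open>
  Along \<open>\<kappa>\<close>, the contour of the mobile, the height \<open>s\<close> rises by one at an element of \<open>L\<close> and never
  rises elsewhere.  \<open>F n y\<close> says that \<open>y\<close> follows \<open>n\<close> around the black face of the Eulerian map: either
  the contour returns to the height of \<open>n\<close>, or it drops below and \<open>y\<close> is the matching rise before \<open>n\<close>.
\<close>

definition F :: "'a \<Rightarrow> 'a \<Rightarrow> bool" where
  "F n y \<longleftrightarrow> y \<in> N \<and>
    (\<exists>k. walk \<kappa> (\<lambda>z. s z \<le> s n) n k \<and>
         (s (\<kappa> k) = s n \<and> y = \<sigma> k \<or>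
          s (\<kappa> k) < s n \<and> walk \<kappa> (\<lambda>z. s z < s n) y n \<and> s y < s n))"

lemma bij_kappa: "bij_betw \<kappa> N N"
  unfolding \<kappa>_def using bij_betw_trans[OF bij_sigma bij_theta] .

lemma inj: "inj_on \<theta> N" "inj_on \<sigma> N" "inj_on \<kappa> N"
  using bij_theta bij_sigma bij_kappa by (auto simp: bij_betw_def)

lemma into: "\<theta> ` N \<subseteq> N" "\<sigma> ` N \<subseteq> N" "\<kappa> ` N \<subseteq> N"
  using bij_theta bij_sigma bij_kappa by (auto simp: bij_betw_def)

lemma in_N [simp]: "n \<in> N \<Longrightarrow> \<theta> n \<in> N" "n \<in> N \<Longrightarrow> \<sigma> n \<in> N" "n \<in> N \<Longrightarrow> \<kappa> n \<in> N"
  using into by auto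

lemma s_kappa: "l \<in> L \<Longrightarrow> s (\<kappa> l) = s l + 1" "k \<in> N - L \<Longrightarrow> s (\<kappa> k) \<le> s k"
  using up level drop by (auto simp: \<kappa>_def)

lemma theta_surj: "n \<in> N \<Longrightarrow> \<exists>j\<in>N. \<theta> j = n"
  using bij_theta by (metis bij_betw_imp_surj_on imageE)

lemma sigma_surj: "n \<in> N \<Longrightarrow> \<exists>j\<in>N. \<sigma> j = n"
  using bij_sigma by (metis bij_betw_imp_surj_on imageE)

text \<open>Both witnesses \<open>k\<close> are the last point before the contour first comes down
  to \<open>s n\<close> or lower, hence equal. This point decides the clause, and in the second
  clause \<open>y\<close> is the last point before \<open>n\<close> that lies below
  \<open>s n\<close>.\<close>

lemma F_unique:
  assumes "n \<in> N" "F n y" "F n y'"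
  shows "y = y'"
proof -
  obtain k where k: "walk \<kappa> (\<lambda>z. s z \<le> s n) n k" "y \<in> N"
     "s (\<kappa> k) = s n \<and> y = \<sigma> k \<or>
          s (\<kappa> k) < s n \<and> walk \<kappa> (\<lambda>z. s z < s n) y n \<and> s y < s n"
    using assms(2) unfolding F_def by blast
  obtain k' where k': "walk \<kappa> (\<lambda>z. s z \<le> s n) n k'" "y' \<in> N"
     "s (\<kappa> k') = s n \<and> y' = \<sigma> k' \<or>
          s (\<kappa> k') < s n \<and> walk \<kappa> (\<lambda>z. s z < s n) y' n \<and> s y' < s n"
    using assms(3) unfolding F_def by blast
  have "k = k'" using walk_stop_unique[OF k(1) _ k'(1)] k(3) k'(3) by fastforce
  then show ?thesis
    using k k' walk_start_unique[OF inj(3) into(3) k(2) k'(2), of "\<lambda>z. s z < s n" n] by auto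
qed

end

text \<open>
  The map side: \<open>\<phi>\<close> moves to the next edge around a black face and \<open>\<chi>\<close> to the next incoming edge
  counterclockwise around a vertex.
\<close>

locale leveled_map =
  fixes N :: "'a set" and \<theta> \<sigma> \<phi> \<chi> :: "'a \<Rightarrow> 'a" and s :: "'a \<Rightarrow> int" and L :: "'a set"
  assumes fin: "finite N"
    and bij_theta: "bij_betw \<theta> N N" and bij_phi: "bij_betw \<phi> N N"
    and L_eq: "L = {n\<in>N. s (\<theta> n) = s n + 1}"
    and s_phi: "\<And>n. n \<in> N \<Longrightarrow> s (\<theta> (\<phi> n)) = s n"
    and s_le: "\<And>n. n \<in> N \<Longrightarrow> s (\<theta> n) \<le> s n + 1"
    and chi_in: "\<And>n. n \<in> N \<Longrightarrow> \<chi> n \<in> N"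
    and chi: "\<And>n. n \<in> N \<Longrightarrow> \<phi> (\<theta> (\<chi> n)) = n"
    and return_phi: "\<And>k. k \<in> N - L \<Longrightarrow> \<exists>j. walk \<phi> (\<lambda>z. z \<notin> L) k j \<and> \<phi> j = \<sigma> k \<and> \<sigma> k \<notin> L"
    and return_chi: "\<And>l. l \<in> L \<Longrightarrow> \<exists>j. walk \<chi> (\<lambda>z. z \<in> L) l j \<and> \<chi> j = \<sigma> l \<and> \<sigma> l \<in> L"
begin

section \<open>The map side: height changes, induced rotation, matching\<close>

lemma theta_in: "n \<in> N \<Longrightarrow> \<theta> n \<in> N" and phi_in: "n \<in> N \<Longrightarrow> \<phi> n \<in> N"
  using bij_theta bij_phi by (auto simp: bij_betw_def)

lemma inj_phi: "inj_on \<phi> N"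
  using bij_phi by (auto simp: bij_betw_def)

lemma inj_chi: "inj_on \<chi> N"
  by (metis chi inj_onI)

lemma s_chi: "n \<in> N \<Longrightarrow> s (\<theta> (\<chi> n)) = s (\<theta> n)"
  by (metis chi chi_in theta_in s_phi)

lemma L_sub: "L \<subseteq> N" using L_eq by auto

lemma sigma_in: "n \<in> N \<Longrightarrow> \<sigma> n \<in> N"
proof -
  assume n: "n \<in> N"
  show ?thesis
  proof (cases "n \<in> L")
    case True
    then obtain j where j: "walk \<chi> (\<lambda>z. z \<in> L) n j" "\<chi> j = \<sigma> n" using return_chi by blast
    then have "j \<in> N" using walk_in chi_in n by (metis image_subsetI)
    then show ?thesis using j chi_in by metis
  next
    case False
    then obtain j where j: "walk \<phi> (\<lambda>z. z \<notin> L) n j" "\<phi> j = \<sigma> n" using return_phi n by blast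
    then have "j \<in> N" using walk_in theta_in phi_in n by (metis image_subsetI)
    then show ?thesis using j theta_in phi_in by metis
  qed
qed

lemma sigma_L: "n \<in> N \<Longrightarrow> \<sigma> n \<in> L \<longleftrightarrow> n \<in> L"
  using return_phi return_chi by blast

text \<open>Equal images have equal predecessors under the underlying permutation, and the argument
  of the induced one is then the last visit to its set.\<close>

lemma inj_sigma: "inj_on \<sigma> N"
proof (rule inj_onI)
  fix a b assume ab: "a \<in> N" "b \<in> N" "\<sigma> a = \<sigma> b"
  show "a = b"
  proof (cases "a \<in> L")
    case True
    then have "b \<in> L" using ab sigma_L by metis
    obtain j where j: "walk \<chi> (\<lambda>z. z \<in> L) a j" "\<chi> j = \<sigma> a" using return_chi True by blast
    obtain i where i: "walk \<chi> (\<lambda>z. z \<in> L) b i" "\<chi> i = \<sigma> b" using return_chi \<open>b \<in> L\<close> by blast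
    have into: "\<chi> ` N \<subseteq> N" using chi_in by auto
    have "i = j" using walk_in[OF i(1) into ab(2)] walk_in[OF j(1) into ab(1)] i j ab inj_chi
      by (metis inj_onD)
    then show ?thesis
      using walk_start_unique[OF inj_chi into ab(1,2) _ _ j(1)] i True \<open>b \<in> L\<close> by blast
  next
    case False
    then have "b \<notin> L" using ab sigma_L by metis
    obtain j where j: "walk \<phi> (\<lambda>z. z \<notin> L) a j" "\<phi> j = \<sigma> a" using return_phi False ab by blast
    obtain i where i: "walk \<phi> (\<lambda>z. z \<notin> L) b i" "\<phi> i = \<sigma> b" using return_phi \<open>b \<notin> L\<close> ab by blast
    have into: "\<phi> ` N \<subseteq> N" using theta_in phi_in by auto
    have "i = j" using walk_in[OF i(1) into ab(2)] walk_in[OF j(1) into ab(1)] i j ab inj_phi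
      by (metis inj_onD)
    then show ?thesis
      using walk_start_unique[OF inj_phi into ab(1,2) _ _ j(1)] i False \<open>b \<notin> L\<close> by blast
  qed
qed

lemma bij_sigma: "bij_betw \<sigma> N N"
  using inj_sigma sigma_in fin by (auto intro!: bij_betw_selfI)

lemma s_sigma_L: assumes "l \<in> L" shows "s (\<theta> (\<sigma> l)) = s (\<theta> l)"
proof -
  obtain j where j: "walk \<chi> (\<lambda>z. z \<in> L) l j" "\<chi> j = \<sigma> l" using return_chi assms by blast
  have "s (\<theta> j) = s (\<theta> l) \<and> j \<in> N" using j(1)
  proof (induction rule: walk_induct)
    case refl
    then show ?case using assms L_sub by auto
  next
    case (step y)
    then show ?case using s_chi chi_in by auto
  qed
  then show ?thesis using j s_chi by metis
qed

text \<open>Entering \<open>L\<close> along \<open>\<phi>\<close> costs one level, since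
  \<open>s (\<theta> (\<phi> y)) = s y\<close> while \<open>\<theta>\<close> raises the height by
  one on \<open>L\<close>.\<close>

lemma s_walk_phi: assumes "walk \<phi> (\<lambda>z. z \<notin> L) k j" "k \<in> N" shows "s j \<le> s k \<and> j \<in> N"
  using assms(1)
proof (induction rule: walk_induct)
  case refl
  then show ?case using assms by auto
next
  case (step y)
  then have "\<phi> y \<in> L" "y \<in> N" "s y \<le> s k" by auto
  then show ?case using s_phi[of y] phi_in L_eq by auto
qed

sublocale leveled N \<theta> \<sigma> s L
proof
  show "finite N" "bij_betw \<theta> N N" "bij_betw \<sigma> N N" "L \<subseteq> N" 
    using fin bij_theta bij_sigma L_sub by auto
  show "\<And>n. n \<in> N \<Longrightarrow> (\<sigma> n \<in> L) = (n \<in> L)" using sigma_L by auto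
  show "\<And>l. l \<in> L \<Longrightarrow> s (\<theta> l) = s l + 1" using L_eq by auto
  show "\<And>l. l \<in> L \<Longrightarrow> s (\<theta> (\<sigma> l)) = s (\<theta> l)" using s_sigma_L by auto
  show "\<And>k. k \<in> N - L \<Longrightarrow> s (\<theta> k) \<le> s k" using s_le L_eq by force
  show "s (\<theta> (\<sigma> k)) \<le> s k" if kB: "k \<in> N - L" for k
  proof -
    obtain j where j: "walk \<phi> (\<lambda>z. z \<notin> L) k j" "\<phi> j = \<sigma> k" using return_phi[OF kB] by blast
    then have "s j \<le> s k" "j \<in> N" using s_walk_phi kB by auto
    then show ?thesis using s_phi j(2) by metis
  qed
qed

text \<open>The pieces of contour from \<open>\<phi> y\<close> to \<open>y\<close> lie above
  successive levels; joined together, they lead from the lowest element \<open>j\<close> back to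
  \<open>k\<close>. The matching is assumed above height \<open>v\<close> only, so that the lemma
  can serve inside the descending induction for \<open>walk_from_phi\<close>.\<close>

lemma walk_chain:
  assumes M: "\<And>n. n \<in> N \<Longrightarrow> v < s n \<Longrightarrow> \<phi> n \<in> L \<Longrightarrow> walk \<kappa> (\<lambda>z. s z < s n) (\<phi> n) n"
    and "walk \<phi> (\<lambda>z. z \<notin> L) k j" "k \<in> N" "v \<le> s j"
  shows "walk \<kappa> (\<lambda>z. s z \<le> s j) j k"
  using assms(2,4)
proof (induction rule: walk_induct)
  case (step y)
  have "\<phi> y \<in> L" using step.hyps by auto
  have y: "y \<in> N" using step.hyps s_walk_phi assms(3) by blast
  have s: "s (\<phi> y) = s y - 1" using s_phi[OF y] \<open>\<phi> y \<in> L\<close> L_eq by auto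
  have "walk \<kappa> (\<lambda>z. s z < s y) (\<phi> y) y" using M[OF y] s step.prems \<open>\<phi> y \<in> L\<close> by auto
  then have "walk \<kappa> (\<lambda>z. s z \<le> s (\<phi> y)) (\<phi> y) y" by (rule walk_mono) (use s in auto)
  moreover have "walk \<kappa> (\<lambda>z. s z \<le> s y) y k" using step s by auto
  then have "walk \<kappa> (\<lambda>z. s z \<le> s (\<phi> y)) y k" by (rule walk_mono) (use s in auto)
  ultimately show ?case by (rule walk_trans)
qed auto

text \<open>
  Descending induction on the height: the elements visited by \<open>\<chi>\<close> between \<open>\<phi> n\<close> and \<open>\<sigma> (\<phi> n)\<close> are
  linked to \<open>n\<close> by pieces of the contour that do not go below \<open>s n\<close>.
\<close>

lemma walk_from_phi:
  assumes "n \<in> N" "\<phi> n \<in> L"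
  shows "walk \<kappa> (\<lambda>z. s z < s n) (\<phi> n) n"
  using assms
proof (induction "nat (Max (s ` N) - s n)" arbitrary: n rule: less_induct)
  case less
  define l where "l = \<phi> n"
  define v where "v = s n"
  have l: "l \<in> L" "l \<in> N" using less L_sub l_def by auto
  have ev: "s (\<theta> l) = v" using s_phi less l_def v_def by auto
  have M: "walk \<kappa> (\<lambda>z. s z < s n') (\<phi> n') n'" if "n' \<in> N" "v < s n'" "\<phi> n' \<in> L" for n'
  proof -
    have "s n' \<le> Max (s ` N)" using that fin by auto
    then show ?thesis using less.hyps[OF _ that(1,3)] that(2) v_def by auto
  qed
  obtain j where j: "walk \<chi> (\<lambda>z. z \<in> L) l j" "\<chi> j = \<sigma> l" "\<sigma> l \<in> L" using return_chi l by blast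
  have "walk \<kappa> (\<lambda>z. s z < v) (\<theta> (\<chi> j)) n \<and> j \<in> N \<and> s (\<theta> j) = v" using j(1)
  proof (induction rule: walk_induct)
    case refl
    have "\<theta> (\<chi> l) = n"
      using chi[OF l(2)] l_def less.prems inj_phi chi_in theta_in phi_in l by (metis inj_onD)
    then show ?case using l ev by auto
  next
    case (step i)
    define i' where "i' = \<chi> i"
    have i': "i' \<in> N" "i' \<notin> L" using step i'_def chi_in by auto
    have s': "s (\<theta> i') = v" using step i'_def s_chi by auto
    \<comment> \<open>\<open>k\<close> precedes \<open>i'\<close> around the black mobile vertex and
      \<open>p\<close> precedes it around the black face. The chain from \<open>k\<close> to
      \<open>p\<close> descends to height \<open>v\<close> by steps that start above
      \<open>v\<close>, so the induction hypothesis covers each of them.\<close>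
    obtain k where k: "k \<in> N" "\<sigma> k = i'" using sigma_surj i' by auto
    then have "k \<notin> L" using sigma_L i' by auto
    then obtain p where p: "walk \<phi> (\<lambda>z. z \<notin> L) k p" "\<phi> p = i'"
      using return_phi k by blast
    have pN: "p \<in> N" using s_walk_phi p k by auto
    have p': "p = \<theta> (\<chi> i')"
      using chi[OF i'(1)] p(2) pN chi_in i'(1) inj_phi theta_in phi_in by (metis inj_onD)
    have sp: "s p = v" using s_phi[OF pN] p(2) s' by simp
    have "walk \<kappa> (\<lambda>z. s z \<le> s p) p k" using walk_chain[OF M p(1) k(1)] sp by auto
    then have "walk \<kappa> (\<lambda>z. s z < v) p k" by (rule walk_mono) (use sp in auto)
    moreover have "\<kappa> k = \<theta> i'" using k \<kappa>_def by auto
    ultimately have "walk \<kappa> (\<lambda>z. s z < v) p (\<theta> i')" using walk_step[of \<kappa> _ p k] s' by auto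
    moreover have "walk \<kappa> (\<lambda>z. s z < v) (\<theta> i') n" using step i'_def by auto
    ultimately have "walk \<kappa> (\<lambda>z. s z < v) p n" by (rule walk_trans)
    then show ?case using i' s' p' i'_def by auto
  qed
  then have "walk \<kappa> (\<lambda>z. s z < v) (\<kappa> l) n" using j by (auto simp: \<kappa>_def)
  moreover have "s (\<kappa> l) = v" using s_sigma_L l ev by (auto simp: \<kappa>_def)
  ultimately show ?case unfolding l_def v_def using walk_step_left by (metis less_irrefl)
qed

text \<open>Going back along \<open>\<phi>\<close> from an element of \<open>L\<close> raises the
  height by one, which cannot go on in a finite set. In particular no black face consists of
  increasing edges only.\<close>

lemma walk_back:
  assumes "n \<in> N"
  obtains k where "k \<in> N - L" "walk \<phi> (\<lambda>z. z \<notin> L) k n"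
    "walk \<kappa> (\<lambda>z. s z \<le> s n) n k"
proof -
  have "\<exists>k. k \<in> N - L \<and> walk \<phi> (\<lambda>z. z \<notin> L) k n"
  proof -
    have "\<exists>k\<in>N. s n \<le> s k \<and> k \<notin> L \<and> walk \<phi> (\<lambda>z. z \<notin> L) k n" using assms
    proof (induction "nat (Max (s ` N) - s n)" arbitrary: n rule: less_induct)
      case less
      show ?case
      proof (cases "n \<in> L")
        case True
        obtain p where p: "p \<in> N" "\<phi> p = n" using bij_phi less.prems by (metis bij_betw_imp_surj_on imageE)
        have "s p = s n + 1" using s_phi[OF p(1)] p True L_eq by auto
        moreover have "s p \<le> Max (s ` N)" using p fin by auto
        ultimately obtain k where "k\<in>N" "s p \<le> s k" "k \<notin> L" "walk \<phi> (\<lambda>z. z \<notin> L) k p"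
          using less.hyps[of p] p by auto
        moreover have "walk \<phi> (\<lambda>z. z \<notin> L) k n" using calculation walk_step[of \<phi> "\<lambda>z. z \<notin> L" k p] p True by simp
        ultimately show ?thesis using \<open>s p = _\<close> by (intro bexI[of _ k]) auto
      qed (use less in auto)
    qed
    then show ?thesis by auto
  qed
  then obtain k where k: "k \<in> N - L" "walk \<phi> (\<lambda>z. z \<notin> L) k n" by blast
  then show ?thesis using that walk_chain[of "s n" k n] walk_from_phi by auto
qed

text \<open>The drop at \<open>k\<close> closes the whole chain from \<open>k\<close> to
  \<open>j\<close>. If \<open>n\<close> is its last element, then
  \<open>\<phi> n = \<sigma> k\<close> gives the first clause; otherwise \<open>\<phi> n\<close> is
  the next rise of the chain, and the drop goes below \<open>s n\<close>.\<close>

lemma F_phi: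
  assumes "n \<in> N"
  shows "F n (\<phi> n)"
proof -
  obtain k where k: "k \<in> N - L" "walk \<phi> (\<lambda>z. z \<notin> L) k n" "walk \<kappa> (\<lambda>z. s z \<le> s n) n k"
    using walk_back assms by blast
  obtain j where j: "walk \<phi> (\<lambda>z. z \<notin> L) k j" "\<phi> j = \<sigma> k" "\<sigma> k \<notin> L" using return_phi k by blast
  have jN: "j \<in> N" using s_walk_phi k j by auto
  have \<kappa>k: "s (\<kappa> k) = s j" using s_phi[OF jN] j by (auto simp: \<kappa>_def)
  show ?thesis
  proof (cases "\<phi> n \<in> L")
    case False
    then have "n = j" using walk_stop_unique[OF k(2) _ j(1)] j by auto
    then show ?thesis unfolding F_def using k j \<kappa>k theta_in phi_in assms by auto
  next
    case True
    have "s (\<phi> n) < s n" using s_phi[OF assms] True L_eq by auto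
    have "s j < s n"
    proof -
      have "walk \<phi> (\<lambda>z. z \<notin> L) (\<phi> n) j"
        using k(2) j(1)
      proof (induction rule: walk_induct_left)
        case refl
        then show ?case using True j by (auto elim: walk_cases_left)
      next
        case (step x)
        then show ?case using j by (auto elim: walk_cases_left)
      qed
      then have "s j \<le> s (\<phi> n)" using s_walk_phi phi_in[OF assms] by blast
      then show ?thesis using \<open>s (\<phi> n) < s n\<close> by auto
    qed
    then show ?thesis unfolding F_def
      using k \<kappa>k theta_in phi_in assms \<open>s (\<phi> n) < s n\<close> walk_from_phi[OF assms True] by auto
  qed
qed


text \<open>\<open>\<phi> \<circ> \<theta>\<close> turns around a vertex of the map, and its orbit
  avoids \<open>L\<close> if no increasing edge ends there. On a contour cycle, follow the corners
  of a vertex at minimal height: an increasing edge into it would put a lower element on the same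
  cycle. So each cycle meets a vertex without such edges, and \<open>single\<close> allows only one
  of these.\<close>

lemma kappa_transitive:
  assumes single: "\<And>x y. x \<in> N \<Longrightarrow> y \<in> N \<Longrightarrow> \<forall>i. ((\<phi> \<circ> \<theta>) ^^ i) x \<notin> L \<Longrightarrow> \<forall>i. ((\<phi> \<circ> \<theta>) ^^ i) y \<notin> L \<Longrightarrow>
    \<exists>i. ((\<phi> \<circ> \<theta>) ^^ i) x = y"
    and "x \<in> N" "y \<in> N"
  shows "\<exists>i. (\<kappa> ^^ i) x = y"
proof -
  define same where "same a b \<longleftrightarrow> (\<exists>i. (\<kappa> ^^ i) a = b)" for a b
  define \<psi> where "\<psi> = \<phi> \<circ> \<theta>"
  have psi_Suc: "(\<psi> ^^ Suc i) j = \<phi> (\<theta> ((\<psi> ^^ i) j))" for i j by (simp add: \<psi>_def)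
  have same_refl: "same a a" for a unfolding same_def by (rule exI[of _ 0]) simp
  have same_trans: "same a c" if ab: "same a b" and bc: "same b c" for a b c
  proof -
    obtain i j where "(\<kappa> ^^ i) a = b" "(\<kappa> ^^ j) b = c" using ab bc unfolding same_def by blast
    then have "(\<kappa> ^^ (j + i)) a = c" by (simp add: funpow_add)
    then show ?thesis unfolding same_def by blast
  qed
  have same_in: "b \<in> N" if "same a b" "a \<in> N" for a b
    using that funpow_in[OF into(3)] by (auto simp: same_def)
  have same_sym: "same b a" if ab: "same a b" and a: "a \<in> N" for a b
  proof -
    obtain i where i: "(\<kappa> ^^ i) a = b" using ab unfolding same_def by blast
    obtain p where p: "p > 0" "(\<kappa> ^^ p) a = a" using funpow_returns[OF fin bij_kappa a] by blast
    have pp: "(\<kappa> ^^ (p * c)) a = a" for c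
      by (induction c) (auto simp: funpow_add p)
    have "i \<le> p * i" using p by simp
    then have "(\<kappa> ^^ (p * i - i)) b = (\<kappa> ^^ (p * i)) a"
      unfolding i[symmetric] by (metis comp_apply funpow_add le_add_diff_inverse2)
    then show ?thesis using pp unfolding same_def by metis
  qed
  have S1: "same n (\<phi> n)" if n: "n \<in> N" "\<phi> n \<in> L" for n
  proof -
    have "same (\<phi> n) n" using walk_funpow[OF walk_from_phi[OF n]] unfolding same_def .
    then show ?thesis using same_sym n L_sub by blast
  qed
  have S2: "same n (\<theta> (\<phi> n))" if n: "n \<in> N" "\<phi> n \<notin> L" for n
  proof -
    obtain k where k: "k \<in> N - L" "walk \<phi> (\<lambda>z. z \<notin> L) k n" "walk \<kappa> (\<lambda>z. s z \<le> s n) n k"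
      using walk_back n by blast
    obtain j where j: "walk \<phi> (\<lambda>z. z \<notin> L) k j" "\<phi> j = \<sigma> k" "\<sigma> k \<notin> L" using return_phi k by blast
    have "n = j" using walk_stop_unique[OF k(2) _ j(1)] n j by auto
    then have "\<kappa> k = \<theta> (\<phi> n)" using j \<kappa>_def by simp
    moreover have "same n k" using walk_funpow[OF k(3)] unfolding same_def .
    moreover have "same k (\<kappa> k)" unfolding same_def by (rule exI[of _ 1]) simp
    ultimately show ?thesis using same_trans by metis
  qed
  have min: "\<exists>j\<in>N. same n (\<theta> j) \<and> (\<forall>i. (\<psi> ^^ i) j \<notin> L) \<and> (\<forall>i. same n (\<theta> ((\<psi> ^^ i) j)))" if n: "n \<in> N" for n
  proof -
    have "finite {z\<in>N. same n z}" "{z\<in>N. same n z} \<noteq> {}" using fin n same_refl by auto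
    then obtain m where m: "m \<in> N" "same n m" "\<And>z. z \<in> N \<Longrightarrow> same n z \<Longrightarrow> s m \<le> s z"
      by (metis (mono_tags, lifting) mem_Collect_eq arg_min_if_finite(1) arg_min_least)
    obtain j where j: "j \<in> N" "\<theta> j = m" using theta_surj m by blast
    have step: "same n (\<theta> ((\<psi> ^^ i) j)) \<and> (\<psi> ^^ i) j \<in> N \<and> s (\<theta> ((\<psi> ^^ i) j)) = s m \<and> (\<psi> ^^ Suc i) j \<notin> L" for i
    proof (induction i)
      case (Suc i)
      define p where "p = \<theta> ((\<psi> ^^ i) j)"
      have p: "p \<in> N" "same n p" "s p = s m" "\<phi> p \<notin> L" "(\<psi> ^^ Suc i) j = \<phi> p"
        using Suc theta_in unfolding p_def psi_Suc by auto
      have 1: "same n (\<theta> (\<phi> p))" using S2 p same_trans by blast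
      define q where "q = \<theta> (\<phi> p)"
      have q: "q \<in> N" "s q = s m" using q_def p theta_in phi_in s_phi by auto
      have "\<phi> q \<notin> L"
      proof
        assume "\<phi> q \<in> L"
        then have "s (\<phi> q) < s m" using s_phi[OF q(1)] L_eq q by auto
        moreover have "same n (\<phi> q)" using S1 q \<open>\<phi> q \<in> L\<close> 1 q_def same_trans by blast
        ultimately show False using m(3) phi_in q by force
      qed
      then show ?case using 1 p q q_def phi_in psi_Suc by metis
    next
      case 0
      have "\<phi> m \<notin> L"
      proof
        assume "\<phi> m \<in> L"
        then have "s (\<phi> m) < s m" using s_phi[OF m(1)] L_eq by auto
        moreover have "same n (\<phi> m)" using S1 m \<open>\<phi> m \<in> L\<close> same_trans by blast
        ultimately show False using m phi_in by force
      qed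
      then show ?case using j m psi_Suc[of 0 j] by auto
    qed
    \<comment> \<open>\<open>step\<close> speaks of positive iterates only, but \<open>j\<close> is
      one of them because \<open>\<psi>\<close> permutes the finite set \<open>N\<close>.\<close>
    have "j \<notin> L"
    proof
      assume "j \<in> L"
      then have "s m = s j + 1" using L_eq j by auto
      have bij: "bij_betw \<psi> N N" unfolding \<psi>_def using bij_betw_trans[OF bij_theta bij_phi] .
      obtain p where "p > 0" "(\<psi> ^^ p) j = j" using funpow_returns[OF fin bij j(1)] by blast
      then show False using step[of "p - 1"] \<open>j \<in> L\<close> by simp
    qed
    then have "(\<psi> ^^ i) j \<notin> L" for i using step by (cases i) auto
    then show ?thesis using step j m by (intro bexI[of _ j]) auto
  qed
  obtain j where j: "j \<in> N" "same x (\<theta> j)" "\<forall>i. (\<psi> ^^ i) j \<notin> L" "\<forall>i. same x (\<theta> ((\<psi> ^^ i) j))"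
    using min assms(2) by blast
  obtain j' where j': "j' \<in> N" "same y (\<theta> j')" "\<forall>i. (\<psi> ^^ i) j' \<notin> L" using min assms(3) by blast
  have "\<exists>i. (\<psi> ^^ i) j = j'" using single[of j j'] j j' \<psi>_def by auto
  then have "same x (\<theta> j')" using j by auto
  moreover have "same (\<theta> j') y" using same_sym j' assms(3) by blast
  ultimately show ?thesis using same_trans unfolding same_def by blast
qed

end

section \<open>From the contour to the black faces\<close>

lemma walk_linear:
  assumes "walk f P x y" "walk f P x z"
  shows "walk f P y z \<or> walk f P z y"
  using assms
proof (induction rule: walk_induct)
  case (step y)
  then show ?case using walk_cases_left[of f P y z] walk_step[of f P z y] by (metis walk_refl)
qed auto

text \<open>With \<open>P\<close> read as below a height and \<open>Q\<close> as not above it, this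
  finds a return to exactly that height on a walk that never goes below.\<close>

lemma walk_first_stop:
  assumes "walk f P n n'" "Q n'" "n \<noteq> n'" "\<And>z. P z \<Longrightarrow> Q z"
  obtains i where "walk f Q n i" "Q (f i)" "\<not> P (f i)"
proof -
  have "n \<noteq> n' \<longrightarrow> (\<exists>i. walk f Q n i \<and> Q (f i) \<and> \<not> P (f i))" using assms(1)
  proof (induction rule: walk_induct_left)
    case (step x)
    show ?case
    proof (cases "Q (f x)")
      case True
      then show ?thesis using step by blast
    next
      case False
      then have "f x \<noteq> n'" using assms(2) by auto
      then show ?thesis using step False walk_step_left by metis
    qed
  qed auto
  then show ?thesis using assms(3) that by blast
qed

section \<open>One-face mobiles: the matching as a permutation\<close>

locale leveled_tree = leveled +
  assumes cyc: "\<And>x y. x \<in> N \<Longrightarrow> y \<in> N \<Longrightarrow> \<exists>i. (\<kappa> ^^ i) x = y"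
begin

definition \<phi> :: "'a \<Rightarrow> 'a" where "\<phi> n = (THE y. F n y)"

definition \<chi> :: "'a \<Rightarrow> 'a" where "\<chi> = inv_into N (\<phi> \<circ> \<theta>)"

text \<open>Periodicity of the contour provides \<open>k\<close>. If it drops strictly, then
  \<open>\<kappa> k\<close> itself lies below \<open>s n\<close>, and going round the single cycle
  from there to \<open>n\<close> passes a last such point; this is where one-facedness
  enters.\<close>

lemma F_exists:
  assumes n: "n \<in> N"
  shows "\<exists>y. F n y"
proof -
  obtain i where i: "i > 0" "(\<kappa> ^^ i) n = n" using funpow_returns[OF fin bij_kappa n] by blast
  then obtain k where k: "walk \<kappa> (\<lambda>z. s z \<le> s n) n k" "s (\<kappa> k) \<le> s n"
    using walk_stop_exists[of "\<lambda>z. s z \<le> s n" i \<kappa> n] by auto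
  have kN: "k \<in> N" using walk_in[OF k(1) into(3) n] .
  show ?thesis
  proof (cases "s (\<kappa> k) = s n")
    case True
    then have "F n (\<sigma> k)" using k kN unfolding F_def by auto
    then show ?thesis by blast
  next
    case False
    then have lt: "s (\<kappa> k) < s n" using k by auto
    obtain j where j: "(\<kappa> ^^ j) (\<kappa> k) = n" using cyc kN n by (meson in_N(3))
    obtain y where y: "s y < s n" "walk \<kappa> (\<lambda>z. s z < s n) y ((\<kappa> ^^ j) (\<kappa> k))" "\<exists>j. y = (\<kappa> ^^ j) (\<kappa> k)"
      using walk_start_exists[of "\<lambda>z. s z < s n" "\<kappa> k" \<kappa> j] lt by auto
    have "y \<in> N" using y(3) funpow_in[OF into(3), of "\<kappa> k"] kN by auto
    then have "F n y" using k lt y j unfolding F_def by auto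
    then show ?thesis by blast
  qed
qed

lemma F_phi: "n \<in> N \<Longrightarrow> F n (\<phi> n)"
  unfolding \<phi>_def using F_exists F_unique by (metis theI)

text \<open>The contour cannot rise to \<open>s n\<close> from a point that is \<open>n\<close> or
  higher, so in the first case the edge lies outside \<open>L\<close>. In the second case the last
  point below \<open>s n\<close> must be followed by a rise, and rises have size one.\<close>

lemma phi_cases:
  assumes "n \<in> N"
  obtains (same) k where "k \<in> N" "walk \<kappa> (\<lambda>z. s z \<le> s n) n k" "s (\<kappa> k) = s n" "\<phi> n = \<sigma> k"
      "\<phi> n \<notin> L"
  | (lower) k where "k \<in> N" "walk \<kappa> (\<lambda>z. s z \<le> s n) n k" "s (\<kappa> k) < s n"
      "walk \<kappa> (\<lambda>z. s z < s n) (\<phi> n) n" "\<phi> n \<in> L" "s (\<phi> n) = s n - 1"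
proof -
  obtain k where k: "walk \<kappa> (\<lambda>z. s z \<le> s n) n k" "\<phi> n \<in> N"
     "s (\<kappa> k) = s n \<and> \<phi> n = \<sigma> k \<or>
          s (\<kappa> k) < s n \<and> walk \<kappa> (\<lambda>z. s z < s n) (\<phi> n) n \<and> s (\<phi> n) < s n"
    using F_phi[OF assms] unfolding F_def by blast
  have kN: "k \<in> N" using walk_in[OF k(1) into(3) assms] .
  show ?thesis
  proof (cases "s (\<kappa> k) = s n")
    case True
    have "k \<notin> L"
    proof
      assume "k \<in> L"
      then have "s k < s n" using s_kappa(1)[of k] True by simp
      then show False using k(1) by (auto elim: walk_cases_right)
    qed
    then show ?thesis using same k kN True sigma_L by auto
  next
    case False
    then have *: "walk \<kappa> (\<lambda>z. s z < s n) (\<phi> n) n" "s (\<phi> n) < s n" "s (\<kappa> k) < s n" using k by auto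
    have "s n \<le> s (\<kappa> (\<phi> n))"
      using *(1) by (rule walk_cases_left) (use *(2) in auto)
    then have "\<phi> n \<in> L" using s_kappa(2)[of "\<phi> n"] k(2) *(2) by force
    moreover have "s (\<phi> n) = s n - 1" using s_kappa(1)[OF calculation] *(2) \<open>s n \<le> _\<close> by simp
    ultimately show ?thesis using lower k kN * by auto
  qed
qed

lemma phi_in: "n \<in> N \<Longrightarrow> \<phi> n \<in> N"
  using F_phi unfolding F_def by blast

lemma s_phi: assumes "n \<in> N" shows "s (\<theta> (\<phi> n)) = s n"
  using assms
proof (cases rule: phi_cases)
  case (same k)
  then show ?thesis by (simp add: \<kappa>_def)
next
  case (lower k)
  then show ?thesis using up by auto
qed

text \<open>Elements with the same image have the same height. If the image is a rise matched to
  both, the earlier one comes back to its own height without having gone below, against the strict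
  drop at its first return.\<close>

lemma inj_phi: "inj_on \<phi> N"
proof (rule inj_onI)
  have *: "a = b" if a: "a \<in> N" "b \<in> N" "\<phi> a = \<phi> b" "s a = s b" "walk \<kappa> (\<lambda>z. s z < s a) a b"
     "\<phi> a \<in> L" for a b
  proof (rule ccontr)
    assume "a \<noteq> b"
    then obtain i where i: "walk \<kappa> (\<lambda>z. s z \<le> s a) a i" "s (\<kappa> i) \<le> s a" "\<not> s (\<kappa> i) < s a"
      using walk_first_stop[OF a(5), of "\<lambda>z. s z \<le> s a"] a(4) by auto
    show False using a(1)
    proof (cases rule: phi_cases)
      case (same k)
      then show ?thesis using a by auto
    next
      case (lower k)
      then show ?thesis using walk_stop_unique[OF i(1) i(2) lower(2)] i by auto
    qed
  qed
  fix a b assume ab: "a \<in> N" "b \<in> N" "\<phi> a = \<phi> b"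
  have sab: "s a = s b" using s_phi ab by metis
  show "a = b" using ab(1)
  proof (cases rule: phi_cases)
    case (same k)
    show ?thesis using ab(2)
    proof (cases rule: phi_cases)
      case same': (same k')
      have "k = k'" using same same' ab inj by (metis inj_onD)
      then show ?thesis using walk_start_unique[OF inj(3) into(3) ab(1,2) _ _ same(2)] same' sab by auto
    qed (use same ab in auto)
  next
    case (lower k)
    show ?thesis using ab(2)
    proof (cases rule: phi_cases)
      case lower': (lower k')
      have "walk \<kappa> (\<lambda>z. s z < s a) a b \<or> walk \<kappa> (\<lambda>z. s z < s a) b a"
        using walk_linear[OF lower(4)] lower'(4) ab(3) sab by auto
      then show ?thesis using *[of a b] *[of b a] ab sab lower(5) by auto
    qed (use lower ab in auto)
  qed
qed

lemma bij_phi: "bij_betw \<phi> N N"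
  using inj_phi phi_in fin by (auto intro!: bij_betw_selfI)

definition \<psi> :: "'a \<Rightarrow> 'a" where "\<psi> = \<phi> \<circ> \<theta>"

lemma psi: "\<psi> z = \<phi> (\<theta> z)"
  by (simp add: \<psi>_def)

lemma bij_psi: "bij_betw \<psi> N N"
  unfolding \<psi>_def using bij_betw_trans[OF bij_theta bij_phi] .

lemma psi_in: "\<psi> ` N \<subseteq> N"
  using bij_psi by (auto simp: bij_betw_def)

lemma chi_psi: "n \<in> N \<Longrightarrow> \<chi> (\<psi> n) = n"
  unfolding \<chi>_def \<psi>_def[symmetric] using bij_psi by (metis bij_betw_def inv_into_f_f)

lemma psi_chi: "n \<in> N \<Longrightarrow> \<psi> (\<chi> n) = n" and chi_in: "n \<in> N \<Longrightarrow> \<chi> n \<in> N"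
  unfolding \<chi>_def \<psi>_def[symmetric] using bij_psi
  by (metis bij_betw_imp_surj_on f_inv_into_f) (metis bij_betw_imp_surj_on inv_into_into bij_psi)

lemma s_psi: "n \<in> N \<Longrightarrow> s (\<theta> (\<psi> n)) = s (\<theta> n)"
  using s_phi psi[of n] by auto

text \<open>The induction runs over all \<open>n\<close> whose first return to \<open>s n\<close> or
  lower happens right after \<open>k\<close>: \<open>\<phi>\<close> either ends at
  \<open>\<sigma> k\<close> or moves to the matched rise one level down, which has the same
  property.\<close>

lemma return_phi:
  assumes k: "k \<in> N - L"
  shows "\<exists>j. walk \<phi> (\<lambda>z. z \<notin> L) k j \<and> \<phi> j = \<sigma> k \<and> \<sigma> k \<notin> L"
proof -
  have "\<exists>j. walk \<phi> (\<lambda>z. z \<notin> L) n j \<and> \<phi> j = \<sigma> k"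
    if "n \<in> N" "walk \<kappa> (\<lambda>z. s z \<le> s n) n k" "s (\<kappa> k) \<le> s n" for n
    using that
  proof (induction "nat (s n - s (\<kappa> k))" arbitrary: n rule: less_induct)
    case less
    show ?case using less.prems(1)
    proof (cases rule: phi_cases)
      case (same k')
      have "k' = k" using walk_stop_unique[OF same(2) _ less.prems(2)] same less.prems by auto
      then show ?thesis using same by blast
    next
      case (lower k')
      have k': "k' = k" using walk_stop_unique[OF lower(2) _ less.prems(2)] lower less.prems by auto
      have "walk \<kappa> (\<lambda>z. s z \<le> s (\<phi> n)) (\<phi> n) n"
        using lower(4) by (rule walk_mono) (use lower in auto)
      moreover have "walk \<kappa> (\<lambda>z. s z \<le> s (\<phi> n)) n k"
        using less.prems(2) by (rule walk_mono) (use lower in auto)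
      ultimately have "walk \<kappa> (\<lambda>z. s z \<le> s (\<phi> n)) (\<phi> n) k" by (rule walk_trans)
      then obtain j where "walk \<phi> (\<lambda>z. z \<notin> L) (\<phi> n) j" "\<phi> j = \<sigma> k"
        using less.hyps[of "\<phi> n"] lower k' phi_in less.prems by auto
      then show ?thesis using lower walk_step_left by metis
    qed
  qed
  from this[of k] show ?thesis using k s_kappa sigma_L by auto
qed

text \<open>Start at \<open>\<sigma> l\<close> and follow \<open>\<psi>\<close>, the inverse of
  \<open>\<chi>\<close>. The \<open>\<theta>\<close>-images of the elements met lie at one height,
  on a stretch of contour that begins right after \<open>l\<close> and never goes lower. The first
  element in \<open>L\<close> is the last point below this stretch, which is \<open>l\<close>;
  reversing the walk gives the claim.\<close>

lemma return_chi:
  assumes l: "l \<in> L"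
  shows "\<exists>j. walk \<chi> (\<lambda>z. z \<in> L) l j \<and> \<chi> j = \<sigma> l \<and> \<sigma> l \<in> L"
proof -
  define c where "c = \<sigma> l"
  define v where "v = s (\<theta> c)"
  have lN: "l \<in> N" and cN: "c \<in> N" and cL: "c \<in> L" using l L_sub sigma_L c_def by auto
  have \<kappa>l: "\<kappa> l = \<theta> c" by (simp add: \<kappa>_def c_def)
  have sl: "s l < v" using s_kappa(1)[OF l] \<kappa>l v_def by auto
  have step: "\<psi> x = l \<or> \<psi> x \<notin> L \<and> s (\<theta> (\<psi> x)) = v \<and> walk \<kappa> (\<lambda>z. s z < v) (\<theta> c) (\<theta> (\<psi> x))"
    if x: "x \<in> N" "s (\<theta> x) = v" "walk \<kappa> (\<lambda>z. s z < v) (\<theta> c) (\<theta> x)" for x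
  proof -
    have p: "\<theta> x \<in> N" using x by auto
    from p show ?thesis
    proof (cases rule: phi_cases)
      case (same k)
      have "walk \<kappa> (\<lambda>z. s z < v) (\<theta> x) k" using same(2) by (rule walk_mono) (use x in auto)
      then have "walk \<kappa> (\<lambda>z. s z < v) (\<theta> x) (\<kappa> k)" using walk_step[of \<kappa> _ "\<theta> x" k] same x by auto
      then have "walk \<kappa> (\<lambda>z. s z < v) (\<theta> c) (\<kappa> k)" using x walk_trans by metis
      then show ?thesis using same x psi[of x] by (auto simp: \<kappa>_def)
    next
      case (lower k)
      have "walk \<kappa> (\<lambda>z. s z < v) l (\<theta> x)"
        using walk_step_left[of "\<lambda>z. s z < v" \<kappa> l] x \<kappa>l v_def by auto
      then have "\<phi> (\<theta> x) = l"
        using walk_start_unique[OF inj(3) into(3) _ lN _ _ lower(4)] lower x sl phi_in[OF p] by auto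
      then show ?thesis using psi[of x] by simp
    qed
  qed
  obtain i where i: "i > 0" "(\<psi> ^^ i) c = c" using funpow_returns[OF fin bij_psi cN] by blast
  then obtain m where m: "walk \<psi> (\<lambda>z. z \<in> L) c m" "\<psi> m \<in> L"
    using walk_stop_exists[of "\<lambda>z. z \<in> L" i \<psi> c] cL by auto
  have inv: "m \<in> N \<and> s (\<theta> m) = v \<and> walk \<kappa> (\<lambda>z. s z < v) (\<theta> c) (\<theta> m)" using m(1)
  proof (induction rule: walk_induct)
    case refl
    then show ?case using cN v_def by auto
  next
    case (step y)
    then have "\<psi> y \<noteq> l" using l by auto
    then show ?case using \<open>\<And>x. _ \<Longrightarrow> _ \<Longrightarrow> _ \<Longrightarrow> \<psi> x = l \<or> _\<close>[of y] step psi_in by auto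
  qed
  then have "\<psi> m = l" using step[of m] m by auto
  then have "walk \<chi> (\<lambda>z. z \<in> L) l (\<psi> c)" using walk_reverse[OF m(1) psi_in cN, of \<chi>] chi_psi by auto
  moreover have "\<chi> (\<psi> c) = \<sigma> l" using chi_psi cN c_def by auto
  ultimately show ?thesis using cL c_def by auto
qed

sublocale M: leveled_map N \<theta> \<sigma> \<phi> \<chi> s L
proof
  show "L = {n \<in> N. s (\<theta> n) = s n + 1}" using up down L_sub by force
  show "\<And>n. n \<in> N \<Longrightarrow> s (\<theta> n) \<le> s n + 1" using up down by (metis DiffI dual_order.trans order_refl less_add_one less_imp_le)
  show "\<And>n. n \<in> N \<Longrightarrow> \<phi> (\<theta> (\<chi> n)) = n" using psi_chi psi by metis
qed (use fin bij_theta bij_phi s_phi chi_in psi_chi return_phi return_chi in auto)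

section \<open>Existence and uniqueness of the pointed vertex\<close>

lemma psi_funpow: assumes "x \<in> N" shows "(\<psi> ^^ i) x \<in> N" "s (\<theta> ((\<psi> ^^ i) x)) = s (\<theta> x)"
proof -
  show *: "(\<psi> ^^ i) x \<in> N" for i using funpow_in[OF psi_in assms] .
  show "s (\<theta> ((\<psi> ^^ i) x)) = s (\<theta> x)"
    by (induction i) (use s_psi[OF *] in simp_all)
qed

text \<open>An increasing edge into a vertex of minimal height would start below the
  minimum.\<close>

lemma pointed_exists:
  assumes "N \<noteq> {}"
  shows "\<exists>x\<in>N. \<forall>i. (\<psi> ^^ i) x \<notin> L"
proof -
  obtain m where m: "m \<in> N" "\<And>z. z \<in> N \<Longrightarrow> s m \<le> s z"
    using fin assms by (metis arg_min_if_finite(1) arg_min_least)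
  obtain x where x: "x \<in> N" "\<theta> x = m" using theta_surj m by blast
  have "(\<psi> ^^ i) x \<notin> L" for i
    using psi_funpow[OF x(1), of i] m(2)[of "(\<psi> ^^ i) x"] up[of "(\<psi> ^^ i) x"] x by auto
  then show ?thesis using x by auto
qed

text \<open>Without an incoming rise, every return of the contour to the height of the vertex is of
  the first kind and passes to the next corner of the same vertex. So the contour never gets
  below.\<close>

lemma pointed_walk:
  assumes x: "x \<in> N" "\<forall>i. (\<psi> ^^ i) x \<notin> L" and z: "z \<in> N"
  shows "\<exists>i. walk \<kappa> (\<lambda>z. s z \<le> s (\<theta> x)) (\<theta> ((\<psi> ^^ i) x)) z"
proof -
  obtain j where j: "z = (\<kappa> ^^ j) (\<theta> x)" using cyc[of "\<theta> x" z] x z by auto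
  have "\<exists>i. walk \<kappa> (\<lambda>z. s z \<le> s (\<theta> x)) (\<theta> ((\<psi> ^^ i) x)) ((\<kappa> ^^ j) (\<theta> x))"
  proof (induction j)
    case 0
    show ?case by (rule exI[of _ 0]) auto
  next
    case (Suc j)
    define y where "y = (\<kappa> ^^ j) (\<theta> x)"
    obtain i where i: "walk \<kappa> (\<lambda>z. s z \<le> s (\<theta> x)) (\<theta> ((\<psi> ^^ i) x)) y" using Suc y_def by blast
    define p where "p = \<theta> ((\<psi> ^^ i) x)"
    have p: "p \<in> N" "s p = s (\<theta> x)" "\<phi> p \<notin> L" "\<phi> p = (\<psi> ^^ Suc i) x"
      using psi_funpow[OF x(1), of i] x(2)[rule_format, of "Suc i"] p_def psi[of "(\<psi> ^^ i) x"] by simp_all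
    show ?case
    proof (cases "s (\<kappa> y) \<le> s (\<theta> x)")
      case False
      then have "walk \<kappa> (\<lambda>z. s z \<le> s (\<theta> x)) (\<theta> ((\<psi> ^^ i) x)) ((\<kappa> ^^ Suc j) (\<theta> x))"
        using walk_step[OF i] y_def by simp
      then show ?thesis by blast
    next
      case True
      show ?thesis using p(1)
      proof (cases rule: phi_cases)
        case (same k)
        have "k = y" using walk_stop_unique[OF same(2) _ i[folded p_def, folded p(2)]] same True p by auto
        then have "\<kappa> y = \<theta> ((\<psi> ^^ Suc i) x)" using same p(4) by (simp add: \<kappa>_def)
        then show ?thesis using y_def by (intro exI[of _ "Suc i"]) auto
      qed (use p in auto)
    qed
  qed
  then show ?thesis using j by auto
qed

text \<open>Both vertices attain the minimal height, and a walk whose steps enter only higher points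
  can end at that height only if it is trivial.\<close>

lemma pointed_unique:
  assumes x: "x \<in> N" "\<forall>i. (\<psi> ^^ i) x \<notin> L" and y: "y \<in> N" "\<forall>i. (\<psi> ^^ i) y \<notin> L"
  shows "\<exists>i. (\<psi> ^^ i) x = y"
proof -
  have ge: "s (\<theta> x) \<le> s z" if xz: "x \<in> N" "\<forall>i. (\<psi> ^^ i) x \<notin> L" "z \<in> N" for x z
  proof -
    obtain i where i: "walk \<kappa> (\<lambda>z. s z \<le> s (\<theta> x)) (\<theta> ((\<psi> ^^ i) x)) z" using pointed_walk[OF xz] by blast
    then show ?thesis by (rule walk_cases_right) (use psi_funpow[OF xz(1), of i] in auto)
  qed
  have "s (\<theta> x) = s (\<theta> y)" using ge[OF x, of "\<theta> y"] ge[OF y, of "\<theta> x"] x y by auto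
  obtain i where i: "walk \<kappa> (\<lambda>z. s z \<le> s (\<theta> x)) (\<theta> ((\<psi> ^^ i) x)) (\<theta> y)" using pointed_walk x y by (meson in_N(1))
  then have "\<theta> ((\<psi> ^^ i) x) = \<theta> y" by (rule walk_cases_right) (use \<open>s (\<theta> x) = s (\<theta> y)\<close> in auto)
  then show ?thesis using inj(1) psi_funpow[OF x(1), of i] y by (metis inj_onD)
qed

end

section \<open>Rotation systems and Eulerian maps\<close>

lemma orbit_eq: "p permutes S \<Longrightarrow> finite S \<Longrightarrow> y \<in> orbit p x \<Longrightarrow> orbit p y = orbit p x"
  using cyclic_on_orbit orbit_cyclic_eq3 by metis

lemma self_in_orbit: "p permutes S \<Longrightarrow> finite S \<Longrightarrow> x \<in> orbit p x"
  by (meson permutation_permutes permutation_self_in_orbit)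

lemma orbit_funpow:
  assumes "p permutes S" "finite S"
  shows "y \<in> orbit p x \<longleftrightarrow> (\<exists>i. (p ^^ i) x = y)"
proof -
  have "permutation p" using assms by (auto simp: permutation_permutes)
  then show ?thesis by (auto simp: orbit_altdef_permutation)
qed

lemma funpow_closed_onto:
  assumes "finite S" "inj_on f S" "f ` S \<subseteq> S" "f x \<in> S" "inj f"
  shows "x \<in> S"
proof -
  have "f ` S = S" using assms by (simp add: endo_inj_surj)
  then show ?thesis using assms by (metis inj_image_mem_iff)
qed

text \<open>Serves two alternations: incoming and outgoing edges around a vertex of an Eulerian map,
  and the two sides of the bipartition along the face of a mobile.\<close>

lemma even_funpow:
  assumes alt: "\<And>z. z \<in> D \<Longrightarrow> f z \<in> D \<and> (f z \<in> N \<longleftrightarrow> z \<notin> N)"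
    and "x \<in> D" "x \<in> N" "(f ^^ i) x \<in> N"
  shows "\<exists>j. ((f \<circ> f) ^^ j) x = (f ^^ i) x"
proof -
  have D: "(f ^^ i) x \<in> D" for i by (induction i) (use alt assms(2) in auto)
  have "(f ^^ i) x \<in> N \<longleftrightarrow> even i" for i
    by (induction i) (use alt[OF D] assms(3) in auto)
  then obtain j where "i = j + j" using assms(4) by (metis evenE mult_2)
  then have "((f ^^ 2) ^^ j) x = (f ^^ i) x" by (simp add: funpow_mult[symmetric] mult_2[symmetric] flip: funpow_mult)
  then show ?thesis by (auto simp: numeral_2_eq_2)
qed

text \<open>An induced permutation meets the points of the orbit in \<open>P\<close> one after the
  other; the induction keeps track of the latest visit.\<close>

lemma return_orbit:
  assumes ret: "\<And>x. x \<in> P \<Longrightarrow> \<exists>j. walk f (\<lambda>z. z \<in> P) x j \<and> f j = \<sigma> x \<and> \<sigma> x \<in> P"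
    and x: "x \<in> P" and y: "(f ^^ i) x \<in> P"
  shows "\<exists>j. (\<sigma> ^^ j) x = (f ^^ i) x"
proof -
  have "\<exists>j. (\<sigma> ^^ j) x \<in> P \<and> walk f (\<lambda>z. z \<in> P) ((\<sigma> ^^ j) x) ((f ^^ i) x)" for i
  proof (induction i)
    case 0
    show ?case using x by (intro exI[of _ 0]) auto
  next
    case (Suc i)
    then obtain j where j: "(\<sigma> ^^ j) x \<in> P" "walk f (\<lambda>z. z \<in> P) ((\<sigma> ^^ j) x) ((f ^^ i) x)" by blast
    show ?case
    proof (cases "(f ^^ Suc i) x \<in> P")
      case True
      obtain k where k: "walk f (\<lambda>z. z \<in> P) ((\<sigma> ^^ j) x) k" "f k = (\<sigma> ^^ Suc j) x" "(\<sigma> ^^ Suc j) x \<in> P"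
        using ret[OF j(1)] by auto
      have "k = (f ^^ i) x" using walk_stop_unique[OF k(1) _ j(2)] k True by auto
      then have "(\<sigma> ^^ Suc j) x = (f ^^ Suc i) x" using k by simp
      then show ?thesis using k(3) by (metis walk_refl)
    next
      case False
      then have "walk f (\<lambda>z. z \<in> P) ((\<sigma> ^^ j) x) ((f ^^ Suc i) x)" using walk_step[OF j(2)] by simp
      then show ?thesis using j by blast
    qed
  qed
  then obtain j where "walk f (\<lambda>z. z \<in> P) ((\<sigma> ^^ j) x) ((f ^^ i) x)" by blast
  then have "(\<sigma> ^^ j) x = (f ^^ i) x" by (rule walk_cases_right) (use y in auto)
  then show ?thesis by blast
qed

section \<open>Cells and connectedness of rotation systems\<close>

locale rotation_system =
  fixes m :: "('d, 'z) cmap_scheme"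
  assumes finite_darts: "finite (darts m)"
    and rot_perm: "rot m permutes darts m" and opp_perm: "opp m permutes darts m"
    and opp_invol: "\<And>x. x \<in> darts m \<Longrightarrow> opp m x \<noteq> x \<and> opp m (opp m x) = x"
begin

lemma opp_opp [simp]: "opp m (opp m x) = x"
  using opp_invol opp_perm by (cases "x \<in> darts m") (auto simp: permutes_not_in)

lemma opp_in [simp]: "opp m x \<in> darts m \<longleftrightarrow> x \<in> darts m"
  using opp_perm by (simp add: permutes_in_image)

lemma rot_in [simp]: "rot m x \<in> darts m \<longleftrightarrow> x \<in> darts m"
  using rot_perm by (simp add: permutes_in_image)

lemma inv_rot [simp]: "inv (rot m) (rot m x) = x" "rot m (inv (rot m) x) = x"
  using permutes_inverses[OF rot_perm] by auto

lemma inv_rot_in [simp]: "inv (rot m) x \<in> darts m \<longleftrightarrow> x \<in> darts m"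
  using permutes_inv[OF rot_perm] by (simp add: permutes_in_image)

lemma face_step_perm: "face_step m permutes darts m"
proof -
  have "face_step m = inv (rot m) \<circ> opp m" by (auto simp: face_step_def)
  then show ?thesis using permutes_compose[OF opp_perm permutes_inv[OF rot_perm]] by simp
qed

lemma face_step_in [simp]: "face_step m x \<in> darts m \<longleftrightarrow> x \<in> darts m"
  by (simp add: face_step_def)

lemma face_step_opp_rot [simp]: "face_step m (opp m (rot m x)) = x"
  by (simp add: face_step_def)

lemma vertex_in: "x \<in> darts m \<Longrightarrow> vertex m x \<subseteq> darts m"
  unfolding vertex_def using permutes_orbit_subset[OF rot_perm] .

lemma face_in: "x \<in> darts m \<Longrightarrow> face m x \<subseteq> darts m"
  unfolding face_def using permutes_orbit_subset[OF face_step_perm] .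

lemma self_in_vertex [simp]: "x \<in> vertex m x"
  unfolding vertex_def using self_in_orbit[OF rot_perm finite_darts] .

lemma self_in_face [simp]: "x \<in> face m x"
  unfolding face_def using self_in_orbit[OF face_step_perm finite_darts] .

lemma vertex_eq: "y \<in> vertex m x \<Longrightarrow> vertex m y = vertex m x"
  unfolding vertex_def using orbit_eq[OF rot_perm finite_darts] .

lemma face_eq: "y \<in> face m x \<Longrightarrow> face m y = face m x"
  unfolding face_def using orbit_eq[OF face_step_perm finite_darts] .

lemma vertex_rot [simp]: "vertex m (rot m x) = vertex m x"
  by (rule vertex_eq) (simp add: vertex_def orbit.base)

lemma vertex_inv_rot [simp]: "vertex m (inv (rot m) x) = vertex m x"
  using vertex_rot[of "inv (rot m) x"] by simp

lemma vertex_face_step [simp]: "vertex m (face_step m x) = vertex m (opp m x)"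
  by (simp add: face_step_def)

lemma face_face_step [simp]: "face m (face_step m x) = face m x"
  by (rule face_eq) (simp add: face_def orbit.base)

lemma vertex_funpow: "y \<in> vertex m x \<longleftrightarrow> (\<exists>i. (rot m ^^ i) x = y)"
  unfolding vertex_def using orbit_funpow[OF rot_perm finite_darts] .

lemma face_funpow: "y \<in> face m x \<longleftrightarrow> (\<exists>i. (face_step m ^^ i) x = y)"
  unfolding face_def using orbit_funpow[OF face_step_perm finite_darts] .

lemma vertex_funpow_inv: "y \<in> vertex m x \<longleftrightarrow> (\<exists>i. (inv (rot m) ^^ i) x = y)"
proof -
  have "permutation (rot m)" using rot_perm finite_darts by (auto simp: permutation_permutes)
  then have "vertex m x = orbit (inv (rot m)) x" unfolding vertex_def by (simp add: orbit_inv_eq)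
  then show ?thesis using orbit_funpow[OF permutes_inv[OF rot_perm] finite_darts] by simp
qed

lemma connected_closure:
  assumes conn: "connected_map m" and x: "x \<in> S" "x \<in> darts m" "y \<in> darts m"
    and closed: "\<And>z. z \<in> S \<Longrightarrow> z \<in> darts m \<Longrightarrow> rot m z \<in> S" "\<And>z. z \<in> S \<Longrightarrow> z \<in> darts m \<Longrightarrow> opp m z \<in> S"
  shows "y \<in> S"
proof -
  have "(x, y) \<in> ({(z, rot m z) | z. z \<in> darts m} \<union> {(z, opp m z) | z. z \<in> darts m})\<^sup>*"
    using conn x unfolding connected_map_def by blast
  then show ?thesis by (induction rule: rtrancl_induct) (use x closed in auto)
qed

text \<open>The set reachable from \<open>x\<close> is finite and mapped into itself by
  \<open>rot m\<close>, hence also by its inverse. Face steps, which use the inverse, thereby become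
  admissible moves.\<close>

lemma connectedI:
  assumes "\<And>S x y. x \<in> S \<Longrightarrow> S \<subseteq> darts m \<Longrightarrow> (\<And>z. z \<in> S \<Longrightarrow> rot m z \<in> S \<and> opp m z \<in> S \<and> inv (rot m) z \<in> S) \<Longrightarrow>
    y \<in> darts m \<Longrightarrow> y \<in> S"
  shows "connected_map m"
  unfolding connected_map_def
proof (intro ballI)
  fix x y assume xy: "x \<in> darts m" "y \<in> darts m"
  define R where "R = ({(z, rot m z) | z. z \<in> darts m} \<union> {(z, opp m z) | z. z \<in> darts m})\<^sup>*"
  define S where "S = {z \<in> darts m. (x, z) \<in> R}"
  have closed: "rot m z \<in> S" "opp m z \<in> S" if "z \<in> S" for z
    using that unfolding S_def R_def by (auto intro: rtrancl.rtrancl_into_rtrancl)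
  have "inv (rot m) z \<in> S" if z: "z \<in> S" for z
  proof (rule funpow_closed_onto[of S "rot m"])
    show "finite S" unfolding S_def using finite_darts by auto
    show "rot m ` S \<subseteq> S" using closed by auto
    show "inj (rot m)" using permutes_inj[OF rot_perm] .
    then show "inj_on (rot m) S" using inj_on_subset by blast
    show "rot m (inv (rot m) z) \<in> S" using z by simp
  qed
  then have "y \<in> S"
    using xy closed by - (rule assms[of x S], auto simp: S_def R_def)
  then show "(x, y) \<in> R" by (simp add: S_def)
qed

end

lemma is_map_rotation_system: "is_map m \<Longrightarrow> rotation_system m"
  unfolding is_map_def rotation_system_def by auto

section \<open>Orientation and labels of a pointed Eulerian map\<close>

locale eulerian =
  fixes m :: "'d emap"
  assumes rp: "rp_eulerian_map m"
begin

sublocale rotation_system m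
  using rp is_map_rotation_system by (auto simp: rp_eulerian_map_def eulerian_map_def)

abbreviation "D \<equiv> darts m"
abbreviation "\<alpha> \<equiv> opp m"
abbreviation "f \<equiv> face_step m"

text \<open>A dart of \<open>W\<close> is an edge in its Eulerian orientation. The edge is named by
  its reversal in \<open>N\<close>, which leaves its endpoint and has the black face on its left. So
  on \<open>N\<close>, \<open>lab\<close> is the label at the endpoint of the oriented edge and
  \<open>s\<close> the label at its origin.\<close>

definition W :: "'d set" where "W = {x\<in>D. black_right m x}"
definition N :: "'d set" where "N = {x\<in>D. \<not> black_right m x}"
definition \<theta> :: "'d \<Rightarrow> 'd" where "\<theta> x = \<alpha> (f (\<alpha> x))"
definition lab :: "'d \<Rightarrow> int" where "lab x = label m (vertex m x)"
definition s :: "'d \<Rightarrow> int" where "s x = lab (\<alpha> x)"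
definition L :: "'d set" where "L = {x\<in>N. lab x = s x + 1}"

lemma connected: "connected_map m" and D_nonempty: "D \<noteq> {}"
  using rp by (auto simp: rp_eulerian_map_def eulerian_map_def is_map_def)

lemma N_or_W: "x \<in> D \<Longrightarrow> x \<notin> N \<longleftrightarrow> x \<in> W" "N \<subseteq> D" "W \<subseteq> D" "x \<in> N \<Longrightarrow> x \<in> D" "x \<in> W \<Longrightarrow> x \<in> D"
  by (auto simp: N_def W_def)

lemma W_iff: "x \<in> D \<Longrightarrow> x \<in> W \<longleftrightarrow> fcol m (face m x) = White"
  using rp unfolding rp_eulerian_map_def eulerian_map_def W_def black_right_def
  by (cases "fcol m (face m x)"; cases "fcol m (face m (opp m x))"; fastforce)

lemma W_face_step [simp]: "f x \<in> W \<longleftrightarrow> x \<in> W"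
  by (cases "x \<in> D") (auto simp: W_iff dest: N_or_W(5))

lemma W_opp [simp]: "\<alpha> x \<in> W \<longleftrightarrow> x \<in> N"
proof (cases "x \<in> D")
  case True
  then have "fcol m (face m x) \<noteq> fcol m (face m (\<alpha> x))"
    using rp by (auto simp: rp_eulerian_map_def eulerian_map_def)
  then have "\<alpha> x \<in> W \<longleftrightarrow> x \<notin> W" using True W_iff[of x] W_iff[of "\<alpha> x"]
    by (cases "fcol m (face m x)"; cases "fcol m (face m (\<alpha> x))") auto
  then show ?thesis using True N_or_W by blast
next
  case False
  then show ?thesis using N_or_W opp_in by blast
qed

lemma N_opp [simp]: "\<alpha> x \<in> N \<longleftrightarrow> x \<in> W"
  using W_opp[of "\<alpha> x"] by simp

lemma N_face_step [simp]: "f x \<in> N \<longleftrightarrow> x \<in> N"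
  using N_or_W W_face_step face_step_in by metis

lemma W_rot [simp]: "rot m x \<in> W \<longleftrightarrow> x \<in> N"
  using W_opp[of "rot m x"] N_face_step[of "\<alpha> (rot m x)"] W_face_step[of "\<alpha> (rot m x)"] by simp

lemma N_rot [simp]: "rot m x \<in> N \<longleftrightarrow> x \<in> W"
  using W_opp[of "rot m x"] W_face_step[of "\<alpha> (rot m x)"] by simp

lemma lab_simps [simp]: "lab (rot m x) = lab x" "lab (f x) = lab (\<alpha> x)" "lab (inv (rot m) x) = lab x"
  by (auto simp: lab_def)

lemma s_theta: "s (\<theta> x) = lab x"
  by (simp add: s_def \<theta>_def)

lemma arc: "x \<in> W \<Longrightarrow> (vertex m x, vertex m (\<alpha> x)) \<in> arcs m"
  unfolding arcs_def W_def by auto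

text \<open>The boundary of a white face is a directed cycle.\<close>

lemma arc_back: assumes "x \<in> W" shows "(vertex m (\<alpha> x), vertex m x) \<in> (arcs m)\<^sup>*"
proof -
  have *: "(vertex m (f x), vertex m ((f ^^ Suc i) x)) \<in> (arcs m)\<^sup>*" for i
  proof (induction i)
    case (Suc i)
    have "(f ^^ Suc i) x \<in> W" by (induction i) (use assms in auto)
    then have "(vertex m ((f ^^ Suc i) x), vertex m ((f ^^ Suc (Suc i)) x)) \<in> arcs m"
      using arc[of "(f ^^ Suc i) x"] by simp
    then show ?case using Suc by (rule rtrancl_into_rtrancl[rotated])
  qed auto
  have "bij_betw f D D" using face_step_perm by (rule permutes_imp_bij)
  then obtain i where "i > 0" "(f ^^ i) x = x" using funpow_returns[OF finite_darts] assms N_or_W by blast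
  then show ?thesis using *[of "i - 1"] by simp
qed

lemma point_dart: obtains x where "x \<in> D" "point m = vertex m x"
  using rp by (auto simp: rp_eulerian_map_def vertices_def)

text \<open>Arcs are one-way, but \<open>arc_back\<close> undoes each of them, so directed paths
  exist wherever undirected ones do.\<close>

lemma reachable: assumes "y \<in> D" shows "(point m, vertex m y) \<in> (arcs m)\<^sup>*"
proof -
  obtain x where x: "x \<in> D" "point m = vertex m x" using point_dart .
  have "y \<in> {y. (point m, vertex m y) \<in> (arcs m)\<^sup>*}"
  proof (rule connected_closure[OF connected _ x(1) assms])
    fix z assume z: "z \<in> {y. (point m, vertex m y) \<in> (arcs m)\<^sup>*}" "z \<in> D"
    have "(vertex m z, vertex m (\<alpha> z)) \<in> (arcs m)\<^sup>*"
    proof (cases "z \<in> W")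
      case True
      then show ?thesis using arc by blast
    next
      case False
      then show ?thesis using arc_back[of "\<alpha> z"] z N_or_W by auto
    qed
    then show "opp m z \<in> {y. (point m, vertex m y) \<in> (arcs m)\<^sup>*}" using z by auto
  qed (use x in auto)
  then show ?thesis by simp
qed

lemma lab_path: assumes "y \<in> D" shows "(point m, vertex m y) \<in> arcs m ^^ nat (lab y)"
proof -
  have "\<exists>k. (point m, vertex m y) \<in> arcs m ^^ k" using reachable[OF assms] by (simp add: rtrancl_power)
  then show ?thesis unfolding lab_def label_def by (metis LeastI nat_int)
qed

lemma lab_le: assumes "(point m, vertex m y) \<in> arcs m ^^ k" shows "lab y \<le> int k"
  unfolding lab_def label_def using Least_le[of "\<lambda>k. (point m, vertex m y) \<in> arcs m ^^ k" k] assms by simp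

lemma lab_nonneg: "lab y \<ge> 0" by (simp add: lab_def label_def)

lemma lab_0_iff: assumes "y \<in> D" shows "lab y = 0 \<longleftrightarrow> vertex m y = point m"
proof
  show "lab y = 0 \<Longrightarrow> vertex m y = point m" using lab_path[OF assms] by auto
  assume "vertex m y = point m"
  then show "lab y = 0" using lab_le[of y 0] lab_nonneg[of y] by auto
qed

lemma lab_arc: assumes "x \<in> W" shows "lab (\<alpha> x) \<le> lab x + 1"
proof -
  have "(point m, vertex m (\<alpha> x)) \<in> arcs m ^^ Suc (nat (lab x))"
    using lab_path[of x] arc[OF assms] assms N_or_W by auto
  then show ?thesis using lab_le lab_nonneg[of x] by fastforce
qed

text \<open>The last arc of a shortest path from the pointed vertex is increasing.\<close>

lemma L_in_vertex:
  assumes "y \<in> D" "vertex m y \<noteq> point m"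
  shows "\<exists>n\<in>L. n \<in> vertex m y"
proof -
  have "lab y \<noteq> 0" using assms lab_0_iff by auto
  then have pos: "lab y > 0" using lab_nonneg[of y] by simp
  then obtain k where k: "nat (lab y) = Suc k" by (metis not0_implies_Suc zero_less_nat_eq less_numeral_extra(3))
  then obtain u where u: "(point m, u) \<in> arcs m ^^ k" "(u, vertex m y) \<in> arcs m"
    using lab_path[OF assms(1)] by auto
  then obtain x where x: "x \<in> W" "u = vertex m x" "vertex m y = vertex m (\<alpha> x)"
    unfolding arcs_def W_def by auto
  have "lab x \<le> int k" using lab_le u x by auto
  moreover have "lab (\<alpha> x) = int k + 1" using k pos x by (auto simp: lab_def)
  ultimately have "lab (\<alpha> x) = lab x + 1" using lab_arc[OF x(1)] by linarith
  then have "\<alpha> x \<in> L" unfolding L_def s_def using x by auto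
  then show ?thesis using x by (metis self_in_vertex)
qed

lemma L_not_point: "x \<in> L \<Longrightarrow> vertex m x \<noteq> point m"
  using lab_0_iff[of x] lab_nonneg[of "\<alpha> x"] N_or_W unfolding L_def s_def by force

lemma mob_kind: "x \<in> D \<Longrightarrow> mob_kind m x =
    (if x \<in> W then Unlabelled White else if x \<in> L then Labelled (lab x) else Unlabelled Black)"
  unfolding mob_kind_def increasing_def W_def L_def N_def lab_def s_def by auto

lemma mob_rot_W: "x \<in> W \<Longrightarrow> mob_rot m x = f x"
  using N_or_W by (auto simp: mob_rot_def mob_kind)

lemma L_N: "L \<subseteq> N" by (auto simp: L_def)

lemma N_not_W: "x \<in> N \<Longrightarrow> x \<notin> W" by (auto simp: N_def W_def)

section \<open>The mobile rotation as an induced permutation\<close>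

lemma bij_f: "bij_betw f N N"
proof -
  have "inj_on f N" using permutes_inj[OF face_step_perm] inj_on_subset by blast
  moreover have "finite N" using N_or_W finite_darts finite_subset by blast
  ultimately show ?thesis by (auto intro!: bij_betw_selfI)
qed

text \<open>The darts skipped by a double rotation lie in \<open>W\<close>, hence outside
  \<open>L\<close>, so single and double rotation make the same first return.\<close>

lemma walk_rot_rot:
  assumes "walk (rot m \<circ> rot m) (\<lambda>z. z \<in> L) x j" "x \<in> N"
  shows "walk (rot m) (\<lambda>z. z \<in> L) x j \<and> j \<in> N"
  using assms(1)
proof (induction rule: walk_induct)
  case refl
  then show ?case using assms by auto
next
  case (step y)
  then have "rot m y \<notin> L" using L_N N_not_W W_rot by blast
  then show ?case using step walk_step[of "rot m" _ x y] walk_step[of "rot m" _ x "rot m y"] by auto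
qed

sublocale leveled_map N \<theta> "mob_rot m" f "rot m \<circ> rot m" s L
proof
  show fin: "finite N" using N_or_W finite_darts finite_subset by blast
  have "inj \<alpha>" using permutes_inj[OF opp_perm] .
  then have "inj_on \<theta> N" unfolding \<theta>_def
    by (intro inj_onI) (metis injD permutes_inj[OF face_step_perm])
  moreover have "\<theta> ` N \<subseteq> N" unfolding \<theta>_def by auto
  ultimately show "bij_betw \<theta> N N" using fin by (auto intro!: bij_betw_selfI)
  show "bij_betw f N N" using bij_f .
  show "L = {n \<in> N. s (\<theta> n) = s n + 1}" unfolding L_def s_theta ..
  show "\<And>n. n \<in> N \<Longrightarrow> s (\<theta> (f n)) = s n" unfolding s_theta by (simp add: s_def)
  show "s (\<theta> n) \<le> s n + 1" if "n \<in> N" for n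
    unfolding s_theta using lab_arc[of "\<alpha> n"] that by (simp add: s_def)
  show "\<And>n. n \<in> N \<Longrightarrow> (rot m \<circ> rot m) n \<in> N" by simp
  show "\<And>n. n \<in> N \<Longrightarrow> f (\<theta> ((rot m \<circ> rot m) n)) = n" by (simp add: \<theta>_def)
  show "\<exists>j. walk f (\<lambda>z. z \<notin> L) k j \<and> f j = mob_rot m k \<and> mob_rot m k \<notin> L" if k: "k \<in> N - L" for k
  proof -
    obtain i where "i > 0" "(f ^^ i) k = k" using funpow_returns[OF fin bij_f] k by blast
    then obtain j where j: "walk f (\<lambda>z. z \<notin> L) k j" "f j \<notin> L"
      using walk_stop_exists[of "\<lambda>z. z \<notin> L" i f k] k by auto
    have jN: "j \<in> N" using walk_in[OF j(1), of N] k by (auto simp: image_subset_iff)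
    have B: "mob_kind m z = Unlabelled Black \<longleftrightarrow> z \<notin> L" if "z \<in> N" for z
      using that N_not_W N_or_W by (auto simp: mob_kind)
    have "walk f (\<lambda>z. mob_kind m z = Unlabelled Black) (id k) (id j)"
      using j(1) by (rule walk_hom[where N = N]) (use k B in auto)
    moreover have "mob_kind m (f j) = Unlabelled Black" using B jN j by auto
    ultimately have "first_return f (\<lambda>z. mob_kind m z = Unlabelled Black) k = f j"
      using first_return_walk[of f _ k j] by auto
    then have "mob_rot m k = f j" using k B[of k] N_or_W by (auto simp: mob_rot_def)
    then show ?thesis using j by auto
  qed
  show "\<exists>j. walk (rot m \<circ> rot m) (\<lambda>z. z \<in> L) l j \<and> (rot m \<circ> rot m) j = mob_rot m l \<and> mob_rot m l \<in> L"
    if l: "l \<in> L" for l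
  proof -
    have lN: "l \<in> N" using l L_N by auto
    have "inj_on (rot m \<circ> rot m) N"
      by (intro inj_onI) (metis comp_apply injD permutes_inj[OF rot_perm])
    then have "bij_betw (rot m \<circ> rot m) N N" using fin by (auto intro!: bij_betw_selfI)
    then obtain i where "i > 0" "((rot m \<circ> rot m) ^^ i) l = l" using funpow_returns[OF fin _ lN] by blast
    then obtain j where j: "walk (rot m \<circ> rot m) (\<lambda>z. z \<in> L) l j" "(rot m \<circ> rot m) j \<in> L"
      using walk_stop_exists[of "\<lambda>z. z \<in> L" i "rot m \<circ> rot m" l] l by auto
    have w: "walk (rot m) (\<lambda>z. z \<in> L) l j" "j \<in> N" using walk_rot_rot[OF j(1) lN] by auto
    have "rot m j \<notin> L" using w L_N N_not_W W_rot by blast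
    then have w': "walk (rot m) (\<lambda>z. z \<in> L) l (rot m j)" using walk_step[OF w(1)] by auto
    have B: "(\<exists>l'. mob_kind m z = Labelled l') \<longleftrightarrow> z \<in> L" if "z \<in> D" for z
      using that N_not_W L_N by (auto simp: mob_kind)
    have "walk (rot m) (\<lambda>z. \<exists>l'. mob_kind m z = Labelled l') (id l) (id (rot m j))"
      using w' by (rule walk_hom[where N = D]) (use lN N_or_W B in auto)
    moreover have "\<exists>l'. mob_kind m (rot m (rot m j)) = Labelled l'" using B[of "rot m (rot m j)"] w(2) N_or_W j by auto
    ultimately have "first_return (rot m) (\<lambda>z. \<exists>l'. mob_kind m z = Labelled l') l = rot m (rot m j)"
      using first_return_walk[of "rot m" _ l "rot m j"] by auto
    then have "mob_rot m l = rot m (rot m j)" using l lN N_not_W N_or_W by (auto simp: mob_rot_def mob_kind)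
    then show ?thesis using j by auto
  qed
qed

lemma psi_inv_rot: "(f \<circ> \<theta>) x = (inv (rot m) \<circ> inv (rot m)) x"
  by (simp add: \<theta>_def face_step_def)

text \<open>Incoming and outgoing edges alternate around a vertex, so two incoming ones differ by an
  even number of rotations.\<close>

lemma same_vertex_N:
  assumes "x \<in> N" "y \<in> N" "y \<in> vertex m x"
  shows "\<exists>i. ((f \<circ> \<theta>) ^^ i) x = y"
proof -
  obtain i where i: "(inv (rot m) ^^ i) x = y" using assms vertex_funpow_inv by blast
  have "\<exists>j. ((inv (rot m) \<circ> inv (rot m)) ^^ j) x = (inv (rot m) ^^ i) x"
  proof (rule even_funpow[of D _ N])
    fix z assume "z \<in> D"
    then show "inv (rot m) z \<in> D \<and> (inv (rot m) z \<in> N) = (z \<notin> N)"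
      using W_rot[of "inv (rot m) z"] N_or_W by auto
  qed (use assms i N_or_W in auto)
  moreover have "f \<circ> \<theta> = inv (rot m) \<circ> inv (rot m)" using psi_inv_rot by auto
  ultimately show ?thesis using i by auto
qed

lemma kappa_trans: "x \<in> N \<Longrightarrow> y \<in> N \<Longrightarrow> \<exists>i. (\<kappa> ^^ i) x = y"
proof (rule kappa_transitive)
  have *: "vertex m x = point m" if x: "x \<in> N" "\<forall>i. ((f \<circ> \<theta>) ^^ i) x \<notin> L" for x
  proof (rule ccontr)
    assume "vertex m x \<noteq> point m"
    then obtain n where "n \<in> L" "n \<in> vertex m x" using L_in_vertex x N_or_W by blast
    then show False using same_vertex_N[of x n] x L_N by auto
  qed
  fix x y assume "x \<in> N" "y \<in> N" "\<forall>i. ((f \<circ> \<theta>) ^^ i) x \<notin> L" "\<forall>i. ((f \<circ> \<theta>) ^^ i) y \<notin> L"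
  then show "\<exists>i. ((f \<circ> \<theta>) ^^ i) x = y" using * same_vertex_N by (metis self_in_vertex)
qed

end

section \<open>The mobile of an Eulerian map\<close>

lemma funpow_cong_on:
  fixes f g :: "'a \<Rightarrow> 'a"
  assumes "\<And>z. z \<in> N \<Longrightarrow> f z = g z \<and> f z \<in> N" "x \<in> N"
  shows "(f ^^ i) x = (g ^^ i) x \<and> (f ^^ i) x \<in> N"
proof (induction i)
  case (Suc i)
  then show ?case using assms(1)[of "(f ^^ i) x"] by auto
qed (use assms(2) in simp)

lemma funpow_left_inverse:
  fixes f g :: "'a \<Rightarrow> 'a"
  assumes "\<And>x. f (g x) = x"
  shows "(f ^^ i) ((g ^^ i) x) = x"
proof (induction i)
  case (Suc i)
  then show ?case using assms by (simp add: funpow_swap1[of f])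
qed auto

section \<open>Faces of a bipartite map\<close>

locale bipartite = rotation_system t for t :: "('d, 'z) cmap_scheme" +
  fixes N :: "'d set"
  assumes N_sub: "N \<subseteq> darts t"
    and opp_N: "\<And>x. x \<in> darts t \<Longrightarrow> opp t x \<in> N \<longleftrightarrow> x \<notin> N"
    and rot_N: "\<And>x. x \<in> darts t \<Longrightarrow> rot t x \<in> N \<longleftrightarrow> x \<in> N"
    and nonempty: "darts t \<noteq> {}"
begin

text \<open>Rotation at the other end of an edge, carried over to the dart at this end.
  \<open>turn \<circ> rot t\<close> inverts two face steps, so the face count can be read off its
  cycles on \<open>N\<close>.\<close>

definition turn :: "'d \<Rightarrow> 'd" where "turn x = opp t (rot t (opp t x))"

lemma face_step_N: "x \<in> darts t \<Longrightarrow> face_step t x \<in> N \<longleftrightarrow> x \<notin> N"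
  using rot_N[of "face_step t x"] opp_N[of x] by (simp add: face_step_def)

lemma turn_rot_face: "(turn \<circ> rot t) ((face_step t \<circ> face_step t) x) = x"
  by (simp add: turn_def face_step_def)

lemma face_turn_rot: "(face_step t \<circ> face_step t) ((turn \<circ> rot t) x) = x"
  by (simp add: turn_def face_step_def)

lemma turn_rot_transitive:
  assumes "card (faces t) = 1" "x \<in> N" "y \<in> N"
  shows "\<exists>i. ((turn \<circ> rot t) ^^ i) x = y"
proof -
  have xy: "x \<in> darts t" "y \<in> darts t" using assms N_sub by auto
  obtain F where F: "faces t = {F}" using assms(1) card_1_singletonE by blast
  then have "face t x = F" "face t y = F" using xy unfolding faces_def by auto
  then have "x \<in> face t y" using self_in_face by metis
  then obtain i where i: "(face_step t ^^ i) y = x" using face_funpow by auto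
  have "\<exists>j. ((face_step t \<circ> face_step t) ^^ j) y = (face_step t ^^ i) y"
    by (rule even_funpow[of "darts t" _ N]) (use face_step_N xy assms i in auto)
  then obtain j where j: "((face_step t \<circ> face_step t) ^^ j) y = x" using i by auto
  have "((turn \<circ> rot t) ^^ j) (((face_step t \<circ> face_step t) ^^ j) y) = y"
    by (rule funpow_left_inverse) (rule turn_rot_face)
  then show ?thesis using j by auto
qed

lemma N_nonempty: obtains x where "x \<in> N"
  using nonempty opp_N by blast

context
  assumes trans: "\<And>x y. x \<in> N \<Longrightarrow> y \<in> N \<Longrightarrow> \<exists>i. ((turn \<circ> rot t) ^^ i) x = y"
begin

lemma one_face: "card (faces t) = 1"
proof -
  obtain x where x: "x \<in> N" using N_nonempty .
  have step: "face t ((turn \<circ> rot t) z) = face t z" for z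
    using face_face_step[of "face_step t ((turn \<circ> rot t) z)"] face_face_step[of "(turn \<circ> rot t) z"]
      face_turn_rot[of z] by (metis comp_apply)
  have pow: "face t (((turn \<circ> rot t) ^^ i) z) = face t z" for i z
    by (induction i) (use step in auto)
  have N: "face t y = face t x" if "y \<in> N" for y using trans[OF x that] pow by auto
  have "face t y = face t x" if "y \<in> darts t" for y
  proof (cases "y \<in> N")
    case False
    then have "face_step t y \<in> N" using face_step_N that by auto
    then show ?thesis using N face_face_step by metis
  qed (use N in auto)
  then have "faces t = {face t x}" unfolding faces_def using x N_sub by auto
  then show ?thesis by simp
qed

lemma connected: "connected_map t"
proof (rule connectedI)
  fix S x y
  assume S: "x \<in> S" "S \<subseteq> darts t" "\<And>z. z \<in> S \<Longrightarrow> rot t z \<in> S \<and> opp t z \<in> S \<and> inv (rot t) z \<in> S"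
    and y: "y \<in> darts t"
  obtain n where n: "n \<in> N" "n \<in> S" using S opp_N by blast
  have "((turn \<circ> rot t) ^^ i) n \<in> S" for i
    by (induction i) (use n S(3) in \<open>auto simp: turn_def\<close>)
  then have NS: "z \<in> S" if "z \<in> N" for z using trans[OF n(1) that] by auto
  show "y \<in> S"
  proof (cases "y \<in> N")
    case False
    then have "opp t y \<in> S" using NS opp_N y by auto
    then show ?thesis using S(3)[of "opp t y"] by simp
  qed (use NS in auto)
qed

end

end

text \<open>Classes that meet \<open>P\<close> are determined by their traces on \<open>P\<close>.
  This compares black faces and vertices of the map with the smaller dart sets that represent them
  in the mobile.\<close>

lemma card_trace:
  assumes "\<And>x. x \<in> P \<Longrightarrow> g x = h x \<inter> P" "\<And>x. x \<in> P \<Longrightarrow> x \<in> h x" "\<And>x y. x \<in> P \<Longrightarrow> y \<in> h x \<Longrightarrow> h y = h x"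
  shows "card (g ` P) = card (h ` P)"
proof -
  have "inj_on (\<lambda>v. v \<inter> P) (h ` P)"
  proof (rule inj_onI)
    fix v w assume "v \<in> h ` P" "w \<in> h ` P" "v \<inter> P = w \<inter> P"
    then obtain x y where xy: "x \<in> P" "y \<in> P" "v = h x" "w = h y" "h x \<inter> P = h y \<inter> P" by blast
    then have "x \<in> h y" using assms(2) by blast
    then show "v = w" using assms(3) xy by metis
  qed
  moreover have "g ` P = (\<lambda>v. v \<inter> P) ` h ` P" using assms(1) by (auto simp: image_image)
  ultimately show ?thesis by (simp add: card_image)
qed

section \<open>The mobile is a map with one face\<close>

context eulerian
begin

lemma Mob_simps [simp]:
  "darts (Mob m) = D" "rot (Mob m) = mob_rot m" "opp (Mob m) = \<alpha>" "mroot (Mob m) = root m"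
  by (simp_all add: Mob_def shift_labels_def mob_unshifted_def)

definition r :: int where "r = root_label (mob_unshifted m)"

lemma flag_Mob: "flag (Mob m) x = lab (\<alpha> x) - r"
  by (simp add: Mob_def shift_labels_def mob_unshifted_def lab_def r_def)

lemma bij_mob_rot: "bij_betw (mob_rot m) D D"
proof -
  have W: "bij_betw (mob_rot m) W W"
  proof -
    have fin: "finite W" using finite_darts N_or_W finite_subset by blast
    have "inj_on f W" using permutes_inj[OF face_step_perm] inj_on_subset by blast
    then have "bij_betw f W W" using fin by (auto intro!: bij_betw_selfI)
    then show ?thesis using bij_betw_cong[of W "mob_rot m" f W] mob_rot_W by auto
  qed
  have "bij_betw (mob_rot m) (N \<union> W) (N \<union> W)"
    by (rule bij_betw_combine[OF bij_sigma W]) (use N_not_W in auto)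
  moreover have "N \<union> W = D" using N_or_W by auto
  ultimately show ?thesis by simp
qed

lemma mob_rot_perm: "mob_rot m permutes D"
  using bij_mob_rot by (rule bij_imp_permutes) (simp add: mob_rot_def)

sublocale T: rotation_system "Mob m"
proof
  show "\<And>x. x \<in> darts (Mob m) \<Longrightarrow> opp (Mob m) x \<noteq> x \<and> opp (Mob m) (opp (Mob m) x) = x"
    using opp_invol by simp
qed (use finite_darts mob_rot_perm opp_perm in simp_all)

lemma mob_rot_cases:
  "x \<in> W \<Longrightarrow> mob_rot m x \<in> W" "x \<in> L \<Longrightarrow> mob_rot m x \<in> L" "x \<in> N - L \<Longrightarrow> mob_rot m x \<in> N - L"
  using mob_rot_W sigma_L L_N in_N(2) by auto

sublocale T: bipartite "Mob m" N
proof
  show "N \<subseteq> darts (Mob m)" "darts (Mob m) \<noteq> {}" using N_or_W D_nonempty by auto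
  show "\<And>x. x \<in> darts (Mob m) \<Longrightarrow> (opp (Mob m) x \<in> N) = (x \<notin> N)" using N_or_W by auto
  show "\<And>x. x \<in> darts (Mob m) \<Longrightarrow> (rot (Mob m) x \<in> N) = (x \<in> N)"
    using mob_rot_cases(1) N_or_W N_not_W in_N(2) by (metis Mob_simps(1,2))
qed

lemma turn_theta: "x \<in> N \<Longrightarrow> T.turn x = \<theta> x"
  by (simp add: T.turn_def \<theta>_def mob_rot_W)

lemma Mob_transitive:
  assumes "x \<in> N" "y \<in> N"
  shows "\<exists>i. ((T.turn \<circ> rot (Mob m)) ^^ i) x = y"
proof -
  obtain i where "(\<kappa> ^^ i) x = y" using kappa_trans assms by blast
  moreover have "(\<kappa> ^^ i) x = ((T.turn \<circ> rot (Mob m)) ^^ i) x \<and> (\<kappa> ^^ i) x \<in> N" for i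
    by (rule funpow_cong_on) (use assms turn_theta in_N in \<open>auto simp: \<kappa>_def\<close>)
  ultimately show ?thesis by auto
qed

lemma Mob_one_face: "card (faces (Mob m)) = 1"
  by (rule T.one_face) (rule Mob_transitive)

lemma Mob_connected: "connected_map (Mob m)"
  by (rule T.connected) (rule Mob_transitive)

lemma is_map_Mob: "is_map (Mob m)"
  unfolding is_map_def using finite_darts D_nonempty mob_rot_perm opp_perm opp_invol Mob_connected by simp

section \<open>Vertices of the mobile\<close>

lemma vertex_Mob_funpow: "y \<in> vertex (Mob m) x \<longleftrightarrow> (\<exists>i. (mob_rot m ^^ i) x = y)"
  using T.vertex_funpow by simp

lemma vertex_Mob_W: assumes "x \<in> W" shows "vertex (Mob m) x = face m x"
proof -
  have "(mob_rot m ^^ i) x = (f ^^ i) x \<and> (mob_rot m ^^ i) x \<in> W" for i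
    by (rule funpow_cong_on) (use assms mob_rot_W in auto)
  then show ?thesis using vertex_Mob_funpow face_funpow by auto
qed

lemma vertex_Mob_B: assumes "x \<in> N - L" shows "vertex (Mob m) x = face m x \<inter> (N - L)"
proof
  show "vertex (Mob m) x \<subseteq> face m x \<inter> (N - L)"
  proof
    fix y assume "y \<in> vertex (Mob m) x"
    then obtain i where i: "(mob_rot m ^^ i) x = y" using vertex_Mob_funpow by auto
    have "(mob_rot m ^^ i) x \<in> face m x \<inter> (N - L)"
    proof (induction i)
      case (Suc i)
      define z where "z = (mob_rot m ^^ i) x"
      have z: "z \<in> face m x" "z \<in> N - L" using Suc z_def by auto
      obtain j where j: "walk f (\<lambda>z. z \<notin> L) z j" "f j = mob_rot m z" using return_phi[OF z(2)] by blast
      have "j \<in> face m z" using walk_funpow[OF j(1)] face_funpow by auto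
      then have "face m (mob_rot m z) = face m x" using j(2) z(1) face_eq face_face_step by metis
      then show ?case using mob_rot_cases(3)[OF z(2)] z_def self_in_face[of "mob_rot m z"] by auto
    qed (use assms in auto)
    then show "y \<in> face m x \<inter> (N - L)" using i by auto
  qed
  show "face m x \<inter> (N - L) \<subseteq> vertex (Mob m) x"
  proof
    fix y assume y: "y \<in> face m x \<inter> (N - L)"
    then obtain i where i: "(f ^^ i) x = y" using face_funpow by auto
    have "\<exists>j. (mob_rot m ^^ j) x = (f ^^ i) x"
    proof (rule return_orbit[where P = "N - L"])
      fix k assume k: "k \<in> N - L"
      then obtain j where j: "walk f (\<lambda>z. z \<notin> L) k j" "f j = mob_rot m k" using return_phi by blast
      have "walk f (\<lambda>z. z \<in> N - L) k j" using j(1) by (rule walk_mono) auto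
      then show "\<exists>j. walk f (\<lambda>z. z \<in> N - L) k j \<and> f j = mob_rot m k \<and> mob_rot m k \<in> N - L"
        using j mob_rot_cases(3)[OF k] by auto
    qed (use assms y i in auto)
    then show "y \<in> vertex (Mob m) x" using i vertex_Mob_funpow by auto
  qed
qed

lemma vertex_rot_rot: "(((rot m \<circ> rot m) ^^ i) x) \<in> vertex m x"
proof (induction i)
  case (Suc i)
  have "((rot m \<circ> rot m) ^^ Suc i) x = rot m (rot m (((rot m \<circ> rot m) ^^ i) x))" by simp
  then show ?case using vertex_eq[OF Suc] vertex_rot self_in_vertex by metis
qed auto

lemma vertex_Mob_L: assumes "x \<in> L" shows "vertex (Mob m) x = vertex m x \<inter> L"
proof
  show "vertex (Mob m) x \<subseteq> vertex m x \<inter> L"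
  proof
    fix y assume "y \<in> vertex (Mob m) x"
    then obtain i where i: "(mob_rot m ^^ i) x = y" using vertex_Mob_funpow by auto
    have "(mob_rot m ^^ i) x \<in> vertex m x \<inter> L"
    proof (induction i)
      case (Suc i)
      define z where "z = (mob_rot m ^^ i) x"
      have z: "z \<in> vertex m x" "z \<in> L" using Suc z_def by auto
      obtain j where j: "walk (rot m \<circ> rot m) (\<lambda>z. z \<in> L) z j" "(rot m \<circ> rot m) j = mob_rot m z"
        using return_chi[OF z(2)] by blast
      have "j \<in> vertex m z" using walk_funpow[OF j(1)] vertex_rot_rot by auto
      then have "vertex m (mob_rot m z) = vertex m x" using j(2) z(1) vertex_eq vertex_rot by (metis comp_apply)
      then show ?case using mob_rot_cases(2)[OF z(2)] z_def self_in_vertex[of "mob_rot m z"] by auto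
    qed (use assms in auto)
    then show "y \<in> vertex m x \<inter> L" using i by auto
  qed
  show "vertex m x \<inter> L \<subseteq> vertex (Mob m) x"
  proof
    fix y assume y: "y \<in> vertex m x \<inter> L"
    then obtain i where i: "(rot m ^^ i) x = y" using vertex_funpow by auto
    \<comment> \<open>\<open>return_chi\<close> is about double rotations, so the orbit is first cut
      down to \<open>N\<close> by parity and only then to the visits of \<open>L\<close>.\<close>
    have "\<exists>j. ((rot m \<circ> rot m) ^^ j) x = (rot m ^^ i) x"
      by (rule even_funpow[of D _ N]) (use assms y i N_or_W L_N in auto)
    then obtain i' where i': "((rot m \<circ> rot m) ^^ i') x = y" using i by auto
    have "\<exists>j. (mob_rot m ^^ j) x = ((rot m \<circ> rot m) ^^ i') x"
      by (rule return_orbit[where P = L]) (use return_chi assms y i' in auto)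
    then show "y \<in> vertex (Mob m) x" using i' vertex_Mob_funpow by auto
  qed
qed

lemma mob_kind_vertex:
  assumes "x \<in> D" "y \<in> vertex (Mob m) x"
  shows "mob_kind m y = mob_kind m x"
proof -
  consider "x \<in> W" | "x \<in> L" | "x \<in> N - L" using assms N_or_W L_N by blast
  then show ?thesis
  proof cases
    case 1
    then have "y \<in> face m x" using vertex_Mob_W assms by auto
    moreover have "y \<in> W" using calculation W_iff 1 face_eq assms face_in by (metis subsetD)
    ultimately show ?thesis using 1 N_or_W by (auto simp: mob_kind)
  next
    case 2
    then have y: "y \<in> vertex m x" "y \<in> L" using vertex_Mob_L assms by auto
    then have "lab y = lab x" using vertex_eq by (auto simp: lab_def)
    moreover have "y \<in> N" "x \<in> N" using y 2 L_N by auto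
    ultimately show ?thesis using y 2 N_or_W N_not_W by (simp add: mob_kind)
  next
    case 3
    then have y: "y \<in> N - L" using vertex_Mob_B assms by auto
    then show ?thesis using 3 N_or_W N_not_W by (auto simp: mob_kind)
  qed
qed

lemma kind_unshifted: assumes "x \<in> D" shows "kind (mob_unshifted m) (vertex (mob_unshifted m) x) = mob_kind m x"
proof -
  have "vertex (mob_unshifted m) x = vertex (Mob m) x"
    by (simp add: vertex_def) (simp add: mob_unshifted_def)
  moreover have "mob_kind m ` vertex (Mob m) x = {mob_kind m x}"
    using mob_kind_vertex[OF assms] T.self_in_vertex by blast
  ultimately show ?thesis by (simp add: mob_unshifted_def)
qed

lemma kind_Mob: assumes "x \<in> D"
  shows "kind (Mob m) (vertex (Mob m) x) =
    (if x \<in> W then Unlabelled White else if x \<in> L then Labelled (lab x - r) else Unlabelled Black)"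
proof -
  have "vertex (mob_unshifted m) x = vertex (Mob m) x"
    by (simp add: vertex_def) (simp add: mob_unshifted_def)
  then have "kind (Mob m) (vertex (Mob m) x) = shift_kind (- r) (mob_kind m x)"
    using kind_unshifted[OF assms] by (simp add: Mob_def shift_labels_def r_def)
  then show ?thesis using mob_kind[OF assms] by auto
qed

section \<open>Label conditions of the mobile\<close>

lemma first_label_Mob: assumes "x \<in> W" shows "first_label (Mob m) x = lab (\<alpha> x) - r"
  using assms N_or_W N_not_W by (auto simp: first_label_def kind_Mob flag_Mob)

lemma root_W: "root m \<in> W"
  using rp by (auto simp: rp_eulerian_map_def W_def)

text \<open>Labelled vertex or left flag, the root label is in both cases the label at the endpoint
  of the root edge.\<close>

lemma r_eq: "r = lab (\<alpha> (root m))"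
proof -
  have "opp (mob_unshifted m) = \<alpha>" "mroot (mob_unshifted m) = root m"
    "flag (mob_unshifted m) (root m) = lab (\<alpha> (root m))"
    by (auto simp: mob_unshifted_def lab_def)
  then show ?thesis using root_W N_or_W N_not_W kind_unshifted[of "\<alpha> (root m)"]
    by (auto simp: r_def root_label_def first_label_def mob_kind)
qed

lemma root_label_Mob: "root_label (Mob m) = 0"
  using first_label_Mob[OF root_W] r_eq by (simp add: root_label_def)

lemma mobile_edges_ok_Mob: "mobile_edges_ok (Mob m)"
  unfolding mobile_edges_ok_def
proof
  fix x assume "x \<in> darts (Mob m)"
  then have x: "x \<in> D" by simp
  have *: "kind (Mob m) (vertex (Mob m) y) = Unlabelled White \<and>
        ((\<exists>l. kind (Mob m) (vertex (Mob m) (\<alpha> y)) = Labelled l) \<or>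
         kind (Mob m) (vertex (Mob m) (\<alpha> y)) = Unlabelled Black)" if "y \<in> W" for y
    using that N_or_W N_not_W by (auto simp: kind_Mob)
  show "\<exists>y\<in>{x, opp (Mob m) x}. kind (Mob m) (vertex (Mob m) y) = Unlabelled White \<and>
        ((\<exists>l. kind (Mob m) (vertex (Mob m) (opp (Mob m) y)) = Labelled l) \<or>
         kind (Mob m) (vertex (Mob m) (opp (Mob m) y)) = Unlabelled Black)"
    using *[of x] *[of "\<alpha> x"] x N_or_W by (cases "x \<in> W") auto
qed

text \<open>The clockwise neighbour \<open>w\<close> precedes \<open>x\<close> along the white face,
  so its first label belongs to their common vertex, the origin of \<open>x\<close>.\<close>

lemma mobile_white_ok_Mob: "mobile_white_ok (Mob m)"
  unfolding mobile_white_ok_def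
proof (intro ballI impI)
  fix x assume "x \<in> darts (Mob m)" and k: "kind (Mob m) (vertex (Mob m) x) = Unlabelled White"
  then have x: "x \<in> W" using N_or_W by (auto simp: kind_Mob split: if_splits)
  define w where "w = next_cw (Mob m) x"
  have "mob_rot m w = x" using T.inv_rot(2)[of x] w_def by simp
  moreover have "w \<in> W"
    using T.rot_N[of w] calculation x N_or_W T.inv_rot_in[of x] w_def N_not_W by (metis Mob_simps(1,2))
  ultimately have "f w = x" using mob_rot_W by simp
  then have fl: "first_label (Mob m) w = lab x - r" using first_label_Mob[OF \<open>w \<in> W\<close>] lab_simps(2)[of w] by simp
  have N: "\<alpha> x \<in> N" "\<alpha> x \<notin> W" "\<alpha> x \<in> D" using x N_not_W N_or_W by auto
  show "case kind (Mob m) (vertex (Mob m) (opp (Mob m) x)) of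
           Labelled l \<Rightarrow> first_label (Mob m) (next_cw (Mob m) x) = l - 1
         | Unlabelled c \<Rightarrow>
             flag (Mob m) x \<le> flag (Mob m) (opp (Mob m) x) \<and>
             first_label (Mob m) (next_cw (Mob m) x) = flag (Mob m) (opp (Mob m) x)"
  proof (cases "\<alpha> x \<in> L")
    case True
    then have "lab (\<alpha> x) = lab x + 1" by (simp add: L_def s_def)
    then show ?thesis using True N fl w_def by (simp add: kind_Mob)
  next
    case False
    then have "lab (\<alpha> x) \<le> lab x" using down[of "\<alpha> x"] N by (simp add: s_theta) (simp add: s_def)
    then show ?thesis using False N fl w_def by (simp add: kind_Mob flag_Mob)
  qed
qed

text \<open>The first inequality compares the two ends of a non-increasing edge, the second is the
  weak drop of the contour at \<open>w\<close>.\<close>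

lemma mobile_black_ok_Mob: "mobile_black_ok (Mob m)"
  unfolding mobile_black_ok_def
proof (intro ballI impI)
  fix x assume "x \<in> darts (Mob m)" and k: "kind (Mob m) (vertex (Mob m) x) = Unlabelled Black"
  then have x: "x \<in> N - L" using N_or_W by (auto simp: kind_Mob split: if_splits)
  define w where "w = next_cw (Mob m) x"
  have w: "mob_rot m w = x" using T.inv_rot(2)[of x] w_def by simp
  have "w \<in> D" using w_def T.inv_rot_in[of x] x N_or_W by simp
  then have "w \<in> N" using w T.rot_N[of w] x by auto
  then have wB: "w \<in> N - L" using w x sigma_L[of w] by auto
  have "lab x \<le> s x" using down[OF x] by (simp add: s_theta)
  moreover have "lab x \<le> s w" using drop[OF wB] w by (simp add: s_theta)
  ultimately show "flag (Mob m) (opp (Mob m) x) \<le> flag (Mob m) x \<and>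
      flag (Mob m) (opp (Mob m) x) \<le> flag (Mob m) (next_cw (Mob m) x)"
    unfolding w_def[symmetric] by (simp add: flag_Mob s_def)
qed

section \<open>Counting cells; the genus\<close>

lemma white_vertices: "{v \<in> vertices (Mob m). kind (Mob m) v = Unlabelled White} = face m ` W"
proof -
  have "{v \<in> vertices (Mob m). kind (Mob m) v = Unlabelled White} = vertex (Mob m) ` W"
    unfolding vertices_def using N_or_W by (auto simp: kind_Mob split: if_splits)
  then show ?thesis using vertex_Mob_W by auto
qed

lemma black_vertices: "{v \<in> vertices (Mob m). kind (Mob m) v = Unlabelled Black} = vertex (Mob m) ` (N - L)"
proof -
  have "kind (Mob m) (vertex (Mob m) x) = Unlabelled Black \<longleftrightarrow> x \<in> N - L" if "x \<in> D" for x
    using kind_Mob[OF that] N_or_W(1)[OF that] by auto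
  then show ?thesis unfolding vertices_def using N_or_W by auto
qed

lemma labelled_vertices: "{v \<in> vertices (Mob m). \<exists>l. kind (Mob m) v = Labelled l} = vertex (Mob m) ` L"
  unfolding vertices_def using N_or_W N_not_W L_N by (auto simp: kind_Mob split: if_splits)

lemma white_faces: "{F \<in> faces m. fcol m F = White} = face m ` W"
  unfolding faces_def using W_iff N_or_W by auto

text \<open>\<open>walk_back\<close> finds a non-increasing edge on every black face, so none is
  lost.\<close>

lemma black_faces: "{F \<in> faces m. fcol m F = Black} = face m ` (N - L)"
proof -
  have "fcol m (face m x) = Black \<longleftrightarrow> x \<in> N" if "x \<in> D" for x
    using W_iff[OF that] N_or_W(1)[OF that] by (cases "fcol m (face m x)") auto
  then have "{F \<in> faces m. fcol m F = Black} = face m ` N"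
    unfolding faces_def using N_or_W by auto
  also have "\<dots> = face m ` (N - L)"
  proof
    show "face m ` N \<subseteq> face m ` (N - L)"
    proof
      fix F assume "F \<in> face m ` N"
      then obtain n where n: "n \<in> N" "F = face m n" by auto
      obtain k where k: "k \<in> N - L" "walk f (\<lambda>z. z \<notin> L) k n" using walk_back[OF n(1)] by blast
      have "n \<in> face m k" using walk_funpow[OF k(2)] face_funpow by auto
      then show "F \<in> face m ` (N - L)" using n k face_eq by blast
    qed
  qed auto
  finally show ?thesis .
qed

lemma other_vertices: "vertices m - {point m} = vertex m ` L"
proof
  show "vertices m - {point m} \<subseteq> vertex m ` L"
  proof
    fix v assume "v \<in> vertices m - {point m}"
    then obtain y where y: "y \<in> D" "v = vertex m y" "v \<noteq> point m" unfolding vertices_def by auto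
    then obtain n where "n \<in> L" "n \<in> vertex m y" using L_in_vertex by metis
    then show "v \<in> vertex m ` L" using y vertex_eq by blast
  qed
  show "vertex m ` L \<subseteq> vertices m - {point m}"
    using L_not_point L_N N_or_W unfolding vertices_def by blast
qed

lemma card_black: "card {v \<in> vertices (Mob m). kind (Mob m) v = Unlabelled Black} = card {F \<in> faces m. fcol m F = Black}"
  unfolding black_vertices black_faces
  by (rule card_trace) (use vertex_Mob_B face_eq in auto)

lemma card_labelled: "card {v \<in> vertices (Mob m). \<exists>l. kind (Mob m) v = Labelled l} + 1 = card (vertices m)"
proof -
  have "card (vertex (Mob m) ` L) = card (vertex m ` L)"
    by (rule card_trace) (use vertex_Mob_L vertex_eq in auto)
  then have "card {v \<in> vertices (Mob m). \<exists>l. kind (Mob m) v = Labelled l} = card (vertices m - {point m})"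
    using labelled_vertices other_vertices by simp
  moreover have "point m \<in> vertices m" using rp by (simp add: rp_eulerian_map_def)
  moreover have "finite (vertices m)" unfolding vertices_def using finite_darts by simp
  ultimately show ?thesis by (metis card.remove Suc_eq_plus1)
qed

lemma card_vertices_Mob: "card (vertices (Mob m)) + 1 = card (vertices m) + card (faces m)"
proof -
  let ?w = "{v \<in> vertices (Mob m). kind (Mob m) v = Unlabelled White}"
  let ?b = "{v \<in> vertices (Mob m). kind (Mob m) v = Unlabelled Black}"
  let ?l = "{v \<in> vertices (Mob m). \<exists>l. kind (Mob m) v = Labelled l}"
  have fin: "finite (vertices (Mob m))" "finite (faces m)"
    unfolding vertices_def faces_def using finite_darts by simp_all
  have "k = Unlabelled White \<or> k = Unlabelled Black \<or> (\<exists>l. k = Labelled l)" for k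
    by (cases k; metis colour.exhaust)
  then have "vertices (Mob m) = (?w \<union> ?b) \<union> ?l" by blast
  then have "card (vertices (Mob m)) = card ((?w \<union> ?b) \<union> ?l)" by simp
  also have "\<dots> = card (?w \<union> ?b) + card ?l" by (rule card_Un_disjoint) (use fin in auto)
  also have "card (?w \<union> ?b) = card ?w + card ?b" by (rule card_Un_disjoint) (use fin in auto)
  finally have v: "card (vertices (Mob m)) = card ?w + card ?b + card ?l" .
  have "faces m = {F \<in> faces m. fcol m F = White} \<union> {F \<in> faces m. fcol m F = Black}"
    by (auto intro: colour.exhaust)
  then have "card (faces m) = card ({F \<in> faces m. fcol m F = White} \<union> {F \<in> faces m. fcol m F = Black})" by simp
  also have "\<dots> = card {F \<in> faces m. fcol m F = White} + card {F \<in> faces m. fcol m F = Black}"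
    by (rule card_Un_disjoint) (use fin in auto)
  finally have "card (faces m) = card ?w + card ?b" using card_black white_vertices white_faces by simp
  then show ?thesis using v card_labelled by simp
qed

lemma edges_Mob: "edges (Mob m) = edges m"
  by (simp add: edges_def)

text \<open>The vertex erased from the map and the single face of the mobile compensate in the Euler
  characteristic.\<close>

lemma has_genus_Mob: "has_genus (Mob m) g \<longleftrightarrow> has_genus m g"
  unfolding has_genus_def edges_Mob Mob_one_face using card_vertices_Mob by auto

lemma gmobile_Mob: "has_genus m g \<Longrightarrow> gmobile g (Mob m)"
  unfolding gmobile_def gtree_def
  using is_map_Mob has_genus_Mob Mob_one_face mobile_edges_ok_Mob mobile_white_ok_Mob mobile_black_ok_Mob
    root_W N_or_W root_label_Mob kind_Mob[of "root m"] by simp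

end

section \<open>The Eulerian map of a mobile\<close>

locale mobile_tree =
  fixes g :: nat and t :: "'d mobile"
  assumes gm: "gmobile g t"
begin

abbreviation "D \<equiv> darts t"
abbreviation "\<alpha> \<equiv> opp t"

definition knd :: "'d \<Rightarrow> vkind" where "knd x = kind t (vertex t x)"
definition N :: "'d set" where "N = {x\<in>D. knd x \<noteq> Unlabelled White}"
definition W :: "'d set" where "W = {x\<in>D. knd x = Unlabelled White}"
definition L :: "'d set" where "L = {x\<in>D. \<exists>l. knd x = Labelled l}"
text \<open>The label at the origin of the edge to be reconstructed. A labelled vertex is the
  endpoint of an increasing edge, whence \<open>l - 1\<close>; otherwise the flag on the left of a
  dart of \<open>N\<close> belongs to that origin.\<close>

definition s :: "'d \<Rightarrow> int" where "s x = (case knd x of Labelled l \<Rightarrow> l - 1 | Unlabelled c \<Rightarrow> flag t x)"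

lemma map_t: "is_map t" "has_genus t g" "card (faces t) = 1"
  using gm by (auto simp: gmobile_def gtree_def)

sublocale rotation_system t
  using map_t is_map_rotation_system by blast

lemma N_or_W: "x \<in> D \<Longrightarrow> x \<notin> N \<longleftrightarrow> x \<in> W" "N \<subseteq> D" "W \<subseteq> D" "x \<in> N \<Longrightarrow> x \<in> D" "x \<in> W \<Longrightarrow> x \<in> D" "x \<in> N \<Longrightarrow> x \<notin> W"
  by (auto simp: N_def W_def)

lemma L_N: "L \<subseteq> N" by (auto simp: L_def N_def)

lemma edge:
  assumes "x \<in> D"
  shows "x \<in> W \<and> \<alpha> x \<in> N \<and> (\<alpha> x \<in> L \<or> knd (\<alpha> x) = Unlabelled Black) \<or>
    \<alpha> x \<in> W \<and> x \<in> N \<and> (x \<in> L \<or> knd x = Unlabelled Black)"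
proof -
  have "mobile_edges_ok t" using gm by (simp add: gmobile_def)
  then have "\<exists>y\<in>{x, opp t x}. knd y = Unlabelled White \<and>
        ((\<exists>l. knd (\<alpha> y) = Labelled l) \<or> knd (\<alpha> y) = Unlabelled Black)"
    using assms unfolding mobile_edges_ok_def knd_def by blast
  then show ?thesis using assms by (auto simp: N_def W_def L_def)
qed

lemma opp_W [simp]: "\<alpha> x \<in> W \<longleftrightarrow> x \<in> N"
  using edge[of x] N_or_W(1,4-6)[of x] N_or_W(1,4-6)[of "\<alpha> x"] by auto

lemma opp_N [simp]: "\<alpha> x \<in> N \<longleftrightarrow> x \<in> W"
  using opp_W[of "\<alpha> x"] by simp

lemma knd_black: "x \<in> N - L \<Longrightarrow> knd x = Unlabelled Black"
  using edge[of x] N_or_W(4,6)[of x] by auto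

lemma knd_rot [simp]: "knd (rot t x) = knd x" "knd (inv (rot t) x) = knd x"
  by (auto simp: knd_def)

lemma rot_sets [simp]: "rot t x \<in> N \<longleftrightarrow> x \<in> N" "rot t x \<in> L \<longleftrightarrow> x \<in> L" "rot t x \<in> W \<longleftrightarrow> x \<in> W"
  "inv (rot t) x \<in> N \<longleftrightarrow> x \<in> N" "inv (rot t) x \<in> W \<longleftrightarrow> x \<in> W"
  by (auto simp: N_def L_def W_def)

sublocale bipartite t N
  by standard (use N_or_W map_t in \<open>auto simp: is_map_def\<close>)

lemma first_label: "first_label t (\<alpha> x) = (case knd x of Labelled l \<Rightarrow> l | Unlabelled c \<Rightarrow> flag t (\<alpha> x))"
  by (simp add: first_label_def knd_def)

lemma white:
  assumes "x \<in> W"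
  shows "case knd (\<alpha> x) of Labelled l \<Rightarrow> first_label t (inv (rot t) x) = l - 1
         | Unlabelled c \<Rightarrow> flag t x \<le> flag t (\<alpha> x) \<and> first_label t (inv (rot t) x) = flag t (\<alpha> x)"
proof -
  have "mobile_white_ok t" using gm by (simp add: gmobile_def)
  then show ?thesis using assms N_or_W(5)[OF assms] unfolding mobile_white_ok_def W_def knd_def by blast
qed

lemma black:
  assumes "x \<in> N - L"
  shows "flag t (\<alpha> x) \<le> flag t x" "flag t (\<alpha> x) \<le> flag t (inv (rot t) x)"
proof -
  have "mobile_black_ok t" using gm by (simp add: gmobile_def)
  moreover have "x \<in> D" using assms N_or_W by auto
  ultimately show "flag t (\<alpha> x) \<le> flag t x" "flag t (\<alpha> x) \<le> flag t (inv (rot t) x)"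
    using knd_black[OF assms] unfolding mobile_black_ok_def knd_def by auto
qed

text \<open>Both cases of the white condition say the same: the endpoint of an edge and the origin
  of the next one around the white face carry one label.\<close>

lemma s_turn: assumes "x \<in> N" shows "s (turn x) = first_label t (\<alpha> x)"
proof -
  have "\<alpha> (turn x) = rot t (\<alpha> x)" by (simp add: turn_def)
  then have "inv (rot t) (\<alpha> (turn x)) = \<alpha> x" "\<alpha> (turn x) \<in> W" using assms by simp_all
  then show ?thesis using white[of "\<alpha> (turn x)"] by (auto simp: s_def split: vkind.splits)
qed

lemma s_turn_L: "x \<in> L \<Longrightarrow> s (turn x) = s x + 1"
  using s_turn[of x] first_label[of x] L_N by (auto simp: L_def s_def)

lemma s_turn_B: "x \<in> N - L \<Longrightarrow> s (turn x) = flag t (\<alpha> x)" "x \<in> N - L \<Longrightarrow> s x = flag t x"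
  using s_turn[of x] first_label[of x] knd_black[of x] by (auto simp: s_def)

lemma bij_rot: "bij_betw (rot t) N N" "bij_betw (rot t) W W"
proof -
  have fin: "finite N" "finite W" using finite_darts N_or_W finite_subset by blast+
  have "inj_on (rot t) A" for A using permutes_inj[OF rot_perm] inj_on_subset by blast
  then show "bij_betw (rot t) N N" "bij_betw (rot t) W W"
    using fin by (auto intro!: bij_betw_selfI)
qed

sublocale leveled N turn "rot t" s L
proof
  show fin: "finite N" using finite_darts N_or_W finite_subset by blast
  have "inj_on turn N"
    unfolding turn_def by (intro inj_onI) (metis injD permutes_inj[OF rot_perm] opp_opp)
  then show "bij_betw turn N N" using fin by (auto intro!: bij_betw_selfI simp: turn_def)
  show "\<And>l. l \<in> L \<Longrightarrow> s (turn (rot t l)) = s (turn l)"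
    using s_turn_L by (auto simp: s_def L_def)
  show "\<And>k. k \<in> N - L \<Longrightarrow> s (turn k) \<le> s k"
    using s_turn_B black by simp
  show "s (turn (rot t k)) \<le> s k" if "k \<in> N - L" for k
    using s_turn_B(1)[of "rot t k"] s_turn_B(2)[of k] black(2)[of "rot t k"] that by simp
qed (use bij_rot L_N s_turn_L in auto)

sublocale leveled_tree N turn "rot t" s L
  by standard (use turn_rot_transitive map_t(3) in \<open>auto simp: \<kappa>_def\<close>)

section \<open>Reconstruction of the Eulerian map\<close>

definition next_face :: "'d \<Rightarrow> 'd" where
  "next_face x = (if x \<in> N then \<phi> x else if x \<in> D then rot t x else x)"

lemma next_face_sets [simp]: "next_face x \<in> N \<longleftrightarrow> x \<in> N" "next_face x \<in> W \<longleftrightarrow> x \<in> W"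
  using phi_in[of x] N_or_W(1,4-6)[of x] N_or_W(6)[of "\<phi> x"] by (auto simp: next_face_def)

lemma next_face_W: "x \<in> W \<Longrightarrow> next_face x = rot t x"
  using N_or_W by (auto simp: next_face_def)

lemma next_face_N: "x \<in> N \<Longrightarrow> next_face x = \<phi> x"
  by (auto simp: next_face_def)

lemma next_face_perm: "next_face permutes D"
proof (rule bij_imp_permutes)
  have "bij_betw next_face N N" using bij_phi bij_betw_cong[of N next_face \<phi> N] next_face_N by auto
  moreover have "bij_betw next_face W W" using bij_rot(2) bij_betw_cong[of W next_face "rot t" W] next_face_W by auto
  ultimately have "bij_betw next_face (N \<union> W) (N \<union> W)"
    by (rule bij_betw_combine) (use N_or_W in auto)
  moreover have "N \<union> W = D" using N_or_W by auto
  ultimately show "bij_betw next_face D D" by simp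
qed (use N_or_W in \<open>auto simp: next_face_def\<close>)

lemma inv_next_face [simp]: "inv next_face (next_face x) = x" "next_face (inv next_face x) = x"
  using permutes_inverses[OF next_face_perm] by auto

lemma inv_next_face_sets [simp]: "inv next_face x \<in> N \<longleftrightarrow> x \<in> N" "inv next_face x \<in> W \<longleftrightarrow> x \<in> W"
  using next_face_sets[of "inv next_face x"] by auto

text \<open>The faces are prescribed here and the vertices follow: this is the equation defining
  \<open>face_step\<close>, solved for the rotation.\<close>

definition \<rho> :: "'d \<Rightarrow> 'd" where "\<rho> x = \<alpha> (inv next_face x)"

lemma rho_perm: "\<rho> permutes D"
proof -
  have "\<rho> = \<alpha> \<circ> inv next_face" by (auto simp: \<rho>_def)
  then show ?thesis using permutes_compose[OF permutes_inv[OF next_face_perm] opp_perm] by simp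
qed

definition basept :: 'd where "basept = (SOME x. x \<in> N \<and> (\<forall>i. (\<psi> ^^ i) x \<notin> L))"

lemma basept: "basept \<in> N" "\<And>i. (\<psi> ^^ i) basept \<notin> L"
proof -
  obtain x where "x \<in> N" using N_nonempty .
  then have "\<exists>x. x \<in> N \<and> (\<forall>i. (\<psi> ^^ i) x \<notin> L)" using pointed_exists by blast
  then have "basept \<in> N \<and> (\<forall>i. (\<psi> ^^ i) basept \<notin> L)" unfolding basept_def by (rule someI_ex)
  then show "basept \<in> N" "\<And>i. (\<psi> ^^ i) basept \<notin> L" by auto
qed

text \<open>Cycles of \<open>next_face\<close> stay inside \<open>N\<close> or inside
  \<open>W\<close>, which makes the test \<open>A \<subseteq> N\<close> a colouring of the
  faces.\<close>

definition E :: "'d emap" where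
  "E = \<lparr>darts = D, rot = \<rho>, opp = \<alpha>, fcol = (\<lambda>A. if A \<subseteq> N then Black else White),
    root = mroot t, point = orbit \<rho> basept\<rparr>"

lemma E_simps [simp]: "darts E = D" "rot E = \<rho>" "opp E = \<alpha>" "root E = mroot t" "point E = vertex E basept"
  by (simp_all add: E_def vertex_def)

lemma face_step_E [simp]: "face_step E = next_face"
proof
  fix x
  have "inv \<rho> (\<alpha> x) = next_face x" using permutes_inv_eq[OF rho_perm] by (simp add: \<rho>_def)
  then show "face_step E x = next_face x" by (simp add: face_step_def)
qed

sublocale E: rotation_system E
  by standard (use finite_darts rho_perm opp_perm opp_invol in simp_all)

lemma rho_sets [simp]: "\<rho> x \<in> W \<longleftrightarrow> x \<in> N" "\<rho> x \<in> N \<longleftrightarrow> x \<in> W"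
  by (auto simp: \<rho>_def)

text \<open>Turns \<open>return_chi\<close> into a statement about the vertices of
  \<open>E\<close>.\<close>

lemma rho_rho: assumes "x \<in> N" shows "\<chi> x = \<rho> (\<rho> x)"
proof -
  define w where "w = inv next_face (\<rho> x)"
  have "w \<in> W" using assms by (simp add: w_def)
  have "turn (\<rho> (\<rho> x)) = \<alpha> (rot t w)" by (simp add: turn_def \<rho>_def[of "\<rho> x"] w_def)
  also have "rot t w = \<rho> x" using next_face_W[OF \<open>w \<in> W\<close>] w_def by simp
  also have "\<alpha> (\<rho> x) = inv next_face x" by (simp add: \<rho>_def)
  finally have "\<psi> (\<rho> (\<rho> x)) = x" using next_face_N[of "inv next_face x"] assms psi by simp
  then show ?thesis using chi_psi[of "\<rho> (\<rho> x)"] assms by simp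
qed

text \<open>A set closed under the moves of \<open>E\<close> is closed under the rotation of the
  mobile, which is a face step on \<open>W\<close> and induced by \<open>\<phi>\<close> or by double
  rotations on \<open>N\<close>. Connectedness of the mobile then applies.\<close>

lemma connected_E: "connected_map E"
proof (rule E.connectedI)
  fix S x y
  assume x: "x \<in> S" and S: "S \<subseteq> darts E"
    and closed: "\<And>z. z \<in> S \<Longrightarrow> rot E z \<in> S \<and> opp E z \<in> S \<and> inv (rot E) z \<in> S" and y: "y \<in> darts E"
  have ff: "next_face z \<in> S" if "z \<in> S" for z
  proof -
    have "inv (rot E) (opp E z) \<in> S" using closed that by blast
    then show ?thesis using face_step_E unfolding face_step_def by metis
  qed
  have rot: "rot t z \<in> S" if z: "z \<in> S" for z
  proof -
    consider "z \<in> W" | "z \<in> N - L" | "z \<in> L" using z S N_or_W by auto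
    then show ?thesis
    proof cases
      case 1
      then show ?thesis using ff[OF z] next_face_W by simp
    next
      case 2
      then obtain j where j: "walk \<phi> (\<lambda>z. z \<notin> L) z j" "\<phi> j = rot t z" using return_phi by blast
      have im: "\<phi> ` (S \<inter> N) \<subseteq> S \<inter> N" using ff next_face_N phi_in by fastforce
      have "j \<in> S \<inter> N" using walk_in[OF j(1) im] z 2 by auto
      then show ?thesis using im j(2) by auto
    next
      case 3
      then obtain j where j: "walk \<chi> (\<lambda>z. z \<in> L) z j" "\<chi> j = rot t z" using return_chi by blast
      have im: "\<chi> ` (S \<inter> N) \<subseteq> S \<inter> N" using closed rho_rho chi_in by fastforce
      have "j \<in> S \<inter> N" using walk_in[OF j(1) im] z 3 L_N by auto
      then show ?thesis using im j(2) by auto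
    qed
  qed
  show "y \<in> S"
    by (rule connected_closure[of x]) (use map_t x S y rot closed in \<open>auto simp: is_map_def\<close>)
qed

lemma face_E_N: assumes "x \<in> D" shows "face E x \<subseteq> N \<longleftrightarrow> x \<in> N"
proof -
  have "(next_face ^^ i) x \<in> N \<longleftrightarrow> x \<in> N" for i by (induction i) auto
  then show ?thesis using E.face_funpow[of _ x] E.self_in_face[of x] by auto
qed

lemma fcol_E: "x \<in> D \<Longrightarrow> fcol E (face E x) = (if x \<in> N then Black else White)"
  using face_E_N by (simp add: E_def)

lemma root_t: "mroot t \<in> W" "first_label t (mroot t) = 0"
  using gm by (auto simp: gmobile_def W_def knd_def root_label_def)

lemma rp_eulerian_E: "rp_eulerian_map E"
  unfolding rp_eulerian_map_def eulerian_map_def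
proof (intro conjI ballI)
  show "is_map E"
    unfolding is_map_def using finite_darts nonempty rho_perm opp_perm opp_invol connected_E by simp
  show "\<And>x. x \<in> darts E \<Longrightarrow> fcol E (face E x) \<noteq> fcol E (face E (opp E x))"
    using fcol_E N_or_W by auto
  show "root E \<in> darts E" using root_t N_or_W by simp
  show "black_right E (root E)"
    using root_t N_or_W fcol_E[of "\<alpha> (mroot t)"] by (simp add: black_right_def)
  show "point E \<in> vertices E" using basept N_or_W by (auto simp: vertices_def)
qed

section \<open>Distances in the reconstructed map\<close>

sublocale X: eulerian E
  by standard (rule rp_eulerian_E)

lemma X_sets [simp]: "X.W = W" "X.N = N"
proof -
  have "black_right E x \<longleftrightarrow> x \<in> W" if "x \<in> D" for x
    using fcol_E[of "\<alpha> x"] that by (simp add: black_right_def)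
  then show "X.W = W" "X.N = N" unfolding X.W_def X.N_def using N_or_W by auto
qed

text \<open>The label of the vertex that a dart leaves, up to an additive constant.\<close>

definition height :: "'d \<Rightarrow> int" where "height x = (if x \<in> N then s (turn x) else s (\<alpha> x))"

lemma height_rho: assumes "x \<in> D" shows "height (\<rho> x) = height x"
proof -
  define y where "y = inv next_face x"
  have y: "x = next_face y" "\<rho> x = \<alpha> y" by (auto simp: y_def \<rho>_def)
  show ?thesis
  proof (cases "x \<in> N")
    case True
    then have "y \<in> N" by (simp add: y_def)
    then show ?thesis using y True s_phi[of y] N_or_W(6)[of y] by (auto simp: height_def next_face_N)
  next
    case False
    then have "y \<in> W" using assms N_or_W by (simp add: y_def)
    then have "s (turn (\<alpha> y)) = s (\<alpha> (rot t y))" by (simp add: turn_def)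
    then show ?thesis using y False \<open>y \<in> W\<close> by (simp add: height_def next_face_W)
  qed
qed

lemma height_vertex: assumes "x \<in> D" "y \<in> vertex E x" shows "height y = height x"
proof -
  obtain i where i: "(\<rho> ^^ i) x = y" using assms E.vertex_funpow by auto
  have "height ((\<rho> ^^ i) x) = height x \<and> (\<rho> ^^ i) x \<in> D" for i
    by (induction i) (use assms height_rho E.rot_in in auto)
  then show ?thesis using i by blast
qed

lemma height_arc: "x \<in> W \<Longrightarrow> height (\<alpha> x) \<le> height x + 1"
  using M.s_le[of "\<alpha> x"] N_or_W(6) by (auto simp: height_def)

text \<open>The lower bound for distances: an arc raises the height by at most one.\<close>

lemma height_path:
  "(point E, vertex E y) \<in> arcs E ^^ k \<Longrightarrow> y \<in> D \<Longrightarrow> height y \<le> height basept + int k"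
proof (induction k arbitrary: y)
  case 0
  then have "vertex E y = vertex E basept" by simp
  then have "y \<in> vertex E basept" using E.self_in_vertex by metis
  then show ?case using height_vertex[of basept y] basept N_or_W by auto
next
  case (Suc k)
  then obtain u where u: "(point E, u) \<in> arcs E ^^ k" "(u, vertex E y) \<in> arcs E" by auto
  then obtain x where x: "x \<in> X.W" "u = vertex E x" "vertex E y = vertex E (\<alpha> x)"
    unfolding arcs_def X.W_def by auto
  then have "x \<in> D" "x \<in> W" using N_or_W by auto
  have "y \<in> vertex E (\<alpha> x)" using x E.self_in_vertex by metis
  then have "height y = height (\<alpha> x)" using height_vertex[of "\<alpha> x" y] \<open>x \<in> D\<close> by simp
  moreover have "height x \<le> height basept + int k" using Suc.IH u x \<open>x \<in> D\<close> by auto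
  ultimately show ?case using height_arc[OF \<open>x \<in> W\<close>] by simp
qed

lemma psi_vertex: "x \<in> N \<Longrightarrow> (\<psi> ^^ i) x \<in> vertex E x"
proof (induction i)
  case (Suc i)
  define z where "z = (\<psi> ^^ i) x"
  have z: "z \<in> N" using psi_funpow Suc z_def by auto
  have "z = \<rho> (\<rho> (\<psi> z))" using rho_rho[of "\<psi> z"] chi_psi[OF z] psi_in z by auto
  then have "vertex E z = vertex E (\<psi> z)" using E.vertex_rot E_simps(2) by metis
  moreover have "vertex E z = vertex E x" using Suc z_def E.vertex_eq by auto
  ultimately show ?case using E.self_in_vertex[of "\<psi> z"] z_def by simp
qed auto

text \<open>The upper bound for distances: by \<open>pointed_unique\<close> every vertex other than
  the base vertex has an incoming edge in \<open>L\<close>. Going back along it lowers the height by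
  one, and finiteness ends the descent.\<close>

lemma height_attained:
  "y \<in> D \<Longrightarrow> \<exists>j. (point E, vertex E y) \<in> arcs E ^^ j \<and> height y = height basept + int j"
proof (induction "nat (height y - Min (height ` D))" arbitrary: y rule: less_induct)
  case less
  show ?case
  proof (cases "vertex E y = vertex E basept")
    case True
    then have "y \<in> vertex E basept" using E.self_in_vertex by metis
    then have "height y = height basept" using height_vertex[of basept y] basept N_or_W by auto
    then show ?thesis using True by (intro exI[of _ 0]) auto
  next
    case False
    \<comment> \<open>Incoming edges are named by darts of \<open>N\<close>; from a dart of
      \<open>W\<close> one rotation leads to such a dart.\<close>
    obtain y' where y': "y' \<in> N" "vertex E y' = vertex E y"
    proof (cases "y \<in> N")
      case False
      then have "\<rho> y \<in> N" using less.prems N_or_W by auto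
      then show ?thesis using that[of "\<rho> y"] E.vertex_rot[of y] by auto
    qed (use that in auto)
    have "\<exists>i. (\<psi> ^^ i) y' \<in> L"
    proof (rule ccontr)
      assume "\<not> (\<exists>i. (\<psi> ^^ i) y' \<in> L)"
      then obtain i where "(\<psi> ^^ i) basept = y'" using pointed_unique[of basept y'] basept y' by auto
      then have "y' \<in> vertex E basept" using psi_vertex basept by auto
      then show False using y' E.vertex_eq False by metis
    qed
    then obtain i where i: "(\<psi> ^^ i) y' \<in> L" by blast
    define n where "n = (\<psi> ^^ i) y'"
    have n: "n \<in> L" "n \<in> N" using i n_def L_N by auto
    have nv: "n \<in> vertex E y" using psi_vertex[OF y'(1)] n_def y' by auto
    have hn: "height n = height y" by (rule height_vertex[OF less.prems nv])
    have hx: "height (\<alpha> n) = height y - 1"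
      using hn s_turn_L[OF n(1)] n N_or_W(6)[of n] by (auto simp: height_def)
    have D: "\<alpha> n \<in> D" using n N_or_W by auto
    then have "Min (height ` D) \<le> height (\<alpha> n)" using finite_darts by auto
    then have "nat (height (\<alpha> n) - Min (height ` D)) < nat (height y - Min (height ` D))" using hx by auto
    then obtain j where j: "(point E, vertex E (\<alpha> n)) \<in> arcs E ^^ j" "height (\<alpha> n) = height basept + int j"
      using less.hyps D by blast
    have "(vertex E (\<alpha> n), vertex E n) \<in> arcs E" using X.arc[of "\<alpha> n"] n by simp
    moreover have "vertex E n = vertex E y" using nv E.vertex_eq by auto
    ultimately have "(point E, vertex E y) \<in> arcs E ^^ Suc j" using j by auto
    then show ?thesis using hx j by (intro exI[of _ "Suc j"]) auto
  qed
qed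

lemma X_lab: assumes "y \<in> D" shows "X.lab y = height y - height basept"
proof -
  obtain j where "(point E, vertex E y) \<in> arcs E ^^ j" "height y = height basept + int j"
    using height_attained[OF assms] by blast
  then have "X.lab y \<le> height y - height basept" using X.lab_le by fastforce
  moreover have "height y \<le> height basept + int (nat (X.lab y))"
    by (rule height_path[OF X.lab_path]) (use assms in auto)
  ultimately show ?thesis using X.lab_nonneg[of y] by simp
qed

lemma X_s: "x \<in> N \<Longrightarrow> X.s x = s x - height basept"
  using X_lab[of "\<alpha> x"] N_or_W(4,6)[of x] by (auto simp: X.s_def height_def)

lemma X_L: "X.L = L"
proof -
  have "X.lab x = X.s x + 1 \<longleftrightarrow> x \<in> L" if "x \<in> N" for x
    using X_s[OF that] X_lab[of x] that N_or_W M.L_eq by (auto simp: height_def)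
  then show ?thesis unfolding X.L_def using L_N by auto
qed

text \<open>Apart from the white vertices, both sides are first returns of the same permutation to
  the same set, so uniqueness of the stop identifies them.\<close>

lemma mob_rot_E: "mob_rot E = rot t"
proof
  fix x
  consider "x \<in> W" | "x \<in> N - L" | "x \<in> L" | "x \<notin> D" using N_or_W by auto
  then show "mob_rot E x = rot t x"
  proof cases
    case 1
    then show ?thesis using X.mob_rot_W[of x] next_face_W by simp
  next
    case 2
    obtain j where j: "walk next_face (\<lambda>z. z \<notin> L) x j" "next_face j = mob_rot E x" "mob_rot E x \<notin> L"
      using X.return_phi[of x] 2 X_L by auto
    obtain i where i: "walk \<phi> (\<lambda>z. z \<notin> L) x i" "\<phi> i = rot t x" using return_phi[OF 2] by blast
    have "i \<in> N" using walk_in[OF i(1), of N] phi_in 2 by auto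
    have "walk next_face (\<lambda>z. z \<notin> L) (id x) (id i)"
      using i(1) by (rule walk_hom[where N = N]) (use 2 phi_in next_face_N in auto)
    moreover have "next_face i = rot t x" using i next_face_N \<open>i \<in> N\<close> by simp
    ultimately show ?thesis using walk_stop_unique[OF j(1), of i] j 2 by auto
  next
    case 3
    obtain j where j: "walk (\<rho> \<circ> \<rho>) (\<lambda>z. z \<in> L) x j" "(\<rho> \<circ> \<rho>) j = mob_rot E x" "mob_rot E x \<in> L"
      using X.return_chi[of x] 3 X_L by auto
    obtain i where i: "walk \<chi> (\<lambda>z. z \<in> L) x i" "\<chi> i = rot t x" using return_chi[OF 3] by blast
    have xN: "x \<in> N" using 3 L_N by auto
    have "i \<in> N" using walk_in[OF i(1), of N] chi_in xN by auto
    have "walk (\<rho> \<circ> \<rho>) (\<lambda>z. z \<in> L) (id x) (id i)"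
      using i(1) by (rule walk_hom[where N = N]) (use xN chi_in rho_rho in auto)
    moreover have "(\<rho> \<circ> \<rho>) i = rot t x" using i rho_rho \<open>i \<in> N\<close> by simp
    ultimately show ?thesis using walk_stop_unique[OF j(1), of i] j 3 by auto
  next
    case 4
    then show ?thesis using rot_perm by (simp add: mob_rot_def permutes_not_in)
  qed
qed

lemma vertex_Mob_E: "vertex (Mob E) = vertex t"
  by (rule ext) (simp add: vertex_def mob_rot_E)

lemma vertices_Mob_E: "vertices (Mob E) = vertices t"
  by (simp add: vertices_def vertex_Mob_E)

text \<open>Root label zero means height zero at the endpoint of the root edge, which fixes the
  additive constant left open by \<open>height\<close>.\<close>

lemma X_r: "X.r = - height basept"
proof -
  have "s (turn (\<alpha> (mroot t))) = 0" using s_turn[of "\<alpha> (mroot t)"] root_t by simp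
  then show ?thesis using X.r_eq X_lab[of "\<alpha> (mroot t)"] root_t N_or_W by (simp add: height_def)
qed

lemma has_genus_E: "has_genus E g"
proof -
  have "faces (Mob E) = faces t"
  proof -
    have "face_step (Mob E) = face_step t" by (rule ext) (simp add: face_step_def mob_rot_E)
    then show ?thesis by (simp add: faces_def face_def)
  qed
  then have "has_genus (Mob E) g"
    using map_t(2) vertices_Mob_E unfolding has_genus_def by (simp add: edges_def)
  then show ?thesis using X.has_genus_Mob by simp
qed

lemma edges_E: "edges E = edges t"
  by (simp add: edges_def)

text \<open>The identity on darts is an isomorphism. Equality would be too much to ask:
  \<open>flag\<close> is arbitrary on edges at labelled vertices, and \<open>kind\<close> on sets
  that are not vertices.\<close>

lemma Mob_E: "(Mob E, t) \<in> mobile_rel"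
proof -
  have kinds: "kind t (id ` v) = kind (Mob E) v" if v: "v \<in> vertices (Mob E)" for v
  proof -
    obtain x where x: "x \<in> D" "v = vertex (Mob E) x" using v unfolding vertices_def by auto
    have "kind (Mob E) (vertex (Mob E) x) = knd x"
    proof -
      consider "x \<in> W" | "x \<in> N - L" | "x \<in> L" using N_or_W x by auto
      then show ?thesis
      proof cases
        case 3
        then have "knd x = Labelled (s (turn x))" using s_turn_L by (auto simp: L_def s_def)
        moreover have "x \<in> N" "x \<notin> W" using 3 L_N N_or_W by auto
        ultimately show ?thesis using 3 X.kind_Mob[of x] x X_L X_r X_lab[of x] by (simp add: height_def)
      next
        case 2
        then show ?thesis using X.kind_Mob[of x] x X_L knd_black[OF 2] N_or_W(6)[of x] by auto
      next
        case 1
        then show ?thesis using X.kind_Mob[of x] x by (simp add: W_def)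
      qed
    qed
    then show ?thesis using x by (simp add: knd_def vertex_Mob_E)
  qed
  have flags: "flag t (id x) = flag (Mob E) x" if x: "x \<in> D" and fl: "flagged (Mob E) x" for x
  proof -
    have L: "y \<notin> L" if "y = x \<or> y = \<alpha> x" for y
    proof
      assume "y \<in> L"
      then have "y \<in> X.L" "y \<in> D" "y \<notin> X.W" using X_L L_N N_or_W by auto
      then have "\<exists>l. kind (Mob E) (vertex (Mob E) y) = Labelled l" using X.kind_Mob[of y] by auto
      then show False using fl that by (auto simp: flagged_def)
    qed
    have "flag (Mob E) x = height (\<alpha> x)" using X.flag_Mob X_lab[of "\<alpha> x"] X_r x by simp
    also have "\<dots> = flag t x"
    proof (cases "x \<in> N")
      case True
      then show ?thesis using s_turn_B(2)[of x] L N_or_W(6)[of x] by (auto simp: height_def)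
    next
      case False
      then have "x \<in> W" using x N_or_W by auto
      then show ?thesis using s_turn_B(1)[of "\<alpha> x"] L by (auto simp: height_def)
    qed
    finally show ?thesis by simp
  qed
  have "map_iso id (Mob E) t" by (simp add: map_iso_def mob_rot_E)
  moreover have "gmobile g (Mob E)" using X.gmobile_Mob has_genus_E by simp
  moreover have "id (mroot (Mob E)) = mroot t" by simp
  moreover have "darts (Mob E) = D" by simp
  ultimately show ?thesis unfolding mobile_rel_def using gm kinds flags by blast
qed

end

section \<open>Isomorphisms\<close>

lemma map_iso_comp: "map_iso f m m' \<Longrightarrow> map_iso g m' m'' \<Longrightarrow> map_iso (g \<circ> f) m m''"
  unfolding map_iso_def by (auto intro: bij_betw_trans dest: bij_betwE)

lemma map_iso_id: "map_iso id m m"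
  by (simp add: map_iso_def)

section \<open>Transport of cells along an isomorphism\<close>

locale cmap_iso = A: rotation_system m + B: rotation_system m'
  for m :: "('d, 'y) cmap_scheme" and m' :: "('e, 'z) cmap_scheme" +
  fixes h :: "'d \<Rightarrow> 'e"
  assumes iso: "map_iso h m m'"
begin

lemma bij: "bij_betw h (darts m) (darts m')"
  using iso by (simp add: map_iso_def)

lemma h_in: "x \<in> darts m \<Longrightarrow> h x \<in> darts m'"
  using bij bij_betwE by blast

lemma h_image: "h ` darts m = darts m'"
  using bij by (simp add: bij_betw_def)

lemma h_rot: "x \<in> darts m \<Longrightarrow> h (rot m x) = rot m' (h x)"
  and h_opp: "x \<in> darts m \<Longrightarrow> h (opp m x) = opp m' (h x)"
  using iso by (auto simp: map_iso_def)

lemma h_inv_rot: "x \<in> darts m \<Longrightarrow> h (inv (rot m) x) = inv (rot m') (h x)"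
  using h_rot[of "inv (rot m) x"] by (metis A.inv_rot(2) A.inv_rot_in B.inv_rot(1))

lemma h_face_step: "x \<in> darts m \<Longrightarrow> h (face_step m x) = face_step m' (h x)"
  by (simp add: face_step_def h_inv_rot h_opp)

lemma h_vertex: assumes "x \<in> darts m" shows "h ` vertex m x = vertex m' (h x)"
  unfolding vertex_def
proof (rule orbit_inverse)
  show "x \<in> orbit (rot m) x" using A.self_in_vertex unfolding vertex_def .
  show "\<And>y. y \<in> orbit (rot m) x \<Longrightarrow> rot m' (h y) = h (rot m y)"
    using A.vertex_in[OF assms] h_rot unfolding vertex_def by auto
qed

lemma h_face: assumes "x \<in> darts m" shows "h ` face m x = face m' (h x)"
  unfolding face_def
proof (rule orbit_inverse)
  show "x \<in> orbit (face_step m) x" using A.self_in_face unfolding face_def .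
  show "\<And>y. y \<in> orbit (face_step m) x \<Longrightarrow> face_step m' (h y) = h (face_step m y)"
    using A.face_in[OF assms] h_face_step unfolding face_def by auto
qed

lemma h_vertices: "(`) h ` vertices m = vertices m'"
  unfolding vertices_def h_image[symmetric] image_image by (rule image_cong) (auto simp: h_vertex)

lemma h_faces: "(`) h ` faces m = faces m'"
  unfolding faces_def h_image[symmetric] image_image by (rule image_cong) (auto simp: h_face)

lemma h_edges: "(`) h ` edges m = edges m'"
  unfolding edges_def h_image[symmetric] image_image by (rule image_cong) (auto simp: h_opp)

lemma card_image_sets:
  assumes "\<And>X. X \<in> \<X> \<Longrightarrow> X \<subseteq> darts m" shows "card ((`) h ` \<X>) = card \<X>"
proof (rule card_image, rule inj_onI)
  fix X Y assume "X \<in> \<X>" "Y \<in> \<X>" "h ` X = h ` Y"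
  then show "X = Y" using assms bij by (meson bij_betw_imp_inj_on inj_on_image_eq_iff)
qed

lemma vertices_sub: "v \<in> vertices m \<Longrightarrow> v \<subseteq> darts m"
  and faces_sub: "F \<in> faces m \<Longrightarrow> F \<subseteq> darts m"
  and edges_sub: "e \<in> edges m \<Longrightarrow> e \<subseteq> darts m"
  using A.vertex_in A.face_in by (auto simp: vertices_def faces_def edges_def)

lemma card_cells: "card (vertices m') = card (vertices m)" "card (faces m') = card (faces m)"
  "card (edges m') = card (edges m)"
  using card_image_sets[of "vertices m"] card_image_sets[of "faces m"] card_image_sets[of "edges m"]
    vertices_sub faces_sub edges_sub h_vertices h_faces h_edges by metis+

lemma has_genus_iff: "has_genus m' g \<longleftrightarrow> has_genus m g"
  by (simp add: has_genus_def card_cells)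

definition h' :: "'e \<Rightarrow> 'd" where "h' = inv_into (darts m) h"

lemma h'_h [simp]: "x \<in> darts m \<Longrightarrow> h' (h x) = x"
  unfolding h'_def using bij by (simp add: bij_betw_def)

lemma h_h' [simp]: "y \<in> darts m' \<Longrightarrow> h (h' y) = y" and h'_in: "y \<in> darts m' \<Longrightarrow> h' y \<in> darts m"
  unfolding h'_def using h_image by (metis f_inv_into_f) (metis h_image inv_into_into)

lemma h'_image: "X \<subseteq> darts m \<Longrightarrow> h' ` h ` X = X"
  unfolding image_image by (auto simp: subset_iff image_iff)

lemma iso_inv: "map_iso h' m' m"
  unfolding map_iso_def
proof (intro conjI ballI)
  show "bij_betw h' (darts m') (darts m)" unfolding h'_def using bij by (rule bij_betw_inv_into)
  fix x assume x: "x \<in> darts m'"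
  show "h' (rot m' x) = rot m (h' x)" using h_rot[of "h' x"] h'_in x by (metis h'_h h_h' A.rot_in)
  show "h' (opp m' x) = opp m (h' x)" using h_opp[of "h' x"] h'_in x by (metis h'_h h_h' A.opp_in)
qed

end

section \<open>Isomorphism as an equivalence relation\<close>

definition emap_iso :: "('d \<Rightarrow> 'd) \<Rightarrow> 'd emap \<Rightarrow> 'd emap \<Rightarrow> bool" where
  "emap_iso f m m' \<longleftrightarrow> map_iso f m m' \<and> (\<forall>F\<in>faces m. fcol m' (f ` F) = fcol m F) \<and>
    f (root m) = root m' \<and> f ` point m = point m'"

definition mobile_iso :: "('d \<Rightarrow> 'd) \<Rightarrow> 'd mobile \<Rightarrow> 'd mobile \<Rightarrow> bool" where
  "mobile_iso f t t' \<longleftrightarrow> map_iso f t t' \<and> (\<forall>v\<in>vertices t. kind t' (f ` v) = kind t v) \<and>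
    (\<forall>x\<in>darts t. flagged t x \<longrightarrow> flag t' (f x) = flag t x) \<and> f (mroot t) = mroot t'"

lemma emap_rel_iff: "(m, m') \<in> emap_rel \<longleftrightarrow> rp_eulerian_map m \<and> rp_eulerian_map m' \<and> (\<exists>f. emap_iso f m m')"
  by (simp add: emap_rel_def emap_iso_def)

lemma mobile_rel_iff:
  "(t, t') \<in> mobile_rel \<longleftrightarrow> (\<exists>g. gmobile g t) \<and> (\<exists>g. gmobile g t') \<and> (\<exists>f. mobile_iso f t t')"
  by (simp add: mobile_rel_def mobile_iso_def)

lemma rp_rotation_system: "rp_eulerian_map m \<Longrightarrow> rotation_system m"
  using is_map_rotation_system by (auto simp: rp_eulerian_map_def eulerian_map_def)

lemma gmobile_rotation_system: "gmobile g t \<Longrightarrow> rotation_system t"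
  using is_map_rotation_system by (auto simp: gmobile_def gtree_def)

lemma emap_iso_inv:
  assumes "rp_eulerian_map m" "rp_eulerian_map m'" "emap_iso f m m'"
  shows "emap_iso (inv_into (darts m) f) m' m"
proof -
  interpret cmap_iso m m' f
    using assms rp_rotation_system by (auto simp: emap_iso_def cmap_iso_def cmap_iso_axioms_def)
  have "fcol m (h' ` F) = fcol m' F" if F: "F \<in> faces m'" for F
  proof -
    obtain G where "G \<in> faces m" "F = f ` G" using F h_faces by blast
    then show ?thesis using h'_image[OF faces_sub] assms(3) by (simp add: emap_iso_def)
  qed
  moreover have "h' (root m') = root m"
    using assms h'_h[of "root m"] by (auto simp: emap_iso_def rp_eulerian_map_def)
  moreover have "h' ` point m' = point m"
    using assms h'_image[OF vertices_sub, of "point m"] by (auto simp: emap_iso_def rp_eulerian_map_def)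
  ultimately have "emap_iso h' m' m" using iso_inv by (simp add: emap_iso_def)
  then show ?thesis unfolding h'_def .
qed

lemma equiv_emap_rel: "equiv {m. rp_eulerian_map m} emap_rel"
proof (rule equivI)
  show "refl_on {m. rp_eulerian_map m} emap_rel"
  proof (rule refl_onI)
    fix m :: "'d emap" assume m: "m \<in> {m. rp_eulerian_map m}"
    have "emap_iso id m m" by (simp add: emap_iso_def map_iso_id)
    then show "(m, m) \<in> emap_rel" using m by (auto simp: emap_rel_iff)
  qed
  show "sym emap_rel" by (rule symI) (use emap_iso_inv in \<open>auto simp: emap_rel_iff\<close>)
  show "trans emap_rel"
  proof (rule transI)
    fix m m' m'' :: "'d emap" assume "(m, m') \<in> emap_rel" "(m', m'') \<in> emap_rel"
    then obtain f f' where *: "rp_eulerian_map m" "rp_eulerian_map m'" "rp_eulerian_map m''"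
      "emap_iso f m m'" "emap_iso f' m' m''" by (auto simp: emap_rel_iff)
    interpret cmap_iso m m' f
      using * rp_rotation_system by (auto simp: emap_iso_def cmap_iso_def cmap_iso_axioms_def)
    have "emap_iso (f' \<circ> f) m m''"
      unfolding emap_iso_def
    proof (intro conjI ballI)
      show "map_iso (f' \<circ> f) m m''" using * map_iso_comp by (auto simp: emap_iso_def)
      show "fcol m'' ((f' \<circ> f) ` F) = fcol m F" if "F \<in> faces m" for F
      proof -
        have "f ` F \<in> faces m'" using that h_faces by blast
        then have "fcol m'' (f' ` f ` F) = fcol m F" using * that by (simp add: emap_iso_def)
        then show ?thesis unfolding image_comp .
      qed
      have "f' ` f ` point m = point m''" using * by (simp add: emap_iso_def)
      then show "(f' \<circ> f) ` point m = point m''" unfolding image_comp .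
    qed (use * in \<open>auto simp: emap_iso_def\<close>)
    then show "(m, m'') \<in> emap_rel" using * by (auto simp: emap_rel_iff)
  qed
qed (auto simp: emap_rel_iff)

text \<open>Flags are compared on flagged darts only, so inverting and composing isomorphisms
  requires that being flagged is invariant.\<close>

lemma mobile_iso_flagged:
  assumes "cmap_iso t t' f" "mobile_iso f t t'" "x \<in> darts t"
  shows "flagged t' (f x) \<longleftrightarrow> flagged t x"
proof -
  interpret cmap_iso t t' f by fact
  have k: "kind t' (vertex t' (f y)) = kind t (vertex t y)" if y: "y \<in> darts t" for y
    using assms(2) h_vertex[OF y] y by (auto simp: mobile_iso_def vertices_def)
  show ?thesis using k[of x] k[of "opp t x"] h_opp[of x] assms(3) by (simp add: flagged_def)
qed

lemma mobile_iso_inv: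
  assumes "gmobile g t" "gmobile g' t'" "mobile_iso f t t'"
  shows "\<exists>f'. mobile_iso f' t' t"
proof -
  interpret cmap_iso t t' f
    using assms gmobile_rotation_system by (auto simp: mobile_iso_def cmap_iso_def cmap_iso_axioms_def)
  have "kind t (h' ` v) = kind t' v" if v: "v \<in> vertices t'" for v
  proof -
    obtain u where "u \<in> vertices t" "v = f ` u" using v h_vertices by blast
    then show ?thesis using h'_image[OF vertices_sub] assms(3) by (simp add: mobile_iso_def)
  qed
  moreover have "flag t (h' x) = flag t' x" if x: "x \<in> darts t'" "flagged t' x" for x
  proof -
    have "flagged t (h' x)"
      using mobile_iso_flagged[OF cmap_iso_axioms assms(3), of "h' x"] x h'_in[of x] by simp
    then have "flag t' (f (h' x)) = flag t (h' x)"
      using assms(3) h'_in[OF x(1)] unfolding mobile_iso_def by blast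
    then show ?thesis using x by simp
  qed
  moreover have "h' (mroot t') = mroot t"
    using assms h'_h[of "mroot t"] by (auto simp: mobile_iso_def gmobile_def)
  ultimately have "mobile_iso h' t' t" using iso_inv by (simp add: mobile_iso_def)
  then show ?thesis by blast
qed

lemma equiv_mobile_rel: "equiv {t. \<exists>g. gmobile g t} mobile_rel"
proof (rule equivI)
  show "refl_on {t. \<exists>g. gmobile g t} mobile_rel"
  proof (rule refl_onI)
    fix t :: "'d mobile" assume t: "t \<in> {t. \<exists>g. gmobile g t}"
    have "mobile_iso id t t" by (simp add: mobile_iso_def map_iso_id)
    then show "(t, t) \<in> mobile_rel" using t by (auto simp: mobile_rel_iff)
  qed
  show "sym mobile_rel" by (rule symI) (use mobile_iso_inv in \<open>auto simp: mobile_rel_iff\<close>)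
  show "trans mobile_rel"
  proof (rule transI)
    fix t t' t'' :: "'d mobile" assume "(t, t') \<in> mobile_rel" "(t', t'') \<in> mobile_rel"
    then obtain f f' g g' g'' where *: "gmobile g t" "gmobile g' t'" "gmobile g'' t''"
      "mobile_iso f t t'" "mobile_iso f' t' t''" by (auto simp: mobile_rel_iff)
    interpret cmap_iso t t' f
      using * gmobile_rotation_system by (auto simp: mobile_iso_def cmap_iso_def cmap_iso_axioms_def)
    have "mobile_iso (f' \<circ> f) t t''"
      unfolding mobile_iso_def
    proof (intro conjI ballI impI)
      show "map_iso (f' \<circ> f) t t''" using * map_iso_comp by (auto simp: mobile_iso_def)
      show "kind t'' ((f' \<circ> f) ` v) = kind t v" if "v \<in> vertices t" for v
      proof -
        have "f ` v \<in> vertices t'" using that h_vertices by blast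
        then have "kind t'' (f' ` f ` v) = kind t v" using * that by (simp add: mobile_iso_def)
        then show ?thesis unfolding image_comp .
      qed
      show "flag t'' ((f' \<circ> f) x) = flag t x" if "x \<in> darts t" "flagged t x" for x
        using * that h_in[of x] mobile_iso_flagged[OF cmap_iso_axioms *(4), of x] by (simp add: mobile_iso_def)
    qed (use * in \<open>auto simp: mobile_iso_def\<close>)
    then show "(t, t'') \<in> mobile_rel" using * by (auto simp: mobile_rel_iff)
  qed
qed (auto simp: mobile_rel_iff)

section \<open>Isomorphic maps have isomorphic mobiles\<close>

locale eulerian_iso = A: eulerian m + B: eulerian m' for m m' :: "'d emap" +
  fixes h :: "'d \<Rightarrow> 'd"
  assumes emap_iso: "emap_iso h m m'"
begin

sublocale cmap_iso m m' h
  by standard (use emap_iso in \<open>simp add: emap_iso_def\<close>)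

lemma h_W: "x \<in> darts m \<Longrightarrow> h x \<in> B.W \<longleftrightarrow> x \<in> A.W"
  using emap_iso A.W_iff[of x] B.W_iff[of "h x"] h_in[of x] h_face[of x]
  by (auto simp: emap_iso_def faces_def)

lemma h_N: "x \<in> darts m \<Longrightarrow> h x \<in> B.N \<longleftrightarrow> x \<in> A.N"
  using h_W[of x] A.N_or_W(1)[of x] B.N_or_W(1)[of "h x"] h_in by auto

lemma h_path: "(u, v) \<in> arcs m ^^ k \<Longrightarrow> (h ` u, h ` v) \<in> arcs m' ^^ k"
proof (induction k arbitrary: v)
  case (Suc k)
  then obtain w where w: "(u, w) \<in> arcs m ^^ k" "(w, v) \<in> arcs m" by auto
  then obtain x where x: "x \<in> A.W" "w = vertex m x" "v = vertex m (opp m x)"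
    unfolding arcs_def A.W_def by auto
  then have D: "x \<in> darts m" using A.N_or_W by auto
  have "(h ` w, h ` v) \<in> arcs m'"
    using B.arc[of "h x"] h_W[OF D] x D h_vertex h_opp by simp
  then show ?case using Suc.IH w by auto
qed auto

text \<open>Images of paths are paths, so distances cannot grow; applied to the inverse isomorphism
  as well, this gives equality.\<close>

lemma lab_h_le: assumes "x \<in> darts m" shows "B.lab (h x) \<le> A.lab x"
proof -
  have "(point m', vertex m' (h x)) \<in> arcs m' ^^ nat (A.lab x)"
    using h_path[OF A.lab_path[OF assms]] h_vertex[OF assms] emap_iso by (simp add: emap_iso_def)
  then show ?thesis using B.lab_le A.lab_nonneg[of x] by fastforce
qed

lemma inverse_iso: "eulerian_iso m' m h'"
  by standard (use emap_iso_inv[OF A.rp B.rp emap_iso] in \<open>simp add: h'_def\<close>)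

lemma lab_h: assumes "x \<in> darts m" shows "B.lab (h x) = A.lab x"
proof -
  have "A.lab (h' (h x)) \<le> B.lab (h x)"
    using eulerian_iso.lab_h_le[OF inverse_iso, of "h x"] h_in[OF assms] .
  then show ?thesis using lab_h_le[OF assms] assms by simp
qed

lemma s_h: "x \<in> darts m \<Longrightarrow> B.s (h x) = A.s x"
  using lab_h[of "opp m x"] h_opp[of x] by (simp add: A.s_def B.s_def)

lemma h_L: "x \<in> darts m \<Longrightarrow> h x \<in> B.L \<longleftrightarrow> x \<in> A.L"
  by (simp add: A.L_def B.L_def h_N lab_h s_h)

lemma h_mob_rot:
  assumes x: "x \<in> darts m"
  shows "h (mob_rot m x) = mob_rot m' (h x)"
proof -
  consider "x \<in> A.W" | "x \<in> A.N - A.L" | "x \<in> A.L" using x A.N_or_W by auto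
  then show ?thesis
  proof cases
    case 1
    then show ?thesis using A.mob_rot_W B.mob_rot_W h_W h_face_step x by auto
  next
    case 2
    obtain j where j: "walk (face_step m) (\<lambda>z. z \<notin> A.L) x j" "face_step m j = mob_rot m x" "mob_rot m x \<notin> A.L"
      using A.return_phi[OF 2] by blast
    have jD: "j \<in> darts m" using walk_in[OF j(1), of "darts m"] x by (auto simp: image_subset_iff)
    have mD: "mob_rot m x \<in> darts m" using j(2) jD A.face_step_in by metis
    have w: "walk (face_step m') (\<lambda>z. z \<notin> B.L) (h x) (h j)"
      using j(1) by (rule walk_hom[where N = "darts m"]) (use x h_face_step h_L in auto)
    have "h x \<in> B.N - B.L" using 2 h_N h_L x by auto
    then obtain i where i: "walk (face_step m') (\<lambda>z. z \<notin> B.L) (h x) i" "face_step m' i = mob_rot m' (h x)"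
      "mob_rot m' (h x) \<notin> B.L" using B.return_phi by blast
    have "face_step m' (h j) = h (mob_rot m x)" using h_face_step[OF jD] j by simp
    moreover have "h (mob_rot m x) \<notin> B.L" using h_L[OF mD] j by simp
    ultimately show ?thesis using walk_stop_unique[OF w _ i(1)] i by auto
  next
    case 3
    obtain j where j: "walk (rot m \<circ> rot m) (\<lambda>z. z \<in> A.L) x j" "(rot m \<circ> rot m) j = mob_rot m x" "mob_rot m x \<in> A.L"
      using A.return_chi[OF 3] by blast
    have jD: "j \<in> darts m" using walk_in[OF j(1), of "darts m"] x by (auto simp: image_subset_iff)
    have w: "walk (rot m' \<circ> rot m') (\<lambda>z. z \<in> B.L) (h x) (h j)"
      using j(1) by (rule walk_hom[where N = "darts m"]) (use x h_rot h_L in auto)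
    have "h x \<in> B.L" using 3 h_L x by auto
    then obtain i where i: "walk (rot m' \<circ> rot m') (\<lambda>z. z \<in> B.L) (h x) i" "(rot m' \<circ> rot m') i = mob_rot m' (h x)"
      "mob_rot m' (h x) \<in> B.L" using B.return_chi by blast
    have "(rot m' \<circ> rot m') (h j) = h (mob_rot m x)" using h_rot[of j] h_rot[of "rot m j"] jD j(2) by simp
    moreover have "h (mob_rot m x) \<in> B.L" using h_L[of "mob_rot m x"] j A.L_N A.N_or_W by auto
    ultimately show ?thesis using walk_stop_unique[OF w _ i(1)] i by auto
  qed
qed

lemma r_h: "B.r = A.r"
  using A.r_eq B.r_eq lab_h[of "opp m (root m)"] h_opp[of "root m"] emap_iso A.root_W A.N_or_W(5)
  by (simp add: emap_iso_def)

lemma Mob_iso: "mobile_iso h (Mob m) (Mob m')"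
proof -
  have iso: "map_iso h (Mob m) (Mob m')"
    using bij h_mob_rot h_opp by (simp add: map_iso_def)
  interpret M: cmap_iso "Mob m" "Mob m'" h by standard (rule iso)
  have "kind (Mob m') (h ` v) = kind (Mob m) v" if v: "v \<in> vertices (Mob m)" for v
  proof -
    obtain x where x: "x \<in> darts m" "v = vertex (Mob m) x" using v unfolding vertices_def by auto
    then have "h ` v = vertex (Mob m') (h x)" using M.h_vertex by simp
    then show ?thesis using x A.kind_Mob[of x] B.kind_Mob[of "h x"] h_in h_W h_L lab_h r_h by simp
  qed
  moreover have "flag (Mob m') (h x) = flag (Mob m) x" if x: "x \<in> darts m" for x
    using A.flag_Mob B.flag_Mob lab_h[of "opp m x"] h_opp[of x] r_h x by simp
  ultimately show ?thesis using iso emap_iso by (simp add: mobile_iso_def emap_iso_def)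
qed

end

section \<open>Isomorphic mobiles come from isomorphic maps\<close>

locale Mob_isomorphic = A: eulerian m + B: eulerian m' for m m' :: "'d emap" +
  fixes h :: "'d \<Rightarrow> 'd"
  assumes mobile_iso: "mobile_iso h (Mob m) (Mob m')"
begin

sublocale M: cmap_iso "Mob m" "Mob m'" h
  by standard (use mobile_iso in \<open>simp add: mobile_iso_def\<close>)

lemmas h_in = M.h_in[simplified] and h_opp = M.h_opp[simplified] and h_mob_rot = M.h_rot[simplified]

lemma kind_h: assumes "x \<in> darts m"
  shows "kind (Mob m') (vertex (Mob m') (h x)) = kind (Mob m) (vertex (Mob m) x)"
  using mobile_iso M.h_vertex[of x] assms by (auto simp: mobile_iso_def vertices_def)

lemma h_W: "x \<in> darts m \<Longrightarrow> h x \<in> B.W \<longleftrightarrow> x \<in> A.W"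
  using kind_h[of x] A.kind_Mob[of x] B.kind_Mob[of "h x"] h_in[of x] by (auto split: if_splits)

lemma h_L: "x \<in> darts m \<Longrightarrow> h x \<in> B.L \<longleftrightarrow> x \<in> A.L"
  using kind_h[of x] A.kind_Mob[of x] B.kind_Mob[of "h x"] h_in[of x] A.L_N B.L_N A.N_not_W[of x] B.N_not_W[of "h x"]
  by (auto split: if_splits)

lemma h_N: "x \<in> darts m \<Longrightarrow> h x \<in> B.N \<longleftrightarrow> x \<in> A.N"
  using h_W[of x] A.N_or_W(1)[of x] B.N_or_W(1)[of "h x"] h_in by auto

text \<open>Each mobile has been shifted by its own root label, hence the two constants.
  \<open>F\<close> only compares heights with each other, so they cancel.\<close>

lemma s_h: assumes "x \<in> A.N" shows "B.s (h x) - B.r = A.s x - A.r"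
proof -
  have x: "x \<in> darts m" "x \<notin> A.W" using assms A.N_or_W A.N_not_W by auto
  show ?thesis
  proof (cases "x \<in> A.L")
    case True
    then have "B.lab (h x) - B.r = A.lab x - A.r"
      using kind_h[OF x(1)] A.kind_Mob[of x] B.kind_Mob[of "h x"] x h_in[of x] h_W[of x] h_L[of x] by simp
    then show ?thesis using True h_L[OF x(1)] by (simp add: A.L_def B.L_def)
  next
    case False
    have "opp m x \<in> A.W" using assms by simp
    then have "flagged (Mob m) x"
      using False x A.kind_Mob[of x] A.kind_Mob[of "opp m x"] by (simp add: flagged_def)
    then have "flag (Mob m') (h x) = flag (Mob m) x" using mobile_iso x by (simp add: mobile_iso_def)
    then show ?thesis by (simp add: A.flag_Mob B.flag_Mob A.s_def B.s_def)
  qed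
qed

lemma s_h_mono: assumes "x \<in> A.N" "y \<in> A.N"
  shows "B.s (h x) \<le> B.s (h y) \<longleftrightarrow> A.s x \<le> A.s y" "B.s (h x) < B.s (h y) \<longleftrightarrow> A.s x < A.s y"
    "B.s (h x) = B.s (h y) \<longleftrightarrow> A.s x = A.s y"
  using s_h[OF assms(1)] s_h[OF assms(2)] by auto

lemma h_theta: assumes "x \<in> A.N" shows "h (A.\<theta> x) = B.\<theta> (h x)"
proof -
  have x: "x \<in> darts m" "h x \<in> B.N" using assms A.N_or_W h_N by auto
  have "A.\<theta> x = opp m (mob_rot m (opp m x))" using A.turn_theta[OF assms] by (simp add: A.T.turn_def)
  moreover have "B.\<theta> (h x) = opp m' (mob_rot m' (opp m' (h x)))" using B.turn_theta[OF x(2)] by (simp add: B.T.turn_def)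
  moreover have "mob_rot m (opp m x) \<in> darts m" using A.T.rot_in[of "opp m x"] x by simp
  ultimately show ?thesis using h_opp h_mob_rot x by simp
qed

lemma h_kappa: "x \<in> A.N \<Longrightarrow> h (A.\<kappa> x) = B.\<kappa> (h x)"
  using h_theta[of "mob_rot m x"] h_mob_rot[of x] A.N_or_W A.in_N by (simp add: A.\<kappa>_def B.\<kappa>_def)

lemma h_F: assumes "n \<in> A.N" "A.F n y" shows "B.F (h n) (h y)"
proof -
  obtain k where k: "y \<in> A.N" "walk A.\<kappa> (\<lambda>z. A.s z \<le> A.s n) n k"
     "A.s (A.\<kappa> k) = A.s n \<and> y = mob_rot m k \<or>
          A.s (A.\<kappa> k) < A.s n \<and> walk A.\<kappa> (\<lambda>z. A.s z < A.s n) y n \<and> A.s y < A.s n"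
    using assms(2) unfolding A.F_def by blast
  have kN: "k \<in> A.N" using walk_in[OF k(2) A.into(3) assms(1)] .
  have w: "walk B.\<kappa> (\<lambda>z. B.s z \<le> B.s (h n)) (h n) (h k)"
    using k(2) A.into(3) assms(1) by (rule walk_hom) (use h_kappa s_h_mono assms in auto)
  have y: "h y \<in> B.N" using h_N k A.N_or_W by auto
  have \<kappa>: "B.\<kappa> (h k) = h (A.\<kappa> k)" "A.\<kappa> k \<in> A.N" using h_kappa kN A.in_N by auto
  from k(3) show ?thesis
  proof
    assume *: "A.s (A.\<kappa> k) = A.s n \<and> y = mob_rot m k"
    then have "h y = mob_rot m' (h k)" using h_mob_rot kN A.N_or_W by auto
    moreover have "B.s (B.\<kappa> (h k)) = B.s (h n)" using * \<kappa> s_h_mono(3)[OF \<kappa>(2) assms(1)] by simp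
    ultimately show ?thesis using w y unfolding B.F_def by blast
  next
    assume *: "A.s (A.\<kappa> k) < A.s n \<and> walk A.\<kappa> (\<lambda>z. A.s z < A.s n) y n \<and> A.s y < A.s n"
    then have "walk A.\<kappa> (\<lambda>z. A.s z < A.s n) y n" by blast
    then have "walk B.\<kappa> (\<lambda>z. B.s z < B.s (h n)) (h y) (h n)"
      using A.into(3) k(1) by (rule walk_hom) (use h_kappa s_h_mono assms in auto)
    moreover have "B.s (B.\<kappa> (h k)) < B.s (h n)" "B.s (h y) < B.s (h n)"
      using * \<kappa> s_h_mono(2)[OF \<kappa>(2) assms(1)] s_h_mono(2)[OF k(1) assms(1)] by simp_all
    ultimately show ?thesis using w y unfolding B.F_def by blast
  qed
qed

text \<open>On a black face the transported successor and the successor in \<open>m'\<close> both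
  satisfy \<open>B.F\<close>, which is single-valued.\<close>

lemma h_face_step: assumes "x \<in> darts m" shows "h (face_step m x) = face_step m' (h x)"
proof (cases "x \<in> A.N")
  case True
  then have "h x \<in> B.N" using h_N assms by simp
  then show ?thesis using B.F_unique B.F_phi h_F[OF True A.F_phi[OF True]] by blast
next
  case False
  then have "x \<in> A.W" using assms A.N_or_W by auto
  then show ?thesis using A.mob_rot_W[of x] B.mob_rot_W[of "h x"] h_W h_mob_rot assms by metis
qed

lemma h_rot: assumes "x \<in> darts m" shows "h (rot m x) = rot m' (h x)"
proof -
  have "h x = h (face_step m (opp m (rot m x)))" by simp
  also have "\<dots> = face_step m' (opp m' (h (rot m x)))" using h_face_step[of "opp m (rot m x)"] h_opp[of "rot m x"] assms by simp
  finally have "face_step m' (opp m' (h (rot m x))) = face_step m' (opp m' (rot m' (h x)))" by simp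
  then have "opp m' (h (rot m x)) = opp m' (rot m' (h x))"
    using permutes_inj[OF B.face_step_perm] by (meson injD)
  then show ?thesis using B.opp_opp by metis
qed

lemma Mob_reflects_iso: "emap_iso h m m'"
proof -
  have iso: "map_iso h m m'"
    using M.bij h_rot h_opp by (simp add: map_iso_def)
  interpret H: cmap_iso m m' h by standard (rule iso)
  have "fcol m' (h ` G) = fcol m G" if G: "G \<in> faces m" for G
  proof -
    obtain x where x: "x \<in> darts m" "G = face m x" using G unfolding faces_def by auto
    then have "fcol m' (face m' (h x)) = White \<longleftrightarrow> fcol m (face m x) = White"
      using A.W_iff[of x] B.W_iff[of "h x"] h_W h_in by auto
    then show ?thesis using x H.h_face by (cases "fcol m (face m x)"; cases "fcol m' (face m' (h x))") auto
  qed
  \<comment> \<open>The mobile keeps no trace of the pointed vertex itself, which is recognised as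
    the vertex without incoming increasing edge.\<close>
  moreover have "h ` point m = point m'"
  proof (rule ccontr)
    obtain x where x: "x \<in> darts m" "point m = vertex m x" using A.point_dart .
    assume "h ` point m \<noteq> point m'"
    then obtain n where n: "n \<in> B.L" "n \<in> h ` vertex m x"
      using B.L_in_vertex[of "h x"] x h_in H.h_vertex by auto
    then obtain y where y: "y \<in> vertex m x" "n = h y" by auto
    then have "y \<in> A.L" using n h_L A.vertex_in x by blast
    then show False using A.L_not_point A.vertex_eq y x by metis
  qed
  ultimately show ?thesis using iso mobile_iso by (simp add: mobile_iso_def emap_iso_def)
qed

end

section \<open>Passage to isomorphism classes\<close>

lemma Mob_rel:
  assumes "(m, m') \<in> emap_rel" "has_genus m g"
  shows "(Mob m, Mob m') \<in> mobile_rel" "has_genus m' g"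
proof -
  obtain h where h: "rp_eulerian_map m" "rp_eulerian_map m'" "emap_iso h m m'"
    using assms(1) by (auto simp: emap_rel_iff)
  interpret eulerian_iso m m' h
    using h by (simp add: eulerian_iso_def eulerian_def eulerian_iso_axioms_def)
  show g: "has_genus m' g" using has_genus_iff assms(2) by simp
  show "(Mob m, Mob m') \<in> mobile_rel"
    using Mob_iso A.gmobile_Mob[OF assms(2)] B.gmobile_Mob[OF g] by (auto simp: mobile_rel_iff)
qed

lemma Mob_rel_reflect:
  assumes "rp_eulerian_map m" "rp_eulerian_map m'" "(Mob m, Mob m') \<in> mobile_rel"
  shows "(m, m') \<in> emap_rel"
proof -
  obtain h where "mobile_iso h (Mob m) (Mob m')" using assms(3) by (auto simp: mobile_rel_iff)
  then interpret Mob_isomorphic m m' h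
    using assms by (simp add: Mob_isomorphic_def eulerian_def Mob_isomorphic_axioms_def)
  show ?thesis using Mob_reflects_iso assms by (auto simp: emap_rel_iff)
qed

lemma Mob_surj:
  assumes "t \<in> gmobiles g n"
  shows "\<exists>m\<in>rp_eulerian_maps g n. (Mob m, t) \<in> mobile_rel"
proof -
  interpret mobile_tree g t using assms by (simp add: mobile_tree_def gmobiles_def)
  show ?thesis
    using rp_eulerian_E has_genus_E edges_E Mob_E assms
    by (intro bexI[of _ E]) (auto simp: rp_eulerian_maps_def gmobiles_def)
qed

text \<open>\<open>P\<close> sees kind and degree together, so one statement transports all three
  counts of the theorem.\<close>

lemma mobile_iso_card:
  assumes "(t, t') \<in> mobile_rel"
  shows "card {v \<in> vertices t'. P (kind t' v) (card v)} = card {v \<in> vertices t. P (kind t v) (card v)}"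
proof -
  obtain f where *: "\<exists>g. gmobile g t" "\<exists>g. gmobile g t'" "mobile_iso f t t'"
    using assms by (auto simp: mobile_rel_iff)
  interpret cmap_iso t t' f
    using * gmobile_rotation_system by (auto simp: mobile_iso_def cmap_iso_def cmap_iso_axioms_def)
  have c: "card (f ` v) = card v" if "v \<in> vertices t" for v
    using vertices_sub[OF that] bij by (meson bij_betw_imp_inj_on card_image inj_on_subset)
  have "{v \<in> vertices t'. P (kind t' v) (card v)} = (`) f ` {v \<in> vertices t. P (kind t v) (card v)}"
    unfolding h_vertices[symmetric] using c *(3) by (auto simp: mobile_iso_def)
  then show ?thesis using card_image_sets[of "{v \<in> vertices t. P (kind t v) (card v)}"] vertices_sub by auto
qed

lemma Mob_class_eq:
  assumes "m \<in> rp_eulerian_maps g n"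
  shows "Mob_class (emap_rel `` {m}) = mobile_rel `` {Mob m}"
proof -
  have m: "rp_eulerian_map m" "has_genus m g" using assms by (auto simp: rp_eulerian_maps_def)
  have *: "mobile_rel `` {Mob m'} = mobile_rel `` {Mob m}" if "(m, m') \<in> emap_rel" for m'
    using Mob_rel(1)[OF that m(2)] equiv_class_eq[OF equiv_mobile_rel] by metis
  moreover have "(m, m) \<in> emap_rel" using equiv_class_self[OF equiv_emap_rel] m by auto
  ultimately show ?thesis unfolding Mob_class_def by blast
qed

theorem theorem3:
  fixes g n :: nat
  shows "bij_betw Mob_class
           ((rp_eulerian_maps g n :: nat emap set) // emap_rel)
           ((gmobiles g n :: nat mobile set) // mobile_rel)
       \<and> (\<forall>C \<in> (rp_eulerian_maps g n :: nat emap set) // emap_rel.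
           \<forall>m \<in> C. \<forall>t \<in> Mob_class C.
             (\<forall>i. card {v \<in> vertices t. kind t v = Unlabelled White \<and> card v = i}
                = card {F \<in> faces m. fcol m F = White \<and> card F = i})
           \<and> card {v \<in> vertices t. kind t v = Unlabelled Black}
             = card {F \<in> faces m. fcol m F = Black}
           \<and> card {v \<in> vertices t. \<exists>l. kind t v = Labelled l} + 1 = card (vertices m))"
proof (intro conjI ballI)
  let ?M = "rp_eulerian_maps g n :: nat emap set" and ?T = "gmobiles g n :: nat mobile set"
  have Mob_in: "Mob m \<in> ?T" if "m \<in> ?M" for m
  proof -
    interpret eulerian m using that by (simp add: eulerian_def rp_eulerian_maps_def)
    show ?thesis using that gmobile_Mob edges_Mob by (simp add: gmobiles_def rp_eulerian_maps_def)
  qed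
  show "bij_betw Mob_class (?M // emap_rel) (?T // mobile_rel)"
    unfolding bij_betw_def
  proof
    show "inj_on Mob_class (?M // emap_rel)"
    proof (rule inj_onI)
      fix C C' assume "C \<in> ?M // emap_rel" "C' \<in> ?M // emap_rel" and eq: "Mob_class C = Mob_class C'"
      then obtain m m' where m: "m \<in> ?M" "m' \<in> ?M" "C = emap_rel `` {m}" "C' = emap_rel `` {m'}"
        by (auto elim!: quotientE)
      then have "mobile_rel `` {Mob m} = mobile_rel `` {Mob m'}" using eq Mob_class_eq by metis
      moreover have "Mob m' \<in> {t. \<exists>g. gmobile g t}" using Mob_in[OF m(2)] by (auto simp: gmobiles_def)
      ultimately have "(Mob m, Mob m') \<in> mobile_rel" using eq_equiv_class[OF _ equiv_mobile_rel] by metis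
      then have "(m, m') \<in> emap_rel" using Mob_rel_reflect m by (auto simp: rp_eulerian_maps_def)
      then show "C = C'" using m equiv_class_eq[OF equiv_emap_rel] by metis
    qed
    show "Mob_class ` (?M // emap_rel) = ?T // mobile_rel"
    proof
      show "Mob_class ` (?M // emap_rel) \<subseteq> ?T // mobile_rel"
        by (auto elim!: quotientE simp: Mob_class_eq intro!: quotientI[OF Mob_in])
      show "?T // mobile_rel \<subseteq> Mob_class ` (?M // emap_rel)"
      proof
        fix K assume "K \<in> ?T // mobile_rel"
        then obtain t where t: "t \<in> ?T" "K = mobile_rel `` {t}" by (auto elim!: quotientE)
        obtain m where m: "m \<in> ?M" "(Mob m, t) \<in> mobile_rel" using Mob_surj[OF t(1)] by blast
        then have "K = Mob_class (emap_rel `` {m})"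
          using Mob_class_eq[OF m(1)] t equiv_class_eq[OF equiv_mobile_rel] by metis
        then show "K \<in> Mob_class ` (?M // emap_rel)" using m by (auto intro: quotientI)
      qed
    qed
  qed
  fix C m t assume "C \<in> ?M // emap_rel" "m \<in> C" "t \<in> Mob_class C"
  then obtain m0 where m0: "m0 \<in> ?M" "(m0, m) \<in> emap_rel" "t \<in> Mob_class (emap_rel `` {m0})"
    by (auto elim!: quotientE)
  then have t: "(Mob m0, t) \<in> mobile_rel" using Mob_class_eq[OF m0(1)] by auto
  have g: "has_genus m0 g" using m0 by (simp add: rp_eulerian_maps_def)
  \<comment> \<open>The counts are known for \<open>Mob m\<close>, whereas \<open>t\<close> is given
    through the representative \<open>m0\<close>; symmetry and transitivity bridge the two.\<close>
  have Mob0: "(Mob m0, Mob m) \<in> mobile_rel" using Mob_rel(1)[OF m0(2) g] .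
  have "equiv {t :: nat mobile. \<exists>g. gmobile g t} mobile_rel" by (rule equiv_mobile_rel)
  then have "sym (mobile_rel :: (nat mobile \<times> nat mobile) set)" "trans (mobile_rel :: (nat mobile \<times> nat mobile) set)"
    by (simp_all add: equiv_def)
  then have rel: "(Mob m, t) \<in> mobile_rel" using Mob0 t symD transD by metis
  interpret eulerian m using m0(2) by (simp add: eulerian_def emap_rel_iff)
  note card = mobile_iso_card[OF rel]
  show "\<forall>i. card {v \<in> vertices t. kind t v = Unlabelled White \<and> card v = i}
                = card {F \<in> faces m. fcol m F = White \<and> card F = i}"
  proof
    fix i
    have "{v \<in> vertices (Mob m). kind (Mob m) v = Unlabelled White \<and> card v = i}
        = {F \<in> faces m. fcol m F = White \<and> card F = i}"
    proof -
      have "{v \<in> vertices (Mob m). kind (Mob m) v = Unlabelled White} = {F \<in> faces m. fcol m F = White}"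
        using white_vertices white_faces by simp
      then show ?thesis by (auto simp: set_eq_iff)
    qed
    then show "card {v \<in> vertices t. kind t v = Unlabelled White \<and> card v = i}
        = card {F \<in> faces m. fcol m F = White \<and> card F = i}"
      using card[of "\<lambda>k c. k = Unlabelled White \<and> c = i"] by simp
  qed
  show "card {v \<in> vertices t. kind t v = Unlabelled Black} = card {F \<in> faces m. fcol m F = Black}"
    using card[of "\<lambda>k c. k = Unlabelled Black"] card_black by simp
  show "card {v \<in> vertices t. \<exists>l. kind t v = Labelled l} + 1 = card (vertices m)"
    using card[of "\<lambda>k c. \<exists>l. k = Labelled l"] card_labelled by simp
qed

end
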